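(* Let $c\in\mathbb{C}$, $c\neq0$, let $\tau_1=0$, $\tau_2=1$, $\tau_3=-1$, and let $\sigma_1,\sigma_2\in\mathbb{C}$ be constants, not necessarily distinct, with $\sigma_j\ne\tau_k$ for all $j,k$. Then all transcendental meromorphic solutions on $\mathbb{C}$ of the equation $$S(u,z)^2=c\,\frac{(u-\sigma_1)^2(u-\sigma_2)^2}{(u-\tau_1)^2(u-\tau_2)(u-\tau_3)}$$ are elliptic functions. Moreover, such solutions exist if and only if $$\{\sigma_1,\sigma_2\}=\left\{\frac{i}{2},\,-\frac{i}{2}\right\},$$ and in this case all the transcendental meromorphic solutions are given by $$u(z)=-\frac{1}{2L}\,\frac{\left(8\wp(z-z_0;g_2,g_3)+L^2\right)^2\wp'(z-z_0;g_2,g_3)}{\wp(z-z_0;g_2,g_3)\left(64\wp(z-z_0;g_2,g_3)^2+L^4\right)},$$ where $L$ is any complex number with $c=9L^4/4$, $g_2=-c/36$, $g_3=0$, and $z_0\in\mathbb{C}$ is arbitrary.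
   Context: For a nonconstant meromorphic function $u$, the Schwarzian derivative is $S(u,z)=\left(\frac{u''}{u'}\right)'-\frac12\left(\frac{u''}{u'}\right)^2=\frac{u'''}{u'}-\frac32\left(\frac{u''}{u'}\right)^2$. "Transcendental" means not rational. $\wp(z;g_2,g_3)$ is the Weierstrass elliptic function with invariants $g_2,g_3$, satisfying $\wp'^2=4\wp^3-g_2\wp-g_3$. *)

theory Defs
  imports "HOL-Complex_Analysis.Complex_Analysis"
begin

text \<open>
  A meromorphic function on the plane is represented by any total function that is
  \<open>meromorphic_on UNIV\<close>. Its values on a sparse (i.e. closed and discrete) set carry no
  information, so identities between meromorphic functions are stated with
  \<open>\<forall>\<^sub>\<approx>z\<in>UNIV\<close>, i.e. for all \<open>z\<close> outside a sparse set.
\<close>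

definition rational_function :: "(complex \<Rightarrow> complex) \<Rightarrow> bool" where
  "rational_function u \<longleftrightarrow>
     (\<exists>p q :: complex poly. q \<noteq> 0 \<and> (\<forall>\<^sub>\<approx>z\<in>UNIV. u z = poly p z / poly q z))"

definition transcendental_meromorphic :: "(complex \<Rightarrow> complex) \<Rightarrow> bool" where
  "transcendental_meromorphic u \<longleftrightarrow> u meromorphic_on UNIV \<and> \<not> rational_function u"

definition schwarzian :: "(complex \<Rightarrow> complex) \<Rightarrow> complex \<Rightarrow> complex" where
  "schwarzian u z =
     deriv (\<lambda>w. deriv (deriv u) w / deriv u w) z - (1/2) * (deriv (deriv u) z / deriv u z)\<^sup>2"

definition schwarzian_ode_solution ::
  "complex \<Rightarrow> complex \<Rightarrow> complex \<Rightarrow> complex \<Rightarrow> complex \<Rightarrow> complex \<Rightarrow> (complex \<Rightarrow> complex) \<Rightarrow> bool" where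
  "schwarzian_ode_solution c \<sigma>\<^sub>1 \<sigma>\<^sub>2 \<tau>\<^sub>1 \<tau>\<^sub>2 \<tau>\<^sub>3 u \<longleftrightarrow>
     (\<forall>\<^sub>\<approx>z\<in>UNIV. (schwarzian u z)\<^sup>2 =
        c * (((u z - \<sigma>\<^sub>1)\<^sup>2 * (u z - \<sigma>\<^sub>2)\<^sup>2) /
             ((u z - \<tau>\<^sub>1)\<^sup>2 * (u z - \<tau>\<^sub>2) * (u z - \<tau>\<^sub>3))))"

definition elliptic_function :: "(complex \<Rightarrow> complex) \<Rightarrow> bool" where
  "elliptic_function u \<longleftrightarrow>
     u meromorphic_on UNIV \<and>
     (\<exists>\<omega>\<^sub>1 \<omega>\<^sub>2. \<omega>\<^sub>1 \<noteq> 0 \<and> \<omega>\<^sub>2 \<noteq> 0 \<and> \<omega>\<^sub>2 / \<omega>\<^sub>1 \<notin> \<real> \<and>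
        (\<forall>\<^sub>\<approx>z\<in>UNIV. u (z + \<omega>\<^sub>1) = u z) \<and> (\<forall>\<^sub>\<approx>z\<in>UNIV. u (z + \<omega>\<^sub>2) = u z))"

definition is_lattice :: "complex set \<Rightarrow> bool" where
  "is_lattice \<Lambda> \<longleftrightarrow>
     (\<exists>\<omega>\<^sub>1 \<omega>\<^sub>2. \<omega>\<^sub>1 \<noteq> 0 \<and> \<omega>\<^sub>2 \<noteq> 0 \<and> \<omega>\<^sub>2 / \<omega>\<^sub>1 \<notin> \<real> \<and>
        \<Lambda> = {of_int m * \<omega>\<^sub>1 + of_int n * \<omega>\<^sub>2 | m n. True})"

definition lattice_g2 :: "complex set \<Rightarrow> complex" where
  "lattice_g2 \<Lambda> = 60 * (\<Sum>\<^sub>\<infinity>\<omega>\<in>\<Lambda> - {0}. 1 / \<omega> ^ 4)"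

definition lattice_g3 :: "complex set \<Rightarrow> complex" where
  "lattice_g3 \<Lambda> = 140 * (\<Sum>\<^sub>\<infinity>\<omega>\<in>\<Lambda> - {0}. 1 / \<omega> ^ 6)"

definition lattice_wp :: "complex set \<Rightarrow> complex \<Rightarrow> complex" where
  "lattice_wp \<Lambda> z = 1 / z\<^sup>2 + (\<Sum>\<^sub>\<infinity>\<omega>\<in>\<Lambda> - {0}. (1 / (z - \<omega>)\<^sup>2 - 1 / \<omega>\<^sup>2))"

text \<open>
  A lattice with invariants \<open>g\<^sub>2\<close> and \<open>g\<^sub>3\<close> exists if and only if
  \<open>g\<^sub>2\<^sup>3 \<noteq> 27 g\<^sub>3\<^sup>2\<close>, and is then unique, so in that case the choice below is no choice at all.
  In the degenerate case \<open>g\<^sub>2\<^sup>3 = 27 g\<^sub>3\<^sup>2\<close> the value is meaningless.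
\<close>

definition weierstrass_wp :: "complex \<Rightarrow> complex \<Rightarrow> complex \<Rightarrow> complex" where
  "weierstrass_wp g\<^sub>2 g\<^sub>3 =
     lattice_wp (SOME \<Lambda>. is_lattice \<Lambda> \<and> lattice_g2 \<Lambda> = g\<^sub>2 \<and> lattice_g3 \<Lambda> = g\<^sub>3)"

end

theory Submission
  imports Defs
begin

text \<open>
  Write \<open>R(u) = c (u - \<sigma>\<^sub>1)\<^sup>2 (u - \<sigma>\<^sub>2)\<^sup>2 / (u\<^sup>2 (u - 1) (u + 1))\<close> and \<open>S\<close> for the Schwarzian derivative. Where \<open>u - t\<close>
  vanishes to order \<open>m > 1\<close>, \<open>S(u)\<close> has a double pole with coefficient \<open>(1 - m\<^sup>2)/2\<close>, while it is
  regular for \<open>m = 1\<close>. Comparing with the poles of \<open>R\<close> shows that a solution takes the values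
  \<open>1\<close> and \<open>-1\<close> only with multiplicity \<open>4\<close> and the value \<open>0\<close> only with multiplicity \<open>2\<close>
  (\<open>ramified_value_multiplicity\<close>). Since \<open>1/2 + 1/4 + 1/4 = 1\<close>, this is the ramification of a
  Euclidean triangle group, and two ideas turn it into a proof.

  The first is rigidity at the ramified points. If two solutions have the same leading term
  \<open>t + a z\<^sup>m\<close> there and first differ in the coefficient of \<open>z\<^sup>m\<^sup>+\<^sup>n\<close>, linearising the equation gives
  \<open>n (n\<^sup>2 - m\<^sup>2) = m\<^sup>2 - 1\<close>, that is \<open>n (n - 1) = m\<^sup>2 - 1\<close>, which is impossible because the left side is even and
  \<open>m\<^sup>2 - 1\<close> is \<open>3\<close> or \<open>15\<close> (\<open>local_uniqueness\<close>). The leading coefficient is determined up to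
  finitely many choices, so the ramified points of a solution form finitely many classes modulo its
  group of periods (\<open>finitely_many_ramified_classes\<close>).

  The second is the function \<open>u'\<^sup>4 / (u\<^sup>2 (u\<^sup>2 - 1)\<^sup>3)\<close>: by the multiplicities above it is entire, and it inherits the
  periods of \<open>u\<close>. Suppose that the periods were all real multiples of one number. Then the
  ramified points lie in a disc or in a strip; outside of it \<open>1/(u - 1)\<close> is holomorphic and omits
  \<open>-1\<close> and \<open>-1/2\<close>. In the variable \<open>\<zeta> = 1/z\<close>, or \<open>\<zeta> = exp(2\<pi>iz/\<omega>)\<close> when there is a period
  \<open>\<omega>\<close>, the great Picard theorem makes it meromorphic at \<open>\<zeta> = 0\<close>, and then the entire function tends
  to \<open>0\<close> at the ends of the plane or of the cylinder, so it vanishes identically by Liouville, which is absurd. Hence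
  \<open>u\<close> is elliptic (\<open>two_independent_periods\<close>).

  For elliptic \<open>u\<close> the entire function is a constant \<open>K\<close> by Liouville, so \<open>u'\<^sup>4 = K u\<^sup>2 (u\<^sup>2 - 1)\<^sup>3\<close>, and this
  equation alone yields \<open>S(u)\<^sup>2 = (9/4) K (u\<^sup>2 + 1/4)\<^sup>2 / (u\<^sup>2 (u\<^sup>2 - 1))\<close> (\<open>schwarzian_of_quartic\<close>).
  Comparing numerators gives \<open>{\<sigma>\<^sub>1, \<sigma>\<^sub>2} = {i/2, -i/2}\<close> (\<open>sigma_values\<close>). Conversely the stated expression in
  \<open>\<wp>\<close> and \<open>\<wp>'\<close> satisfies the quartic equation with \<open>K = L\<^sup>4\<close>, and as every solution takes the value \<open>1\<close>,
  rigidity at such points shows that there are no solutions but its translates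
  (\<open>translate_of_solution\<close>). The Weierstrass function itself is developed here from its defining series, up to its
  differential equation and the existence of a square lattice with any prescribed \<open>g\<^sub>2 \<noteq> 0\<close>.
\<close>

section \<open>Local rigidity of the Schwarzian equation at a ramified point\<close>

lemma deriv_translate: "deriv (\<lambda>z. f (a + z)) = (\<lambda>z. deriv f (a + z))" for a :: complex
proof
  fix z
  have "((\<lambda>z. f (a + z)) has_field_derivative D) (at z) \<longleftrightarrow> (f has_field_derivative D) (at (a + z))" for D
    using DERIV_shift[of f D z a] by (simp add: add.commute)
  thus "deriv (\<lambda>z. f (a + z)) z = deriv f (a + z)"
    by (simp add: deriv_def)
qed

lemma schwarzian_translate: "schwarzian (\<lambda>z. u (a + z)) z = schwarzian u (a + z)"
  unfolding schwarzian_def deriv_translate deriv_translate[of "\<lambda>w. deriv (deriv u) w / deriv u w"] ..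

lemma schwarzian_cong:
  assumes "\<forall>\<^sub>F w in nhds z. u w = v w"
  shows "schwarzian u z = schwarzian v z"
proof -
  have 1: "\<forall>\<^sub>F w in nhds z. deriv u w = deriv v w"
    using assms[THEN eventually_eventually[THEN iffD2]] by eventually_elim (rule deriv_cong_ev, auto)
  have 2: "\<forall>\<^sub>F w in nhds z. deriv (deriv u) w = deriv (deriv v) w"
    using 1[THEN eventually_eventually[THEN iffD2]] by eventually_elim (rule deriv_cong_ev, auto)
  have 3: "\<forall>\<^sub>F w in nhds z. deriv (deriv u) w / deriv u w = deriv (deriv v) w / deriv v w"
    using 1 2 by eventually_elim simp
  show ?thesis unfolding schwarzian_def
    using deriv_cong_ev[OF 3 refl] eventually_nhds_x_imp_x[OF 1] eventually_nhds_x_imp_x[OF 2] by simp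
qed

lemma analytic_factor_zero:
  fixes f :: "complex \<Rightarrow> complex"
  assumes "f analytic_on {0}" "f 0 = 0" "\<not> (\<forall>\<^sub>F z in nhds 0. f z = 0)"
  obtains n g where "n > 0" "g analytic_on {0}" "g 0 \<noteq> 0" "\<forall>\<^sub>F z in nhds 0. f z = z ^ n * g z"
proof -
  obtain r where r: "r > 0" "f holomorphic_on ball 0 r"
    using assms(1) by (auto simp: analytic_on_def)
  have nc: "\<not> f constant_on ball 0 r"
  proof
    assume "f constant_on ball 0 r"
    then have "\<forall>z\<in>ball 0 r. f z = 0"
      using assms(2) r unfolding constant_on_def by force
    moreover have "\<forall>\<^sub>F z in nhds (0::complex). z \<in> ball 0 r"
      using r by (intro eventually_nhds_in_open) auto
    ultimately have "\<forall>\<^sub>F z in nhds 0. f z = 0" by (auto elim!: eventually_mono)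
    then show False using assms(3) by simp
  qed
  show ?thesis
  proof (rule holomorphic_factor_zero_nonconstant[OF r(2) open_ball connected_ball _ assms(2) nc])
    show "0 \<in> ball 0 r" using r(1) by simp
  next
    fix g s and n :: nat
    assume g: "0 < n" "0 < s" "g holomorphic_on ball 0 s"
      "\<And>w. w \<in> ball 0 s \<Longrightarrow> f w = (w - 0) ^ n * g w" "\<And>w. w \<in> ball 0 s \<Longrightarrow> g w \<noteq> 0"
    have "\<forall>\<^sub>F z in nhds (0::complex). z \<in> ball 0 s"
      using g(2) by (intro eventually_nhds_in_open) auto
    then have "\<forall>\<^sub>F z in nhds 0. f z = z ^ n * g z"
      by eventually_elim (use g(4) in auto)
    moreover have "g analytic_on {0}" using g by (auto simp: analytic_on_def)
    ultimately show ?thesis using that[of n g] g(1) g(5)[of 0] g(2) by simp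
  qed
qed

text \<open>
  If \<open>u = t + z\<^sup>m P\<close>, then \<open>u' = z\<^sup>m\<^sup>-\<^sup>1 Q\<close> with \<open>Q = m P + z P'\<close>, and \<open>u''/u' = (m - 1)/z + Q'/Q\<close>. The next
  three functions are \<open>Q\<close>, the regular part \<open>Q'/Q\<close>, and \<open>z\<^sup>2 S(u)\<close>; unlike \<open>S(u)\<close> the last one is
  holomorphic at \<open>0\<close>, with value \<open>(1 - m\<^sup>2)/2\<close>.
\<close>
definition deriv_factor :: "nat \<Rightarrow> (complex \<Rightarrow> complex) \<Rightarrow> complex \<Rightarrow> complex" where
  "deriv_factor m P z = of_nat m * P z + z * deriv P z"

definition logderiv_factor :: "nat \<Rightarrow> (complex \<Rightarrow> complex) \<Rightarrow> complex \<Rightarrow> complex" where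
  "logderiv_factor m P z = deriv (deriv_factor m P) z / deriv_factor m P z"

definition schwarzian_factor :: "nat \<Rightarrow> (complex \<Rightarrow> complex) \<Rightarrow> complex \<Rightarrow> complex" where
  "schwarzian_factor m P z = (1 - (of_nat m)\<^sup>2) / 2 - (of_nat m - 1) * z * logderiv_factor m P z
      + z\<^sup>2 * (deriv (logderiv_factor m P) z - (logderiv_factor m P z)\<^sup>2 / 2)"

lemma deriv_factor_holomorphic [holomorphic_intros]:
  assumes "open S" "P holomorphic_on S"
  shows "deriv_factor m P holomorphic_on S"
  unfolding deriv_factor_def[abs_def] using assms by (intro holomorphic_intros)

lemma logderiv_factor_holomorphic [holomorphic_intros]:
  assumes "open S" "P holomorphic_on S" "\<And>z. z \<in> S \<Longrightarrow> deriv_factor m P z \<noteq> 0"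
  shows "logderiv_factor m P holomorphic_on S"
  unfolding logderiv_factor_def[abs_def] using assms by (intro holomorphic_intros)

lemma schwarzian_factor_holomorphic [holomorphic_intros]:
  assumes "open S" "P holomorphic_on S" "\<And>z. z \<in> S \<Longrightarrow> deriv_factor m P z \<noteq> 0"
  shows "schwarzian_factor m P holomorphic_on S"
  unfolding schwarzian_factor_def[abs_def] using assms by (intro holomorphic_intros) auto

lemma deriv_power_factor:
  assumes "open S" "P holomorphic_on S" "m > 0" "\<And>z. z \<in> S \<Longrightarrow> u z = t + z ^ m * P z" "z \<in> S"
  shows "deriv u z = z ^ (m - 1) * deriv_factor m P z"
proof -
  have "((\<lambda>z. t + z ^ m * P z) has_field_derivative
     (of_nat m * z ^ (m - 1) * P z + z ^ m * deriv P z)) (at z)"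
    using holomorphic_derivI[OF assms(2,1,5)] by (auto intro!: derivative_eq_intros)
  also have "of_nat m * z ^ (m - 1) * P z + z ^ m * deriv P z = z ^ (m - 1) * deriv_factor m P z"
    using assms(3) by (cases m) (auto simp: deriv_factor_def algebra_simps)
  finally have "(u has_field_derivative z ^ (m - 1) * deriv_factor m P z) (at z)"
    by (rule has_field_derivative_transform_within_open[of _ _ _ S]) (use assms in auto)
  then show ?thesis by (rule DERIV_imp_deriv)
qed

lemma schwarzian_power_factor:
  assumes S: "open S" and P: "P holomorphic_on S" and m: "m > 0"
    and u: "\<And>z. z \<in> S \<Longrightarrow> u z = t + z ^ m * P z"
    and p1: "\<And>z. z \<in> S \<Longrightarrow> deriv_factor m P z \<noteq> 0"
    and z: "z \<in> S" "z \<noteq> 0"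
  shows "schwarzian u z * z\<^sup>2 = schwarzian_factor m P z"
proof -
  let ?p = "deriv_factor m P" and ?g = "logderiv_factor m P"
  have hp: "?p holomorphic_on S" and hg: "?g holomorphic_on S"
    using S P p1 by (auto intro!: holomorphic_intros)
  have d1: "deriv u w = w ^ (m - 1) * ?p w" if "w \<in> S" for w
    using deriv_power_factor[OF S P m u that] .
  have d2: "deriv (deriv u) w / deriv u w = (of_nat m - 1) / w + ?g w" if w: "w \<in> S - {0}" for w
  proof -
    have "((\<lambda>w. w ^ (m - 1) * ?p w) has_field_derivative
      of_nat (m - 1) * w ^ (m - 1 - 1) * ?p w + w ^ (m - 1) * deriv ?p w) (at w)"
      using holomorphic_derivI[OF hp S, of w] w by (auto intro!: derivative_eq_intros)
    then have "(deriv u has_field_derivative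
      of_nat (m - 1) * w ^ (m - 1 - 1) * ?p w + w ^ (m - 1) * deriv ?p w) (at w)"
      by (rule has_field_derivative_transform_within_open[of _ _ _ S]) (use d1 S w in auto)
    then have "deriv (deriv u) w = of_nat (m - 1) * w ^ (m - 1 - 1) * ?p w + w ^ (m - 1) * deriv ?p w"
      by (rule DERIV_imp_deriv)
    also have "of_nat (m - 1) * w ^ (m - 1 - 1) = (of_nat m - 1) / w * w ^ (m - 1)"
    proof (cases "m = 1")
      case False
      then obtain k where "m = Suc (Suc k)" using m
        by (metis One_nat_def Suc_pred not_gr_zero)
      then show ?thesis using w by simp
    qed simp
    finally show ?thesis using w p1[of w] d1[of w]
      by (simp add: logderiv_factor_def field_simps)
  qed
  have "((\<lambda>w. (of_nat m - 1) / w + ?g w) has_field_derivative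
     (- (of_nat m - 1) / z\<^sup>2 + deriv ?g z)) (at z)"
    using holomorphic_derivI[OF hg S, of z] z by (auto intro!: derivative_eq_intros simp: power2_eq_square)
  then have "((\<lambda>w. deriv (deriv u) w / deriv u w) has_field_derivative
     (- (of_nat m - 1) / z\<^sup>2 + deriv ?g z)) (at z)"
    by (rule has_field_derivative_transform_within_open[of _ _ _ "S - {0}"])
      (use d2 S z in \<open>auto simp: open_delete\<close>)
  then have "deriv (\<lambda>w. deriv (deriv u) w / deriv u w) z = - (of_nat m - 1) / z\<^sup>2 + deriv ?g z"
    by (rule DERIV_imp_deriv)
  then have S_eq: "schwarzian u z = - (of_nat m - 1) / z\<^sup>2 + deriv ?g z - 1 / 2 * ((of_nat m - 1) / z + ?g z)\<^sup>2"
    unfolding schwarzian_def using d2[of z] z by simp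
  show ?thesis
    unfolding schwarzian_factor_def S_eq using z
    by (simp add: field_simps power2_eq_square)
qed

text \<open>
  The first variation of the Schwarzian derivative at \<open>z\<^sup>m P\<close> in the direction \<open>z\<^sup>m\<^sup>+\<^sup>n D\<close>. The logarithmic derivatives
  of the two functions \<open>deriv_factor\<close> differ by \<open>z\<^sup>n\<^sup>-\<^sup>1 M\<close>, and inserting this
  into the definition of \<open>schwarzian_factor\<close> gives the multiplier \<open>n - m\<close> in front of \<open>M 0\<close>.
\<close>
lemma schwarzian_factor_diff:
  assumes S: "open S" and P: "P holomorphic_on S" and D: "D holomorphic_on S"
    and Q: "\<And>z. z \<in> S \<Longrightarrow> Q z = P z + z ^ n * D z" and n: "n > 0"
    and p1: "\<And>z. z \<in> S \<Longrightarrow> deriv_factor m P z \<noteq> 0"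
    and q1: "\<And>z. z \<in> S \<Longrightarrow> deriv_factor m Q z \<noteq> 0"
    and S0: "0 \<in> S" and m: "m > 0"
  obtains W where "W holomorphic_on S" "\<And>z. z \<in> S \<Longrightarrow> schwarzian_factor m Q z - schwarzian_factor m P z = z ^ n * W z"
    "W 0 = (of_nat n - of_nat m) * of_nat n * (of_nat m + of_nat n) * D 0 / (of_nat m * P 0)"
proof -
  let ?p = "deriv_factor m P" and ?q = "deriv_factor m Q"
  let ?g = "logderiv_factor m P" and ?h = "logderiv_factor m Q"
  \<comment> \<open>\<open>E\<close> is the factor belonging to the derivative of \<open>z\<^sup>m\<^sup>+\<^sup>n D\<close>.\<close>
  define E where "E z = of_nat (m + n) * D z + z * deriv D z" for z
  have hE: "E holomorphic_on S" unfolding E_def[abs_def] using S D by (intro holomorphic_intros)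
  obtain k where k: "n = Suc k" using n by (cases n) auto
  have hQ: "Q holomorphic_on S"
    using Q by (subst holomorphic_cong[OF refl, of S Q "\<lambda>z. P z + z ^ n * D z"]) (auto intro!: holomorphic_intros P D)
  have hp: "?p holomorphic_on S" and hg: "?g holomorphic_on S" and hq: "?q holomorphic_on S" and hh: "?h holomorphic_on S"
    using S P p1 hQ q1 by (auto intro!: holomorphic_intros)
  have q: "?q z = ?p z + z ^ n * E z" if "z \<in> S" for z
  proof -
    have "((\<lambda>z. P z + z ^ n * D z) has_field_derivative
      deriv P z + (of_nat n * z ^ (n - 1) * D z + z ^ n * deriv D z)) (at z)"
      using holomorphic_derivI[OF P S that] holomorphic_derivI[OF D S that]
      by (auto intro!: derivative_eq_intros)
    then have "(Q has_field_derivative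
      deriv P z + (of_nat n * z ^ (n - 1) * D z + z ^ n * deriv D z)) (at z)"
      by (rule has_field_derivative_transform_within_open[of _ _ _ S]) (use Q S that in auto)
    then have "deriv Q z = deriv P z + (of_nat n * z ^ (n - 1) * D z + z ^ n * deriv D z)"
      by (rule DERIV_imp_deriv)
    then show ?thesis
      unfolding deriv_factor_def E_def Q[OF that] k by (simp add: algebra_simps)
  qed
  define M where "M z = (of_nat n * E z * ?p z + z * deriv E z * ?p z - z * deriv ?p z * E z) / (?p z * ?q z)" for z
  have hM: "M holomorphic_on S" unfolding M_def[abs_def] using S P D hQ p1 q1 hE hp hq
    by (intro holomorphic_intros) auto
  have h: "?h z = ?g z + z ^ k * M z" if "z \<in> S" for z
  proof -
    have "((\<lambda>z. ?p z + z ^ n * E z) has_field_derivative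
      deriv ?p z + (of_nat n * z ^ (n - 1) * E z + z ^ n * deriv E z)) (at z)"
      using holomorphic_derivI[OF hp S that] holomorphic_derivI[OF hE S that]
      by (auto intro!: derivative_eq_intros)
    then have "(?q has_field_derivative
      deriv ?p z + (of_nat n * z ^ (n - 1) * E z + z ^ n * deriv E z)) (at z)"
      by (rule has_field_derivative_transform_within_open[of _ _ _ S]) (use q S that in auto)
    then have d: "deriv ?q z = deriv ?p z + (of_nat n * z ^ (n - 1) * E z + z ^ n * deriv E z)"
      by (rule DERIV_imp_deriv)
    have "?h z - ?g z = (deriv ?q z * ?p z - deriv ?p z * ?q z) / (?p z * ?q z)"
      unfolding logderiv_factor_def using p1[OF that] q1[OF that] by (simp add: field_simps)
    also have "deriv ?q z * ?p z - deriv ?p z * ?q z =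
        z ^ k * (of_nat n * E z * ?p z + z * deriv E z * ?p z - z * deriv ?p z * E z)"
      unfolding d q[OF that] k by (simp add: algebra_simps)
    finally show ?thesis by (simp add: M_def algebra_simps)
  qed
  have dh: "z * deriv ?h z = z * deriv ?g z + of_nat k * z ^ k * M z + z * z ^ k * deriv M z" if "z \<in> S" for z
  proof -
    have "((\<lambda>z. ?g z + z ^ k * M z) has_field_derivative
      deriv ?g z + (of_nat k * z ^ (k - 1) * M z + z ^ k * deriv M z)) (at z)"
      using holomorphic_derivI[OF hg S that] holomorphic_derivI[OF hM S that]
      by (auto intro!: derivative_eq_intros)
    then have "(?h has_field_derivative
      deriv ?g z + (of_nat k * z ^ (k - 1) * M z + z ^ k * deriv M z)) (at z)"
      by (rule has_field_derivative_transform_within_open[of _ _ _ S]) (use h S that in auto)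
    then have "deriv ?h z = deriv ?g z + (of_nat k * z ^ (k - 1) * M z + z ^ k * deriv M z)"
      by (rule DERIV_imp_deriv)
    then show ?thesis by (cases k) (auto simp: algebra_simps)
  qed
  define W where "W z = (of_nat n - of_nat m) * M z + z * deriv M z - z * M z * (?g z + ?h z) / 2" for z
  show ?thesis
  proof (rule that[of W])
    show "W holomorphic_on S" unfolding W_def[abs_def] using S P hQ p1 q1 hM hg hh by (intro holomorphic_intros) auto
    fix z assume z: "z \<in> S"
    have "schwarzian_factor m Q z - schwarzian_factor m P z =
       - (of_nat m - 1) * z * (?h z - ?g z) + z * (z * deriv ?h z - z * deriv ?g z) - z * z * (?h z - ?g z) * (?h z + ?g z) / 2"
      unfolding schwarzian_factor_def by (simp add: field_simps power2_eq_square)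
    also have "\<dots> = - (of_nat m - 1) * z * (z ^ k * M z) + z * (of_nat k * z ^ k * M z + z * z ^ k * deriv M z)
       - z * z * (z ^ k * M z) * (?h z + ?g z) / 2"
      using h[OF z] dh[OF z] by simp
    also have "\<dots> = z ^ n * W z"
      unfolding W_def k by (simp add: field_simps)
    finally show "schwarzian_factor m Q z - schwarzian_factor m P z = z ^ n * W z" .
  next
    have "?q 0 = ?p 0" using q[OF S0] n by simp
    moreover have "?p 0 = of_nat m * P 0" by (simp add: deriv_factor_def)
    moreover have "P 0 \<noteq> 0" using p1[OF S0] by (simp add: deriv_factor_def)
    ultimately show "W 0 = (of_nat n - of_nat m) * of_nat n * (of_nat m + of_nat n) * D 0 / (of_nat m * P 0)"
      using m unfolding W_def M_def E_def by (simp add: field_simps)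
  qed
qed

text \<open>
  A chain rule for two functions with a common limit, applied below to the coefficients of the
  equation, to powers, and with \<open>w = z\<^sup>n\<close>.
\<close>
lemma poly_diff_quotient_tendsto:
  fixes u v w :: "'a \<Rightarrow> complex"
  assumes "(u \<longlongrightarrow> t) F" "(v \<longlongrightarrow> t) F" "((\<lambda>z. (v z - u z) / w z) \<longlongrightarrow> d) F"
  shows "((\<lambda>z. (poly A (v z) - poly A (u z)) / w z) \<longlongrightarrow> poly (pderiv A) t * d) F"
proof (induction A)
  case (pCons a A)
  have "((\<lambda>z. v z * ((poly A (v z) - poly A (u z)) / w z) + (v z - u z) / w z * poly A (u z)) \<longlongrightarrow>
      t * (poly (pderiv A) t * d) + d * poly A t) F"
    by (intro tendsto_intros assms pCons.IH)
  moreover have "v z * ((poly A (v z) - poly A (u z)) / w z) + (v z - u z) / w z * poly A (u z) =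
      (poly (pCons a A) (v z) - poly (pCons a A) (u z)) / w z" for z
    by (simp add: diff_divide_distrib add_divide_distrib algebra_simps)
  ultimately show ?case by (simp add: pderiv_pCons algebra_simps)
qed simp

lemma power_factor_nhd:
  fixes u :: "complex \<Rightarrow> complex" and R :: "complex \<Rightarrow> bool"
  assumes "P analytic_on {0}" "P 0 \<noteq> 0" "m > 0" "\<forall>\<^sub>F z in nhds 0. u z = t + z ^ m * P z"
    and "\<forall>\<^sub>F z in at 0. R z"
  obtains r where "r > 0" "P holomorphic_on ball 0 r" "\<And>z. z \<in> ball 0 r \<Longrightarrow> deriv_factor m P z \<noteq> 0"
    "\<And>z. z \<in> ball 0 r \<Longrightarrow> u z = t + z ^ m * P z" "\<And>z. z \<in> ball 0 r - {0} \<Longrightarrow> R z"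
proof -
  obtain r where r: "r > 0" "P holomorphic_on ball 0 r"
    using assms(1) by (auto simp: analytic_on_def)
  have "deriv_factor m P holomorphic_on ball 0 r"
    using r by (intro holomorphic_intros) auto
  then have "isCont (deriv_factor m P) 0"
    using r by (metis centre_in_ball holomorphic_on_imp_continuous_on continuous_on_eq_continuous_at open_ball)
  moreover have ne: "deriv_factor m P 0 \<noteq> 0" using assms by (simp add: deriv_factor_def)
  ultimately have "\<forall>\<^sub>F z in at 0. deriv_factor m P z \<noteq> 0"
    by (intro tendsto_imp_eventually_ne[OF isContD])
  then have "\<forall>\<^sub>F z in nhds 0. deriv_factor m P z \<noteq> 0"
    using ne by (simp add: eventually_nhds_conv_at)
  moreover have "\<forall>\<^sub>F z in nhds 0. z \<noteq> 0 \<longrightarrow> R z"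
    using assms(5) by (auto simp: eventually_at_filter)
  ultimately have "\<forall>\<^sub>F z in nhds 0. deriv_factor m P z \<noteq> 0 \<and> u z = t + z ^ m * P z \<and> (z \<noteq> 0 \<longrightarrow> R z)"
    using assms(4) by eventually_elim auto
  then obtain e where e: "e > 0" "\<And>z. dist z 0 < e \<Longrightarrow> deriv_factor m P z \<noteq> 0 \<and> u z = t + z ^ m * P z \<and> (z \<noteq> 0 \<longrightarrow> R z)"
    by (auto simp: eventually_nhds_metric)
  show ?thesis
    by (rule that[of "min r e"]) (use e r in \<open>auto simp: dist_commute intro: holomorphic_on_subset\<close>)
qed

lemma holomorphic_tendsto_at:
  assumes "f holomorphic_on S" "open S" "z \<in> S"
  shows "(f \<longlongrightarrow> f z) (at z)"
  using assms by (metis holomorphic_on_imp_continuous_on continuous_on_eq_continuous_at isContD)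

text \<open>
  Multiplying the equation by \<open>z\<^sup>4\<close> makes every factor on the left holomorphic at \<open>0\<close>.
\<close>
lemma ode_times_power:
  assumes S: "open S" and P: "P holomorphic_on S" and m: "m > 0"
    and u: "\<And>z. z \<in> S \<Longrightarrow> u z = t + z ^ m * P z"
    and p1: "\<And>z. z \<in> S \<Longrightarrow> deriv_factor m P z \<noteq> 0"
    and ode: "(schwarzian u z)\<^sup>2 * (u z - t) ^ p * a = b"
    and z: "z \<in> S" "z \<noteq> 0"
  shows "(schwarzian_factor m P z)\<^sup>2 * z ^ (p * m) * P z ^ p * a = z ^ 4 * b"
proof -
  have "(schwarzian_factor m P z)\<^sup>2 * z ^ (p * m) * P z ^ p * a = (schwarzian u z * z\<^sup>2)\<^sup>2 * (u z - t) ^ p * a"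
    using schwarzian_power_factor[OF S P m u p1 z] u[OF z(1)]
    by (simp add: power_mult_distrib power_mult[symmetric] mult.commute)
  also have "\<dots> = z ^ 4 * ((schwarzian u z)\<^sup>2 * (u z - t) ^ p * a)"
    by (simp add: power_mult_distrib algebra_simps flip: power_mult)
  finally show ?thesis by (simp only: ode)
qed

text \<open>
  As \<open>0\<^sup>0 = 1\<close>, this gives \<open>a = b\<close> for equal exponents and \<open>a = 0\<close> otherwise.
\<close>
lemma compare_leading_terms:
  fixes f g :: "complex \<Rightarrow> complex"
  assumes f: "(f \<longlongrightarrow> a) (at 0)" and g: "(g \<longlongrightarrow> b) (at 0)"
    and eq: "\<forall>\<^sub>F z in at 0. z ^ i * f z = z ^ j * g z" and le: "i \<le> j"
  shows "a = 0 ^ (j - i) * b"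
proof -
  have "((\<lambda>z. z ^ (j - i) * g z) \<longlongrightarrow> 0 ^ (j - i) * b) (at 0)" by (intro tendsto_intros g)
  moreover have "\<forall>\<^sub>F z in at 0. z ^ (j - i) * g z = f z"
    using eq eventually_neq_at_within[of 0 0 UNIV]
  proof eventually_elim
    case (elim z)
    have "z ^ i * (z ^ (j - i) * g z) = z ^ i * f z"
      using elim(1) le by (simp add: mult.assoc[symmetric] flip: power_add)
    then show ?case using elim(2) by simp
  qed
  ultimately have "(f \<longlongrightarrow> 0 ^ (j - i) * b) (at 0)" by (rule Lim_transform_eventually)
  then show ?thesis using f LIM_unique by blast
qed

text \<open>
  The equation forces \<open>S(u)\<^sup>2\<close> to have a pole of order \<open>p m\<close>. As \<open>S(u)\<close> is regular where \<open>m = 1\<close> and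
  has a double pole otherwise, this order is \<open>4\<close>. The last equation compares the leading
  coefficients: it determines \<open>P 0\<close> up to a \<open>p\<close>-th root of unity.
\<close>
lemma ramified_value_multiplicity:
  assumes P: "P analytic_on {0}" "P 0 \<noteq> 0" "m > 0" "\<forall>\<^sub>F z in nhds 0. u z = t + z ^ m * P z"
    and ode: "\<forall>\<^sub>F z in at 0. (schwarzian u z)\<^sup>2 * (u z - t) ^ p * poly A (u z) = poly B (u z)"
    and p: "p > 0" and A: "poly A t \<noteq> 0" and B: "poly B t \<noteq> 0"
  shows "m > 1" "p * m = 4" "((1 - (of_nat m)\<^sup>2) / 2)\<^sup>2 * P 0 ^ p * poly A t = poly B t"
proof -
  obtain r where r: "r > 0" "P holomorphic_on ball 0 r" "\<And>z. z \<in> ball 0 r \<Longrightarrow> deriv_factor m P z \<noteq> 0"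
    "\<And>z. z \<in> ball 0 r \<Longrightarrow> u z = t + z ^ m * P z"
    "\<And>z. z \<in> ball 0 r - {0} \<Longrightarrow> (schwarzian u z)\<^sup>2 * (u z - t) ^ p * poly A (u z) = poly B (u z)"
    using power_factor_nhd[OF P ode] by metis
  let ?S = "schwarzian_factor m P"
  have r0: "(0::complex) \<in> ball 0 r" using r by auto
  have ev: "\<forall>\<^sub>F z in at (0::complex). z \<in> ball 0 r - {0}"
    using r(1) by (intro eventually_at_in_open) auto
  have eq: "(?S z)\<^sup>2 * z ^ (p * m) * P z ^ p * poly A (u z) = z ^ 4 * poly B (u z)" if "z \<in> ball 0 r - {0}" for z
    using ode_times_power[OF _ r(2) P(3) r(4,3) r(5)[OF that]] that by auto
  have limP: "(P \<longlongrightarrow> P 0) (at 0)" using holomorphic_tendsto_at[OF r(2) _ r0] by simp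
  have "?S holomorphic_on ball 0 r" using r by (intro holomorphic_intros) auto
  then have limS: "(?S \<longlongrightarrow> (1 - (of_nat m)\<^sup>2) / 2) (at 0)"
    using holomorphic_tendsto_at[of ?S "ball 0 r" 0] r0 by (simp add: schwarzian_factor_def)
  have "((\<lambda>z. t + z ^ m * P z) \<longlongrightarrow> t + 0 ^ m * P 0) (at 0)"
    by (intro tendsto_intros limP)
  then have "((\<lambda>z. t + z ^ m * P z) \<longlongrightarrow> t) (at 0)" using P(3) by (simp add: zero_power)
  moreover have "\<forall>\<^sub>F z in at 0. t + z ^ m * P z = u z"
    using ev by eventually_elim (use r(4) in auto)
  ultimately have limu: "(u \<longlongrightarrow> t) (at 0)"
    by (rule Lim_transform_eventually)
  have limA: "((\<lambda>z. poly A (u z)) \<longlongrightarrow> poly A t) (at 0)" and limB: "((\<lambda>z. poly B (u z)) \<longlongrightarrow> poly B t) (at 0)"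
    by (intro tendsto_intros limu)+
  show m1: "m > 1"
  proof (rule ccontr)
    assume "\<not> m > 1"
    then have m: "m = 1" using P(3) by simp
    \<comment> \<open>At an unramified point the double pole of the Schwarzian cancels, so the left-hand side vanishes there.\<close>
    define s where "s z = deriv (logderiv_factor m P) z - (logderiv_factor m P z)\<^sup>2 / 2" for z
    have s: "?S z = z\<^sup>2 * s z" for z using m by (simp add: schwarzian_factor_def s_def)
    have "s holomorphic_on ball 0 r" unfolding s_def[abs_def] using r by (intro holomorphic_intros) auto
    then have lims: "(s \<longlongrightarrow> s 0) (at 0)" using holomorphic_tendsto_at[of s "ball 0 r" 0] r0 by simp
    have "((\<lambda>z. (s z)\<^sup>2 * P z ^ p * poly A (u z)) \<longlongrightarrow> (s 0)\<^sup>2 * P 0 ^ p * poly A t) (at 0)"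
      by (intro tendsto_intros lims limP limA)
    moreover have "\<forall>\<^sub>F z in at 0. z ^ 4 * poly B (u z) = z ^ (4 + p) * ((s z)\<^sup>2 * P z ^ p * poly A (u z))"
      using ev
    proof eventually_elim
      case (elim z)
      show ?case
        unfolding eq[OF elim, symmetric] s by (simp add: m power_mult_distrib power_add algebra_simps flip: power_mult)
    qed
    ultimately have "poly B t = 0 ^ (4 + p - 4) * ((s 0)\<^sup>2 * P 0 ^ p * poly A t)"
      by (rule compare_leading_terms[OF limB]) simp
    then show False using B p by (simp add: zero_power)
  qed
  have S0: "(1 - (of_nat m :: complex)\<^sup>2) / 2 \<noteq> 0"
  proof
    assume "(1 - (of_nat m :: complex)\<^sup>2) / 2 = 0"
    then have "(of_nat (m\<^sup>2) :: complex) = of_nat 1" by simp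
    then have "m\<^sup>2 = 1" using of_nat_eq_iff by blast
    then show False using m1 by simp
  qed
  define a where "a = ((1 - (of_nat m)\<^sup>2) / 2)\<^sup>2 * P 0 ^ p * poly A t"
  have a0: "a \<noteq> 0" using S0 P(2) A by (simp add: a_def)
  have limH: "((\<lambda>z. (?S z)\<^sup>2 * P z ^ p * poly A (u z)) \<longlongrightarrow> a) (at 0)"
    unfolding a_def by (intro tendsto_intros limS limP limA)
  have evH: "\<forall>\<^sub>F z in at 0. z ^ (p * m) * ((?S z)\<^sup>2 * P z ^ p * poly A (u z)) = z ^ 4 * poly B (u z)"
    using ev
  proof eventually_elim
    case (elim z)
    then show ?case using eq[OF elim] by (simp add: mult_ac)
  qed
  have evH': "\<forall>\<^sub>F z in at 0. z ^ 4 * poly B (u z) = z ^ (p * m) * ((?S z)\<^sup>2 * P z ^ p * poly A (u z))"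
    using evH by eventually_elim simp
  show pm: "p * m = 4"
  proof (rule ccontr)
    assume ne: "p * m \<noteq> 4"
    show False
    proof (cases "p * m \<le> 4")
      case True
      then show False using compare_leading_terms[OF limH limB evH] ne a0 by (simp add: zero_power)
    next
      case False
      then show False using compare_leading_terms[OF limB limH evH'] B by (simp add: zero_power)
    qed
  qed
  show "((1 - (of_nat m)\<^sup>2) / 2)\<^sup>2 * P 0 ^ p * poly A t = poly B t"
    using compare_leading_terms[OF limH limB evH] pm unfolding a_def by simp
qed

text \<open>
  With \<open>p m = 4\<close> the equation reads \<open>(n + 1) (n (n - 1) - (m\<^sup>2 - 1)) = 0\<close>. Now \<open>n (n - 1)\<close> is even, whereas
  \<open>m\<close> is \<open>2\<close> or \<open>4\<close>, so \<open>m\<^sup>2 - 1\<close> is odd.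
\<close>
lemma no_resonance:
  assumes "m > 1" "p * m = 4" "n > 0"
    and eq: "4 * ((of_nat n - of_nat m) * of_nat n * (of_nat m + of_nat n)) + (1 - (of_nat m)\<^sup>2) * of_nat (p * m) = (0 :: complex)"
  shows False
proof -
  have "of_int (4 * ((int n - int m) * int n * (int m + int n)) + (1 - (int m)\<^sup>2) * int (p * m)) = (of_int 0 :: complex)"
    using eq by simp
  then have e: "4 * ((int n - int m) * int n * (int m + int n)) + (1 - (int m)\<^sup>2) * int (p * m) = 0"
    using of_int_eq_iff by blast
  then have "(int n + 1) * (int n * (int n - 1) - ((int m)\<^sup>2 - 1)) = 0"
    unfolding assms(2) by (simp add: algebra_simps power2_eq_square)
  then have n: "int n * (int n - 1) = (int m)\<^sup>2 - 1" by auto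
  have "m dvd 4" using assms(2) by (metis dvd_triv_right)
  moreover have "m = 2 \<or> m = 3 \<or> m = 4"
    using dvd_imp_le[OF \<open>m dvd 4\<close>] assms(1) by linarith
  ultimately have "m = 2 \<or> m = 4" by (elim disjE) simp_all
  moreover have "even (int n * (int n - 1))" by simp
  ultimately show False unfolding n by auto
qed

text \<open>
  If the two expansions first differ in the coefficient of \<open>z\<^sup>m\<^sup>+\<^sup>n\<close>, subtract the two equations and
  divide by \<open>z\<^sup>n\<close>. In the limit only the variations of \<open>S(u)\<close> and of \<open>(u - t)\<^sup>p\<close> survive, since \<open>A(u)\<close>
  and \<open>B(u)\<close> vary to the higher order \<open>m + n\<close>; what remains is the resonance condition excluded above.
\<close>
lemma local_uniqueness:
  assumes P: "P analytic_on {0}" "P 0 \<noteq> 0" and Q: "Q analytic_on {0}" "Q 0 = P 0"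
    and u: "\<forall>\<^sub>F z in nhds 0. u z = t + z ^ m * P z" and v: "\<forall>\<^sub>F z in nhds 0. v z = t + z ^ m * Q z"
    and ode_u: "\<forall>\<^sub>F z in at 0. (schwarzian u z)\<^sup>2 * (u z - t) ^ p * poly A (u z) = poly B (u z)"
    and ode_v: "\<forall>\<^sub>F z in at 0. (schwarzian v z)\<^sup>2 * (v z - t) ^ p * poly A (v z) = poly B (v z)"
    and p: "p * m = 4" "m > 1" and A: "poly A t \<noteq> 0"
  shows "\<forall>\<^sub>F z in nhds 0. u z = v z"
proof (rule ccontr)
  assume neq: "\<not> ?thesis"
  have m: "m > 0" using p by simp
  have "\<not> (\<forall>\<^sub>F z in nhds 0. Q z - P z = 0)"
  proof
    assume "\<forall>\<^sub>F z in nhds 0. Q z - P z = 0"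
    then have "\<forall>\<^sub>F z in nhds 0. u z = v z" using u v by eventually_elim simp
    then show False using neq by simp
  qed
  moreover have "(\<lambda>z. Q z - P z) analytic_on {0}" using P Q by (intro analytic_intros)
  ultimately obtain n D where n: "n > 0" "D analytic_on {0}" "D 0 \<noteq> 0" "\<forall>\<^sub>F z in nhds 0. Q z - P z = z ^ n * D z"
    using analytic_factor_zero[of "\<lambda>z. Q z - P z"] Q(2) by auto
  have QD: "\<forall>\<^sub>F z in at 0. Q z = P z + z ^ n * D z"
    using n(4) by (auto simp: eventually_at_filter algebra_simps elim: eventually_mono)
  obtain r1 where r1: "r1 > 0" "P holomorphic_on ball 0 r1" "\<And>z. z \<in> ball 0 r1 \<Longrightarrow> deriv_factor m P z \<noteq> 0"
    "\<And>z. z \<in> ball 0 r1 \<Longrightarrow> u z = t + z ^ m * P z"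
    "\<And>z. z \<in> ball 0 r1 - {0} \<Longrightarrow> (schwarzian u z)\<^sup>2 * (u z - t) ^ p * poly A (u z) = poly B (u z)"
    using power_factor_nhd[OF P m u ode_u] by metis
  obtain r2 where r2: "r2 > 0" "Q holomorphic_on ball 0 r2" "\<And>z. z \<in> ball 0 r2 \<Longrightarrow> deriv_factor m Q z \<noteq> 0"
    "\<And>z. z \<in> ball 0 r2 \<Longrightarrow> v z = t + z ^ m * Q z"
    "\<And>z. z \<in> ball 0 r2 - {0} \<Longrightarrow> (schwarzian v z)\<^sup>2 * (v z - t) ^ p * poly A (v z) = poly B (v z)"
    using power_factor_nhd[OF Q(1) _ m v ode_v] P Q by metis
  obtain r3 where r3: "r3 > 0" "D holomorphic_on ball 0 r3"
    using n(2) by (auto simp: analytic_on_def)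
  obtain r4 where r4: "r4 > 0" "\<And>z. z \<noteq> 0 \<Longrightarrow> dist z 0 < r4 \<Longrightarrow> Q z = P z + z ^ n * D z"
    using QD by (auto simp: eventually_at)
  define r where "r = min (min r1 r2) (min r3 r4)"
  have r: "r > 0" "r \<le> r1" "r \<le> r2" "r \<le> r3" "r \<le> r4" using r1 r2 r3 r4 by (auto simp: r_def)
  define S where "S = ball (0::complex) r"
  have S: "open S" "0 \<in> S" "S \<subseteq> ball 0 r1" "S \<subseteq> ball 0 r2" "S \<subseteq> ball 0 r3" using r by (auto simp: S_def)
  have hP: "P holomorphic_on S" and hQ: "Q holomorphic_on S" and hD: "D holomorphic_on S"
    using r1(2) r2(2) r3(2) S holomorphic_on_subset by blast+
  have QPD: "Q z = P z + z ^ n * D z" if "z \<in> S" for z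
    using r4(2)[of z] that n(1) Q(2) r(5) by (cases "z = 0") (auto simp: S_def)
  have dP: "\<And>z. z \<in> S \<Longrightarrow> deriv_factor m P z \<noteq> 0" by (rule r1(3)) (use S in blast)
  have dQ: "\<And>z. z \<in> S \<Longrightarrow> deriv_factor m Q z \<noteq> 0" by (rule r2(3)) (use S in blast)
  have uS: "\<And>z. z \<in> S \<Longrightarrow> u z = t + z ^ m * P z" by (rule r1(4)) (use S in blast)
  have vS: "\<And>z. z \<in> S \<Longrightarrow> v z = t + z ^ m * Q z" by (rule r2(4)) (use S in blast)
  let ?S = "schwarzian_factor m P" and ?T = "schwarzian_factor m Q"
  obtain W where W: "W holomorphic_on S" "\<And>z. z \<in> S \<Longrightarrow> ?T z - ?S z = z ^ n * W z"
    "W 0 = (of_nat n - of_nat m) * of_nat n * (of_nat m + of_nat n) * D 0 / (of_nat m * P 0)"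
    using schwarzian_factor_diff[OF S(1) hP hD QPD n(1) dP dQ S(2) m] by blast
  have ev: "\<forall>\<^sub>F z in at (0::complex). z \<in> S - {0}"
    using S by (intro eventually_at_in_open) auto
  have equ: "(?S z)\<^sup>2 * P z ^ p * poly A (u z) = poly B (u z)" if "z \<in> S - {0}" for z
  proof -
    have "z \<in> ball 0 r1 - {0}" using that S by auto
    from ode_times_power[OF S(1) hP m uS dP r1(5)[OF this]] that
    have "z ^ 4 * ((?S z)\<^sup>2 * P z ^ p * poly A (u z)) = z ^ 4 * poly B (u z)"
      unfolding p by (simp add: algebra_simps)
    then show ?thesis using that by simp
  qed
  have eqv: "(?T z)\<^sup>2 * Q z ^ p * poly A (v z) = poly B (v z)" if "z \<in> S - {0}" for z
  proof -
    have "z \<in> ball 0 r2 - {0}" using that S by auto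
    from ode_times_power[OF S(1) hQ m vS dQ r2(5)[OF this]] that
    have "z ^ 4 * ((?T z)\<^sup>2 * Q z ^ p * poly A (v z)) = z ^ 4 * poly B (v z)"
      unfolding p by (simp add: algebra_simps)
    then show ?thesis using that by simp
  qed
  note lim = holomorphic_tendsto_at[OF _ S(1,2)]
  have limP: "(P \<longlongrightarrow> P 0) (at 0)" and limQ: "(Q \<longlongrightarrow> P 0) (at 0)" and limD: "(D \<longlongrightarrow> D 0) (at 0)"
    and limW: "(W \<longlongrightarrow> W 0) (at 0)"
    using lim[OF hP] lim[OF hQ] lim[OF hD] lim[OF W(1)] Q(2) by auto
  define s0 :: complex where "s0 = (1 - (of_nat m)\<^sup>2) / 2"
  have hS: "?S holomorphic_on S" and hT: "?T holomorphic_on S" using S hP hQ dP dQ by (auto intro!: holomorphic_intros)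
  have limS: "(?S \<longlongrightarrow> s0) (at 0)" and limT: "(?T \<longlongrightarrow> s0) (at 0)"
    using lim[OF hS] lim[OF hT] by (simp_all add: schwarzian_factor_def s0_def)
  have "((\<lambda>z. t + z ^ m * P z) \<longlongrightarrow> t + 0 ^ m * P 0) (at 0)"
    by (intro tendsto_intros limP)
  then have "((\<lambda>z. t + z ^ m * P z) \<longlongrightarrow> t) (at 0)" using m by (simp add: zero_power)
  moreover have "\<forall>\<^sub>F z in at 0. t + z ^ m * P z = u z"
    using ev by eventually_elim (use uS in auto)
  ultimately have limu: "(u \<longlongrightarrow> t) (at 0)"
    by (rule Lim_transform_eventually)
  have "((\<lambda>z. t + z ^ m * Q z) \<longlongrightarrow> t + 0 ^ m * P 0) (at 0)"
    by (intro tendsto_intros limQ)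
  then have "((\<lambda>z. t + z ^ m * Q z) \<longlongrightarrow> t) (at 0)" using m by (simp add: zero_power)
  moreover have "\<forall>\<^sub>F z in at 0. t + z ^ m * Q z = v z"
    using ev by eventually_elim (use vS in auto)
  ultimately have limv: "(v \<longlongrightarrow> t) (at 0)"
    by (rule Lim_transform_eventually)
  have "((\<lambda>z. z ^ m * D z) \<longlongrightarrow> 0 ^ m * D 0) (at 0)" by (intro tendsto_intros limD)
  then have "((\<lambda>z. z ^ m * D z) \<longlongrightarrow> 0) (at 0)" using m by (simp add: zero_power)
  then have limvu: "((\<lambda>z. (v z - u z) / z ^ n) \<longlongrightarrow> 0) (at 0)"
    by (subst tendsto_cong[of _ "\<lambda>z. z ^ m * D z"])
      (use ev uS vS QPD in \<open>auto elim!: eventually_mono simp: field_simps\<close>)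
  have limQP: "((\<lambda>z. (Q z - P z) / z ^ n) \<longlongrightarrow> D 0) (at 0)"
    by (subst tendsto_cong[of _ D])
      (use ev QPD limD in \<open>auto elim!: eventually_mono simp: field_simps\<close>)
  have limA: "((\<lambda>z. (poly A (v z) - poly A (u z)) / z ^ n) \<longlongrightarrow> 0) (at 0)"
   and limB: "((\<lambda>z. (poly B (v z) - poly B (u z)) / z ^ n) \<longlongrightarrow> 0) (at 0)"
    using poly_diff_quotient_tendsto[OF limu limv limvu, of A] poly_diff_quotient_tendsto[OF limu limv limvu, of B] by auto
  have limp: "((\<lambda>z. (Q z ^ p - P z ^ p) / z ^ n) \<longlongrightarrow> of_nat p * P 0 ^ (p - 1) * D 0) (at 0)"
    using poly_diff_quotient_tendsto[OF limP limQ limQP, of "monom 1 p"]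
    by (simp add: poly_monom pderiv_monom)
  have "((\<lambda>z. (?T z + ?S z) * W z * Q z ^ p * poly A (v z) + (?S z)\<^sup>2 * ((Q z ^ p - P z ^ p) / z ^ n) * poly A (v z)
      + (?S z)\<^sup>2 * P z ^ p * ((poly A (v z) - poly A (u z)) / z ^ n)) \<longlongrightarrow>
      (s0 + s0) * W 0 * P 0 ^ p * poly A t + s0\<^sup>2 * (of_nat p * P 0 ^ (p - 1) * D 0) * poly A t
      + s0\<^sup>2 * P 0 ^ p * 0) (at 0)"
    by (intro tendsto_intros limW limA limp limP limQ limS limT limv)
  moreover have "\<forall>\<^sub>F z in at 0. (?T z + ?S z) * W z * Q z ^ p * poly A (v z) + (?S z)\<^sup>2 * ((Q z ^ p - P z ^ p) / z ^ n) * poly A (v z)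
      + (?S z)\<^sup>2 * P z ^ p * ((poly A (v z) - poly A (u z)) / z ^ n) = (poly B (v z) - poly B (u z)) / z ^ n"
    using ev
  proof eventually_elim
    case (elim z)
    then have z: "z \<in> S" "z \<noteq> 0" by auto
    have Wz: "W z = (?T z - ?S z) / z ^ n" using W(2)[OF z(1)] z(2) by simp
    show ?case
      unfolding Wz equ[OF elim, symmetric] eqv[OF elim, symmetric] using z(2)
      by (simp add: field_simps power2_eq_square)
  qed
  ultimately have "((\<lambda>z. (poly B (v z) - poly B (u z)) / z ^ n) \<longlongrightarrow> (s0 + s0) * W 0 * P 0 ^ p * poly A t + s0\<^sup>2 * (of_nat p * P 0 ^ (p - 1) * D 0) * poly A t
      + s0\<^sup>2 * P 0 ^ p * 0) (at 0)"
    using tendsto_cong by force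
  then have "(s0 + s0) * W 0 * P 0 ^ p * poly A t + s0\<^sup>2 * (of_nat p * P 0 ^ (p - 1) * D 0) * poly A t = 0"
    using limB LIM_unique by fastforce
  then have fin: "s0 * poly A t * (2 * W 0 * P 0 ^ p + s0 * (of_nat p * P 0 ^ (p - 1) * D 0)) = 0"
    by (simp add: algebra_simps power2_eq_square)
  have s0: "s0 \<noteq> 0"
  proof
    assume "s0 = 0"
    then have "(of_nat (m\<^sup>2) :: complex) = of_nat 1" by (simp add: s0_def)
    then have "m\<^sup>2 = 1" using of_nat_eq_iff by blast
    then show False using p by simp
  qed
  obtain q where q: "p = Suc q" using p by (cases p) auto
  define X :: complex where "X = (of_nat n - of_nat m) * of_nat n * (of_nat m + of_nat n)"
  have "2 * W 0 * P 0 ^ p + s0 * (of_nat p * P 0 ^ (p - 1) * D 0) = 0"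
    using fin s0 A by simp
  moreover have "2 * W 0 * P 0 ^ p = 2 * X * D 0 * P 0 ^ q / of_nat m"
    unfolding W(3) X_def[symmetric] q using P(2) by simp
  moreover have "of_nat p * P 0 ^ (p - 1) * D 0 = of_nat p * P 0 ^ q * D 0" by (simp add: q)
  ultimately have "2 * X * D 0 * P 0 ^ q / of_nat m + (1 - (of_nat m)\<^sup>2) / 2 * (of_nat p * P 0 ^ q * D 0) = 0"
    unfolding s0_def by (simp only:)
  moreover have "2 * x * d * y / a + (1 - a\<^sup>2) / 2 * (b * y * d) = y * d * (4 * x + (1 - a\<^sup>2) * (b * a)) / (2 * a)"
    if "a \<noteq> 0" for x d y a b :: complex
    using that by (simp add: field_simps)
  ultimately have "P 0 ^ q * D 0 * (4 * X + (1 - (of_nat m)\<^sup>2) * of_nat (p * m)) = 0"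
    using m by (simp only: of_nat_mult) simp
  then have "4 * X + (1 - (of_nat m)\<^sup>2) * of_nat (p * m) = 0" using P(2) n(3) by simp
  then show False unfolding X_def using no_resonance[OF p(2,1) n(1)] by blast
qed

section \<open>Solutions on the plane and their ramified points\<close>

lemma nicely_meromorphic_eq_remove_sings:
  assumes "f nicely_meromorphic_on A" "z \<in> A"
  shows "remove_sings f z = f z"
  using assms unfolding nicely_meromorphic_on_def by (metis remove_sings_at_pole remove_sings_eqI)

lemma nicely_meromorphic_eqI:
  assumes "f nicely_meromorphic_on UNIV" "g nicely_meromorphic_on UNIV" "\<forall>\<^sub>\<approx>z\<in>UNIV. f z = g z"
  shows "f = g"
proof
  fix z
  have "\<forall>\<^sub>F w in at z. f w = g w"
    using eventually_cosparse_imp_eventually_at[OF assms(3)] by simp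
  then have "remove_sings f z = remove_sings g z" by (rule remove_sings_cong) simp
  then show "f z = g z"
    using assms(1,2) by (simp add: nicely_meromorphic_eq_remove_sings)
qed

lemma meromorphic_translate:
  assumes "f meromorphic_on UNIV"
  shows "(\<lambda>z. f (a + z)) meromorphic_on UNIV"
  by (rule meromorphic_on_compose[OF assms]) (auto intro!: analytic_intros)

lemma filtermap_plus_at: "filtermap (\<lambda>z. a + z) (at z) = at (a + z)" for a z :: complex
  using filtermap_at_shift[of "-a" z] by (simp add: add.commute)

lemma nicely_meromorphic_translate:
  assumes "f nicely_meromorphic_on UNIV"
  shows "(\<lambda>z. f (a + z)) nicely_meromorphic_on UNIV"
proof -
  have "remove_sings (\<lambda>z. f (a + z)) = (\<lambda>z. f (a + z))"
  proof
    fix z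
    have "remove_sings (f \<circ> (\<lambda>z. a + z)) z = remove_sings f (a + z)"
      by (rule remove_sings_compose) (rule filtermap_plus_at)
    then show "remove_sings (\<lambda>z. f (a + z)) z = f (a + z)"
      using nicely_meromorphic_eq_remove_sings[OF assms] by (simp add: o_def)
  qed
  moreover have "(\<lambda>z. f (a + z)) meromorphic_on UNIV"
    using assms meromorphic_translate by (auto simp: nicely_meromorphic_on_def)
  ultimately show ?thesis using remove_sings_nicely_meromorphic by metis
qed

text \<open>
  The difference is meromorphic, and vanishes either almost everywhere or almost nowhere.
\<close>
lemma nicely_meromorphic_identity:
  assumes f: "f nicely_meromorphic_on UNIV" and g: "g nicely_meromorphic_on UNIV"
    and eq: "\<forall>\<^sub>F z in at a. f z = g z"
  shows "f = g"
proof -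
  have "(\<lambda>z. f z - g z) meromorphic_on UNIV"
    using f g by (auto simp: nicely_meromorphic_on_def intro!: meromorphic_intros)
  from meromorphic_imp_constant_or_avoid[OF this open_UNIV connected_UNIV, of 0]
  have "(\<forall>\<^sub>\<approx>z\<in>UNIV. f z - g z = 0) \<or> (\<forall>\<^sub>\<approx>z\<in>UNIV. f z - g z \<noteq> 0)" by simp
  moreover have "\<not> (\<forall>\<^sub>\<approx>z\<in>UNIV. f z - g z \<noteq> 0)"
  proof
    assume "\<forall>\<^sub>\<approx>z\<in>UNIV. f z - g z \<noteq> 0"
    then have "\<forall>\<^sub>F z in at a. f z - g z \<noteq> 0"
      using eventually_cosparse_imp_eventually_at by blast
    then have "\<forall>\<^sub>F z in at a. False" using eq by eventually_elim simp
    then show False by simp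
  qed
  ultimately show ?thesis
    using nicely_meromorphic_eqI[OF f g] by simp
qed

lemma at_translate_0:
  "(\<forall>\<^sub>F z in at (0::complex). R (a + z)) \<longleftrightarrow> (\<forall>\<^sub>F z in at a. R z)"
  by (subst at_to_0[of a]) (simp add: eventually_filtermap add.commute)

lemma nhds_translate_0:
  "(\<forall>\<^sub>F z in nhds (0::complex). R (a + z)) \<longleftrightarrow> (\<forall>\<^sub>F z in nhds a. R z)"
  by (subst nhds_to_0[of a]) (simp add: eventually_filtermap add.commute)

definition periods :: "(complex \<Rightarrow> complex) \<Rightarrow> complex set" where
  "periods u = {w. \<forall>z. u (z + w) = u z}"

text \<open>
  A nicely meromorphic function has the value \<open>0\<close> at its poles, so poles have to be excluded.
\<close>
definition ramified_point :: "(complex \<Rightarrow> complex) \<Rightarrow> complex \<Rightarrow> bool" where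
  "ramified_point u z \<longleftrightarrow> \<not> is_pole u z \<and> u z \<in> {0, 1, -1}"

text \<open>
  The multiplicity with which a solution takes the value \<open>t \<in> {0, 1, -1}\<close>.
\<close>
definition ramification_index :: "complex \<Rightarrow> nat" where
  "ramification_index t = (if t = 0 then 2 else 4)"

text \<open>
  The denominator \<open>u\<^sup>2 (u - 1) (u + 1)\<close> of the equation is \<open>(u - t) ^ denominator_order t\<close> times the value at \<open>u\<close> of
  the polynomial \<open>denominator_cofactor t\<close>.
\<close>
definition denominator_order :: "complex \<Rightarrow> nat" where
  "denominator_order t = (if t = 0 then 2 else 1)"

definition denominator_cofactor :: "complex \<Rightarrow> complex poly" where
  "denominator_cofactor t = (if t = 0 then [:-1, 1:] * [:1, 1:] else if t = 1 then [:0, 1:]\<^sup>2 * [:1, 1:] else [:0, 1:]\<^sup>2 * [:-1, 1:])"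

definition ode_numerator :: "complex \<Rightarrow> complex \<Rightarrow> complex \<Rightarrow> complex poly" where
  "ode_numerator c s1 s2 = smult c ([:- s1, 1:]\<^sup>2 * [:- s2, 1:]\<^sup>2)"

lemma poly_ode_numerator: "poly (ode_numerator c s1 s2) w = c * ((w - s1)\<^sup>2 * (w - s2)\<^sup>2)"
  by (simp add: ode_numerator_def)

lemma denominator_cofactor:
  assumes "t \<in> {0, 1, -1}"
  shows "(w - t) ^ denominator_order t * poly (denominator_cofactor t) w = w\<^sup>2 * (w - 1) * (w + 1)" "poly (denominator_cofactor t) t \<noteq> 0"
    "denominator_order t > 0" "denominator_order t * ramification_index t = 4" "ramification_index t > 1"
  using assms by (auto simp: denominator_cofactor_def denominator_order_def ramification_index_def algebra_simps power2_eq_square)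

definition ramified_expansion :: "(complex \<Rightarrow> complex) \<Rightarrow> complex \<Rightarrow> (complex \<Rightarrow> complex) \<Rightarrow> bool" where
  "ramified_expansion u a P \<longleftrightarrow> P analytic_on {0} \<and> P 0 \<noteq> 0 \<and>
     (\<forall>\<^sub>F z in nhds 0. u (a + z) = u a + z ^ ramification_index (u a) * P z)"

text \<open>
  The solutions under study: the equation is cleared of denominators, and \<open>u\<close> is normalised so
  that equalities between solutions hold everywhere. A transcendental solution gives rise to one by
  removing its singularities (\<open>schwarzian_solution_of_transcendental\<close>), and conversely no nonconstant solution
  is rational (\<open>not_rational\<close>).
\<close>
locale schwarzian_solution =
  fixes c s1 s2 :: complex and u :: "complex \<Rightarrow> complex"
  assumes c: "c \<noteq> 0" and s: "s1 \<notin> {0, 1, -1}" "s2 \<notin> {0, 1, -1}"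
    and nice: "u nicely_meromorphic_on UNIV" and nonconst: "\<not> u constant_on UNIV"
    and ode: "\<forall>\<^sub>\<approx>z\<in>UNIV. (schwarzian u z)\<^sup>2 * ((u z)\<^sup>2 * (u z - 1) * (u z + 1)) = c * ((u z - s1)\<^sup>2 * (u z - s2)\<^sup>2)"
begin

lemma mero: "u meromorphic_on UNIV"
  using nice by (simp add: nicely_meromorphic_on_def)

lemma analytic: "\<not> is_pole u z \<Longrightarrow> u analytic_on {z}"
  using nicely_meromorphic_on_imp_analytic_at[OF nice] by simp

lemma not_locally_constant: "\<not> (\<forall>\<^sub>F w in at z. u w = a)"
proof
  assume "\<forall>\<^sub>F w in at z. u w = a"
  then have "\<exists>\<^sub>F w in at z. u w = a" by (intro eventually_frequently) auto
  from frequently_eq_meromorphic_imp_constant[OF this nice open_UNIV connected_UNIV]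
  have "u w = a" for w by simp
  then show False using nonconst by (auto simp: constant_on_def)
qed

lemma avoids: "\<forall>\<^sub>\<approx>z\<in>UNIV. u z \<noteq> a"
  using nicely_meromorphic_imp_constant_or_avoid[OF nice open_UNIV connected_UNIV, of a] nonconst
  by (auto simp: constant_on_def)

lemma ode_at_ramified_point:
  assumes "u a \<in> {0, 1, -1}"
  shows "\<forall>\<^sub>F z in at 0. (schwarzian (\<lambda>z. u (a + z)) z)\<^sup>2 * (u (a + z) - u a) ^ denominator_order (u a) * poly (denominator_cofactor (u a)) (u (a + z)) =
      poly (ode_numerator c s1 s2) (u (a + z))"
proof -
  have "\<forall>\<^sub>F z in at a. (schwarzian u z)\<^sup>2 * ((u z)\<^sup>2 * (u z - 1) * (u z + 1)) = c * ((u z - s1)\<^sup>2 * (u z - s2)\<^sup>2)"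
    using eventually_cosparse_imp_eventually_at[OF ode] by simp
  then have "\<forall>\<^sub>F z in at 0. (schwarzian u (a + z))\<^sup>2 * ((u (a + z))\<^sup>2 * (u (a + z) - 1) * (u (a + z) + 1)) = c * ((u (a + z) - s1)\<^sup>2 * (u (a + z) - s2)\<^sup>2)"
    by (subst (asm) at_translate_0[symmetric])
  then show ?thesis
    by eventually_elim (simp only: schwarzian_translate poly_ode_numerator denominator_cofactor(1)[OF assms] mult.assoc[of "_\<^sup>2" "_ ^ denominator_order _"])
qed

lemma ramified_expansion_exists:
  assumes "ramified_point u a"
  obtains P where "ramified_expansion u a P"
    "((1 - (of_nat (ramification_index (u a)))\<^sup>2) / 2)\<^sup>2 * P 0 ^ denominator_order (u a) * poly (denominator_cofactor (u a)) (u a) =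
       poly (ode_numerator c s1 s2) (u a)"
proof -
  let ?t = "u a"
  have t: "?t \<in> {0, 1, -1}" and np: "\<not> is_pole u a" using assms by (auto simp: ramified_point_def)
  have "(\<lambda>z. u (a + z)) analytic_on {0}"
    using analytic[OF np] by (intro analytic_on_compose_gen[where g = u and f = "\<lambda>z. a + z", unfolded o_def]) (auto intro!: analytic_intros)
  then have "(\<lambda>z. u (a + z) - ?t) analytic_on {0}" by (intro analytic_intros)
  moreover have "\<not> (\<forall>\<^sub>F z in nhds 0. u (a + z) - ?t = 0)"
  proof
    assume "\<forall>\<^sub>F z in nhds 0. u (a + z) - ?t = 0"
    then have "\<forall>\<^sub>F z in nhds a. u z = ?t" using nhds_translate_0[of "\<lambda>z. u z - ?t = 0" a] by simp
    then have "\<forall>\<^sub>F z in at a. u z = ?t" by (simp add: eventually_nhds_conv_at)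
    then show False using not_locally_constant by simp
  qed
  ultimately obtain m P where mP: "m > 0" "P analytic_on {0}" "P 0 \<noteq> 0" "\<forall>\<^sub>F z in nhds 0. u (a + z) - ?t = z ^ m * P z"
    using analytic_factor_zero[of "\<lambda>z. u (a + z) - ?t"] by auto
  have ex: "\<forall>\<^sub>F z in nhds 0. u (a + z) = ?t + z ^ m * P z"
    using mP(4) by eventually_elim (simp add: algebra_simps)
  note ode_at_ramified_point[OF t]
  moreover have "poly (ode_numerator c s1 s2) ?t \<noteq> 0"
    using c s t by (auto simp: poly_ode_numerator)
  ultimately have m: "denominator_order ?t * m = 4"
    "((1 - (of_nat m)\<^sup>2) / 2)\<^sup>2 * P 0 ^ denominator_order ?t * poly (denominator_cofactor ?t) ?t = poly (ode_numerator c s1 s2) ?t"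
    using ramified_value_multiplicity[OF mP(2,3,1) ex] denominator_cofactor[OF t] by blast+
  have "m = ramification_index ?t"
    using m(1) denominator_cofactor(3,4)[OF t] by (metis mult_cancel1 not_gr_zero)
  then show ?thesis using that[of P] mP ex m unfolding ramified_expansion_def by simp
qed

lemma translate_solution: "schwarzian_solution c s1 s2 (\<lambda>z. u (a + z))"
proof
  show "(\<lambda>z. u (a + z)) nicely_meromorphic_on UNIV" by (rule nicely_meromorphic_translate[OF nice])
  show "\<not> (\<lambda>z. u (a + z)) constant_on UNIV"
  proof
    assume "(\<lambda>z. u (a + z)) constant_on UNIV"
    then obtain k where "\<And>z. u (a + z) = k" by (auto simp: constant_on_def)
    from this[of "_ - a"] have "u z = k" for z by simp
    then show False using nonconst by (auto simp: constant_on_def)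
  qed
  let ?R = "\<lambda>z. (schwarzian u z)\<^sup>2 * ((u z)\<^sup>2 * (u z - 1) * (u z + 1)) = c * ((u z - s1)\<^sup>2 * (u z - s2)\<^sup>2)"
  have "\<forall>\<^sub>F z in at w. ?R (a + z)" for w
  proof -
    have "\<forall>\<^sub>F z in at (a + w). ?R z" using eventually_cosparse_imp_eventually_at[OF ode] by simp
    then show ?thesis unfolding filtermap_plus_at[symmetric] eventually_filtermap .
  qed
  then show "\<forall>\<^sub>\<approx>z\<in>UNIV. (schwarzian (\<lambda>z. u (a + z)) z)\<^sup>2 * ((u (a + z))\<^sup>2 * (u (a + z) - 1) * (u (a + z) + 1)) =
      c * ((u (a + z) - s1)\<^sup>2 * (u (a + z) - s2)\<^sup>2)"
    unfolding schwarzian_translate by (simp add: eventually_cosparse_open_eq)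
qed (use c s in auto)

text \<open>
  Local rigidity, spread over the plane by the identity theorem.
\<close>
lemma solutions_agree:
  assumes v: "schwarzian_solution c s1 s2 v"
    and a: "ramified_point u a" and eq: "v b = u a" and P: "ramified_expansion u a P" "ramified_expansion v b Q" "P 0 = Q 0"
  shows "u (a + z) = v (b + z)"
proof -
  interpret v: schwarzian_solution c s1 s2 v by fact
  let ?t = "u a"
  have t: "?t \<in> {0, 1, -1}" using a by (auto simp: ramified_point_def)
  have "\<forall>\<^sub>F z in nhds 0. u (a + z) = v (b + z)"
  proof (rule local_uniqueness[where u = "\<lambda>z. u (a + z)" and v = "\<lambda>z. v (b + z)" and t = ?t and P = P and Q = Q,
        OF _ _ _ P(3)[symmetric] _ _ ode_at_ramified_point[OF t] _ denominator_cofactor(4,5,2)[OF t]])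
    show "P analytic_on {0}" "P 0 \<noteq> 0" "\<forall>\<^sub>F z in nhds 0. u (a + z) = ?t + z ^ ramification_index ?t * P z"
      using P(1) unfolding ramified_expansion_def by auto
    show "Q analytic_on {0}" "\<forall>\<^sub>F z in nhds 0. v (b + z) = ?t + z ^ ramification_index ?t * Q z"
      using P(2) unfolding ramified_expansion_def eq by auto
    show "\<forall>\<^sub>F z in at 0. (schwarzian (\<lambda>z. v (b + z)) z)\<^sup>2 * (v (b + z) - ?t) ^ denominator_order ?t * poly (denominator_cofactor ?t) (v (b + z)) =
      poly (ode_numerator c s1 s2) (v (b + z))"
      using v.ode_at_ramified_point[of b, unfolded eq, OF t] .
  qed
  then have "\<forall>\<^sub>F z in at 0. u (a + z) = v (b + z)" by (simp add: eventually_nhds_conv_at)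
  then have "(\<lambda>z. u (a + z)) = (\<lambda>z. v (b + z))"
    by (rule nicely_meromorphic_identity[OF nicely_meromorphic_translate[OF nice] nicely_meromorphic_translate[OF v.nice]])
  then show ?thesis by metis
qed

text \<open>
  Ramified points with the same value and the same leading coefficient differ by a period, and only finitely
  many pairs of a value and a leading coefficient can occur.
\<close>
lemma finitely_many_ramified_classes:
  obtains Z where "finite Z" "\<And>z. ramified_point u z \<Longrightarrow> \<exists>w\<in>Z. z - w \<in> periods u"
proof -
  define K where "K t = ((1 - (of_nat (ramification_index t))\<^sup>2) / 2)\<^sup>2 * poly (denominator_cofactor t) t" for t
  let ?B = "poly (ode_numerator c s1 s2)"
  have "\<exists>P. ramified_expansion u a P \<and> P 0 ^ denominator_order (u a) * K (u a) = ?B (u a)" if "ramified_point u a" for a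
  proof -
    from ramified_expansion_exists[OF that] obtain P where P: "ramified_expansion u a P"
      "((1 - (of_nat (ramification_index (u a)))\<^sup>2) / 2)\<^sup>2 * P 0 ^ denominator_order (u a) * poly (denominator_cofactor (u a)) (u a) = ?B (u a)"
      by blast
    have "P 0 ^ denominator_order (u a) * K (u a) = ?B (u a)" unfolding K_def P(2)[symmetric] by (simp only: mult_ac)
    with P(1) show ?thesis by blast
  qed
  then obtain E where E: "\<And>a. ramified_point u a \<Longrightarrow> ramified_expansion u a (E a)"
     "\<And>a. ramified_point u a \<Longrightarrow> E a 0 ^ denominator_order (u a) * K (u a) = ?B (u a)"
    by metis
  have K: "K t \<noteq> 0" if "t \<in> {0,1,-1}" for t
    using that denominator_cofactor(2)[OF that] by (auto simp: K_def ramification_index_def)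
  define T where "T = {a. ramified_point u a}"
  have "(\<lambda>a. (u a, E a 0)) ` T \<subseteq> (SIGMA t:{0,1,-1}. {x. poly (monom (K t) (denominator_order t) - [:?B t:]) x = 0})"
    using E(2) by (auto simp: T_def ramified_point_def poly_monom algebra_simps)
  moreover have "finite (SIGMA t:{0,1,-1}. {x. poly (monom (K t) (denominator_order t) - [:?B t:]) x = 0})"
  proof (intro finite_SigmaI poly_roots_finite)
    fix t :: complex assume t: "t \<in> {0,1,-1}"
    have "coeff (monom (K t) (denominator_order t) - [:?B t:]) (denominator_order t) \<noteq> 0"
      using K[OF t] denominator_cofactor(3)[OF t] by (cases "denominator_order t") auto
    then show "monom (K t) (denominator_order t) - [:?B t:] \<noteq> 0" by force
  qed auto
  ultimately have "finite ((\<lambda>a. (u a, E a 0)) ` T)" by (rule finite_subset)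
  then obtain Z where Z: "Z \<subseteq> T" "finite Z" "(\<lambda>a. (u a, E a 0)) ` T = (\<lambda>a. (u a, E a 0)) ` Z"
    using finite_subset_image[of "(\<lambda>a. (u a, E a 0)) ` T" "\<lambda>a. (u a, E a 0)" T] by blast
  show ?thesis
  proof (rule that[OF Z(2)])
    fix z assume z: "ramified_point u z"
    then have "(u z, E z 0) \<in> (\<lambda>a. (u a, E a 0)) ` Z" using Z(3) by (auto simp: T_def)
    then obtain w where w: "w \<in> Z" "u w = u z" "E w 0 = E z 0" by auto
    have tw: "ramified_point u w" using w Z by (auto simp: T_def)
    have "u (w + x) = u (z + x)" for x
      using solutions_agree[OF schwarzian_solution_axioms tw _ E(1)[OF tw] E(1)[OF z]] w by simp
    from this[of "_ - w"] have "u (x + (z - w)) = u x" for x by (simp add: algebra_simps)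
    then have "z - w \<in> periods u" by (simp add: periods_def)
    then show "\<exists>w\<in>Z. z - w \<in> periods u" using w(1) by blast
  qed
qed

end

section \<open>Decay of logarithmic derivatives at a puncture\<close>

text \<open>
  If \<open>f - f 0\<close> vanishes to order \<open>k > 0\<close>, so does \<open>z f'\<close>. The quotient then vanishes at least to order
  \<open>4 k - 3 k\<close>.
\<close>
lemma decay_at_finite_value:
  assumes f: "f analytic_on {0}" and Q: "Q \<noteq> 0" "order (f 0) Q \<le> 3"
  shows "((\<lambda>z. (z * deriv f z) ^ 4 / poly Q (f z)) \<longlongrightarrow> 0) (at 0)"
proof (cases "\<forall>\<^sub>F z in nhds 0. f z - f 0 = 0")
  case True
  then have "\<forall>\<^sub>F z in nhds 0. \<forall>\<^sub>F w in nhds z. f w = f 0"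
    by (simp add: eventually_eventually)
  then have "\<forall>\<^sub>F z in nhds 0. deriv f z = 0"
  proof eventually_elim
    case (elim z)
    then have "deriv f z = deriv (\<lambda>_. f 0) z" by (rule deriv_cong_ev) simp
    then show ?case by simp
  qed
  then have "\<forall>\<^sub>F z in at 0. 0 = (z * deriv f z) ^ 4 / poly Q (f z)"
    by (auto simp: eventually_nhds_conv_at elim: eventually_mono)
  then show ?thesis by (rule Lim_transform_eventually[OF tendsto_const])
next
  case False
  have "(\<lambda>z. f z - f 0) analytic_on {0}" using f by (intro analytic_intros)
  then obtain k P where k: "k > 0" "P analytic_on {0}" "P 0 \<noteq> 0" "\<forall>\<^sub>F z in nhds 0. f z - f 0 = z ^ k * P z"
    using analytic_factor_zero[of "\<lambda>z. f z - f 0"] False by auto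
  have "\<forall>\<^sub>F z in nhds 0. f z = f 0 + z ^ k * P z"
    using k(4) by eventually_elim (simp add: algebra_simps)
  from power_factor_nhd[OF k(2,3,1) this, of "\<lambda>_. True"] obtain r where
    r: "r > 0" "P holomorphic_on ball 0 r" "\<And>z. z \<in> ball 0 r \<Longrightarrow> deriv_factor k P z \<noteq> 0"
    "\<And>z. z \<in> ball 0 r \<Longrightarrow> f z = f 0 + z ^ k * P z" by auto
  define j where "j = order (f 0) Q"
  obtain q where q: "Q = [:- f 0, 1:] ^ j * q" "\<not> [:- f 0, 1:] dvd q"
    using order_decomp[OF Q(1), of "f 0"] by (auto simp: j_def)
  have q0: "poly q (f 0) \<noteq> 0" using q(2) by (simp add: poly_eq_0_iff_dvd)
  have j: "j \<le> 3" using Q by (simp add: j_def)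
  let ?p = "deriv_factor k P"
  have hp: "?p holomorphic_on ball 0 r" using r by (intro holomorphic_intros) auto
  have r0: "(0::complex) \<in> ball 0 r" using r by simp
  have ev: "\<forall>\<^sub>F z in at (0::complex). z \<in> ball 0 r - {0}"
    using r(1) by (intro eventually_at_in_open) auto
  have limP: "(P \<longlongrightarrow> P 0) (at 0)" and limp: "(?p \<longlongrightarrow> ?p 0) (at 0)"
    using holomorphic_tendsto_at[OF r(2) _ r0] holomorphic_tendsto_at[OF hp _ r0] by auto
  have limf: "(f \<longlongrightarrow> f 0) (at 0)" using f by (simp add: analytic_at_imp_isCont isContD)
  have "((\<lambda>z. z ^ ((4 - j) * k) * ?p z ^ 4 / (P z ^ j * poly q (f z))) \<longlongrightarrow> 0 ^ ((4 - j) * k) * ?p 0 ^ 4 / (P 0 ^ j * poly q (f 0))) (at 0)"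
    by (intro tendsto_intros limP limp limf) (use k q0 in auto)
  moreover have "(4 - j) * k > 0" using j k by simp
  ultimately have "((\<lambda>z. z ^ ((4 - j) * k) * ?p z ^ 4 / (P z ^ j * poly q (f z))) \<longlongrightarrow> 0) (at 0)"
    by (simp add: zero_power)
  moreover have "\<forall>\<^sub>F z in at 0. z ^ ((4 - j) * k) * ?p z ^ 4 / (P z ^ j * poly q (f z)) = (z * deriv f z) ^ 4 / poly Q (f z)"
    using ev
  proof eventually_elim
    case (elim z)
    have d: "z * deriv f z = z ^ k * ?p z"
      using deriv_power_factor[OF open_ball r(2) k(1) r(4), of z] elim k(1)
      by (cases k) auto
    have a: "poly Q (f z) = (z ^ k * P z) ^ j * poly q (f z)"
      using r(4)[of z] elim by (subst q) (simp add: poly_mult poly_power)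
    have b: "(z ^ k * ?p z) ^ 4 = z ^ (j * k) * (z ^ ((4 - j) * k) * ?p z ^ 4)"
    proof -
      have "k * 4 = j * k + (4 - j) * k" using j by (simp add: algebra_simps flip: add_mult_distrib)
      then show ?thesis by (simp only: power_mult_distrib power_mult[symmetric] power_add mult.assoc)
    qed
    show ?case unfolding d a b using elim
      by (simp add: power_mult_distrib power_mult[symmetric] mult.commute[of k j])
  qed
  ultimately show ?thesis by (rule Lim_transform_eventually)
qed

lemma order_linear_power: "order a ([:b, 1:] ^ n) = (if a = - b then n else 0)" for a b :: complex
proof (cases "a = - b")
  case True
  then show ?thesis using order_power_n_n[of "- b" n] by simp
next
  case False
  then have "b + a \<noteq> 0" by (metis add_eq_0_iff)
  then show ?thesis using False by (simp add: order_0I)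
qed

text \<open>
  For \<open>u = 1 + 1/v\<close> one has \<open>u'\<^sup>4 / (u\<^sup>2 (u\<^sup>2 - 1)\<^sup>3) = v'\<^sup>4 / ((v + 1)\<^sup>2 (2 v + 1)\<^sup>3)\<close>; this is the denominator. The second
  polynomial plays the same role for \<open>w\<close> with \<open>v = 1/w - 1\<close>. All roots have multiplicity at
  most \<open>3\<close>, less than the exponent \<open>4\<close> of the derivative.
\<close>
definition recip_poly :: "complex poly" where "recip_poly = smult 8 ([:1, 1:] ^ Suc 1 * [:1/2, 1:] ^ Suc 2)"
definition recip_inverse_poly :: "complex poly" where "recip_inverse_poly = smult (-1) ([:0, 1:] ^ Suc 2 * [:-2, 1:] ^ Suc 2)"

lemma poly_recip_poly: "poly recip_poly x = (x + 1)\<^sup>2 * (2 * x + 1) ^ 3"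
  by (simp add: recip_poly_def) algebra

lemma poly_recip_inverse_poly: "poly recip_inverse_poly x = x ^ 3 * (2 - x) ^ 3"
  by (simp add: recip_inverse_poly_def) algebra

lemma order_recip_poly: "order a recip_poly \<le> 3" and recip_poly_nonzero: "recip_poly \<noteq> 0"
proof -
  show *: "recip_poly \<noteq> 0" by (simp add: recip_poly_def del: power_Suc)
  then have "[:1, 1:] ^ Suc 1 * [:1/2, 1:] ^ Suc 2 \<noteq> (0 :: complex poly)" by (auto simp: recip_poly_def)
  then show "order a recip_poly \<le> 3"
    unfolding recip_poly_def by (simp add: order_smult order_mult order_linear_power del: power_Suc)
qed

lemma order_recip_inverse_poly: "order a recip_inverse_poly \<le> 3" and recip_inverse_poly_nonzero: "recip_inverse_poly \<noteq> 0"
proof -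
  show *: "recip_inverse_poly \<noteq> 0" by (simp add: recip_inverse_poly_def del: power_Suc)
  then have "[:0, 1:] ^ Suc 2 * [:-2, 1:] ^ Suc 2 \<noteq> (0 :: complex poly)" by (auto simp: recip_inverse_poly_def)
  then show "order a recip_inverse_poly \<le> 3"
    unfolding recip_inverse_poly_def by (simp add: order_smult order_mult order_linear_power del: power_Suc)
qed

text \<open>
  By the great Picard theorem \<open>h\<close> has a limit on the sphere. It is applied to \<open>g = 1/(h + 1)\<close>, which omits \<open>0\<close>
  and \<open>2\<close>: unlike \<open>h\<close>, the function \<open>h + 1\<close> has no zeros, so both \<open>g\<close> and \<open>1/g\<close> are holomorphic in the
  punctured disc.
\<close>
lemma decay_at_puncture:
  assumes r: "r > 0" and h: "h holomorphic_on ball 0 r - {0}"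
    and omit: "\<And>z. z \<in> ball 0 r - {0} \<Longrightarrow> h z \<noteq> -1 \<and> h z \<noteq> -1/2"
  shows "((\<lambda>z. (z * deriv h z) ^ 4 / poly recip_poly (h z)) \<longlongrightarrow> 0) (at 0)"
proof -
  have ev: "\<forall>\<^sub>F z in at (0::complex). z \<in> ball 0 r - {0}"
    using r(1) by (intro eventually_at_in_open) auto
  have iso: "isolated_singularity_at h 0"
    using h r by (auto simp: isolated_singularity_at_def open_delete intro!: exI[of _ r] simp: analytic_on_open)
  have case1: ?thesis if lim: "(h \<longlongrightarrow> l) (at 0)" for l
  proof -
    let ?f = "remove_sings h"
    have "?f analytic_on {0}" by (rule remove_sings_analytic_at[OF iso lim])
    from decay_at_finite_value[OF this recip_poly_nonzero order_recip_poly]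
    have "((\<lambda>z. (z * deriv ?f z) ^ 4 / poly recip_poly (?f z)) \<longlongrightarrow> 0) (at 0)" .
    moreover have "\<forall>\<^sub>F z in at 0. (z * deriv ?f z) ^ 4 / poly recip_poly (?f z) = (z * deriv h z) ^ 4 / poly recip_poly (h z)"
      using ev
    proof eventually_elim
      case (elim z)
      have "h analytic_on {z}"
        using h elim analytic_at[of h z] open_delete[OF open_ball, of 0 r 0] by blast
      then show ?case by simp
    qed
    ultimately show ?thesis by (rule Lim_transform_eventually)
  qed
  define g where "g z = 1 / (h z + 1)" for z
  have g: "g holomorphic_on ball 0 r - {0}"
    unfolding g_def[abs_def] using omit by (intro holomorphic_intros h) (auto simp: eq_neg_iff_add_eq_0)
  have gomit: "g z \<noteq> 0 \<and> g z \<noteq> 2" if "z \<in> ball 0 r - {0}" for z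
    using omit[OF that] by (auto simp: g_def field_simps add_eq_0_iff)
  have hg: "h z = inverse (g z) - 1" for z by (simp add: g_def)
  have isog: "isolated_singularity_at g 0"
    using g r by (auto simp: isolated_singularity_at_def open_delete intro!: exI[of _ r] simp: analytic_on_open)
  obtain l where "(g \<longlongrightarrow> l) (at 0) \<or> ((inverse \<circ> g) \<longlongrightarrow> l) (at 0)"
    using great_Picard[OF open_ball _ _ g, of 0 2] r gomit by auto
  then consider "((inverse \<circ> g) \<longlongrightarrow> l) (at 0)" | "(g \<longlongrightarrow> l) (at 0)" "l \<noteq> 0" | "(g \<longlongrightarrow> 0) (at 0)" by auto
  then show ?thesis
  proof cases
    case 1
    have "(h \<longlongrightarrow> l - 1) (at 0)"
      unfolding hg using tendsto_diff[OF 1 tendsto_const[of 1]] by (simp add: o_def)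
    then show ?thesis by (rule case1)
  next
    case 2
    have "(h \<longlongrightarrow> inverse l - 1) (at 0)"
      unfolding hg by (intro tendsto_intros 2)
    then show ?thesis by (rule case1)
  next
    case 3
    let ?w = "remove_sings g"
    have "?w analytic_on {0}" by (rule remove_sings_analytic_at[OF isog 3])
    from decay_at_finite_value[OF this recip_inverse_poly_nonzero order_recip_inverse_poly]
    have "((\<lambda>z. (z * deriv ?w z) ^ 4 / poly recip_inverse_poly (?w z)) \<longlongrightarrow> 0) (at 0)" .
    moreover have "\<forall>\<^sub>F z in at 0. (z * deriv ?w z) ^ 4 / poly recip_inverse_poly (?w z) = (z * deriv h z) ^ 4 / poly recip_poly (h z)"
      using ev
    proof eventually_elim
      case (elim z)
      have S: "open (ball 0 r - {0::complex})" by (simp add: open_delete)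
      have "g analytic_on {z}" using g elim S analytic_at by blast
      then have w: "?w z = g z" "deriv ?w z = deriv g z" by simp_all
      have gz: "g z \<noteq> 0" "g z \<noteq> 2" using gomit[OF elim] by auto
      have "((\<lambda>z. inverse (g z) - 1) has_field_derivative - deriv g z / (g z)\<^sup>2) (at z)"
        using holomorphic_derivI[OF g S elim] gz
        by (auto intro!: derivative_eq_intros simp: power2_eq_square divide_inverse)
      then have dh: "deriv h z = - deriv g z / (g z)\<^sup>2"
        unfolding hg[abs_def] by (rule DERIV_imp_deriv)
      have "(x * (- d / y\<^sup>2)) ^ 4 / ((inverse y - 1 + 1)\<^sup>2 * (2 * (inverse y - 1) + 1) ^ 3) = (x * d) ^ 4 / (y ^ 3 * (2 - y) ^ 3)"
        if "y \<noteq> 0" "y \<noteq> 2" for x d y :: complex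
      proof -
        have "2 * (inverse y - 1) + 1 = (2 - y) / y" "inverse y - 1 + 1 = 1 / y" using that by (simp_all add: field_simps)
        then show ?thesis using that by (simp add: power_divide power_mult_distrib field_simps)
      qed
      from this[OF gz] show ?case unfolding w dh poly_recip_poly poly_recip_inverse_poly hg[of z] by simp
    qed
    ultimately show ?thesis by (rule Lim_transform_eventually)
  qed
qed

section \<open>Every solution has two independent periods\<close>

lemma remove_sings_translate_period:
  assumes "\<And>z. f (z + w) = f z"
  shows "remove_sings f (z + w) = remove_sings f z"
proof -
  have "remove_sings (f \<circ> (\<lambda>z. w + z)) z = remove_sings f (w + z)"
    by (rule remove_sings_compose) (rule filtermap_plus_at)
  moreover have "f \<circ> (\<lambda>z. w + z) = f" using assms by (auto simp: add.commute)
  ultimately show ?thesis by (simp add: add.commute)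
qed

lemma deriv_translate_period:
  assumes "\<And>z. f (z + w) = f (z::complex)"
  shows "deriv f (z + w) = deriv f z"
proof -
  have "(\<lambda>z. f (w + z)) = f" using assms by (auto simp: add.commute)
  then show ?thesis using fun_cong[OF deriv_translate[of f w], of z] by (simp add: add.commute)
qed

lemma periods_add: "a \<in> periods u \<Longrightarrow> b \<in> periods u \<Longrightarrow> a + b \<in> periods u"
  by (simp add: periods_def add.assoc[symmetric])

lemma periods_minus: assumes "a \<in> periods u" shows "- a \<in> periods u"
proof -
  have "u (z - a + a) = u (z - a)" for z using assms unfolding periods_def by blast
  then show ?thesis by (simp add: periods_def)
qed

lemma zero_in_periods [simp]: "0 \<in> periods u" by (simp add: periods_def)

lemma periods_of_nat: "a \<in> periods u \<Longrightarrow> of_nat n * a \<in> periods u"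
  by (induction n) (auto simp: distrib_right intro: periods_add)

lemma periods_of_int: "a \<in> periods u \<Longrightarrow> of_int n * a \<in> periods u"
  using periods_of_nat[of a u] periods_minus[of _ u] by (cases n rule: int_cases2) fastforce+

context schwarzian_solution
begin

text \<open>
  At a ramified point of multiplicity \<open>m\<close> the numerator vanishes to order \<open>4 (m - 1)\<close>, which is \<open>12\<close> or \<open>4\<close>, exactly
  the order of the denominator. At a pole of order \<open>m\<close> the quotient vanishes to order \<open>4 (m - 1)\<close>, and elsewhere it
  is regular. Therefore \<open>ratio_ext\<close> is an entire function.
\<close>
definition ratio where "ratio z = deriv u z ^ 4 / ((u z)\<^sup>2 * ((u z)\<^sup>2 - 1) ^ 3)"
definition ratio_ext where "ratio_ext = remove_sings ratio"

text \<open>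
  Moving the value \<open>1\<close> to infinity: away from the ramified points this function is holomorphic even at the
  poles of \<open>u\<close>, and it omits \<open>-1\<close> and \<open>-1/2\<close>, the images of \<open>0\<close> and \<open>-1\<close>.
\<close>
definition recip where "recip = remove_sings (\<lambda>z. inverse (u z - 1))"

lemma ratio_meromorphic: "ratio meromorphic_on UNIV"
  unfolding ratio_def[abs_def] by (intro meromorphic_intros mero)

lemma recip_tendsto:
  assumes "is_pole u z \<or> u z \<noteq> 1"
  shows "((\<lambda>z. inverse (u z - 1)) \<longlongrightarrow> (if is_pole u z then 0 else inverse (u z - 1))) (at z)"
proof (cases "is_pole u z")
  case True
  then have "is_pole (\<lambda>z. u z - 1) z" by (simp add: is_pole_minus_const_iff)
  then show ?thesis using True is_pole_tendsto[of "\<lambda>z. u z - 1" z] by (simp add: o_def)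
next
  case False
  then have "(u \<longlongrightarrow> u z) (at z)" using analytic by (simp add: analytic_at_imp_isCont isContD)
  then show ?thesis using assms False by (auto intro!: tendsto_intros)
qed

lemma recip_eq:
  assumes "is_pole u z \<or> u z \<noteq> 1"
  shows "recip z = (if is_pole u z then 0 else inverse (u z - 1))" "recip analytic_on {z}"
proof -
  show "recip z = (if is_pole u z then 0 else inverse (u z - 1))"
    unfolding recip_def by (rule remove_sings_eqI[OF recip_tendsto[OF assms]])
  have "(\<lambda>z. inverse (u z - 1)) meromorphic_on {z}"
    using mero by (intro meromorphic_intros) (auto intro: meromorphic_on_subset)
  then have "isolated_singularity_at (\<lambda>z. inverse (u z - 1)) z"
    by (rule meromorphic_on_isolated_singularity)
  then show "recip analytic_on {z}"
    unfolding recip_def using recip_tendsto[OF assms] by (rule remove_sings_analytic_at)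
qed

lemma recip_omits:
  assumes "\<not> ramified_point u z"
  shows "recip analytic_on {z}" "recip z \<noteq> -1" "recip z \<noteq> -1/2"
proof -
  have z: "is_pole u z \<or> (u z \<noteq> 0 \<and> u z \<noteq> 1 \<and> u z \<noteq> -1)"
    using assms by (auto simp: ramified_point_def)
  then show "recip analytic_on {z}" using recip_eq by blast
  have eq: "recip z = (if is_pole u z then 0 else inverse (u z - 1))" using recip_eq(1) z by blast
  show "recip z \<noteq> -1"
  proof
    assume "recip z = -1"
    then have "\<not> is_pole u z" "inverse (u z - 1) = inverse (- 1)" unfolding eq by (auto split: if_splits)
    then have "u z - 1 = -1" using inverse_eq_imp_eq by blast
    then show False using z \<open>\<not> is_pole u z\<close> by simp
  qed
  show "recip z \<noteq> -1/2"
  proof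
    assume "recip z = -1/2"
    then have "\<not> is_pole u z" "inverse (u z - 1) = inverse (- 2)" unfolding eq by (auto split: if_splits)
    then have "u z - 1 = -2" using inverse_eq_imp_eq by blast
    then show False using z \<open>\<not> is_pole u z\<close> by (simp add: algebra_simps)
  qed
qed

lemma generic_near:
  "\<forall>\<^sub>F z in at a. u analytic_on {z} \<and> u z \<notin> {0, 1, -1}"
proof -
  have "\<forall>\<^sub>\<approx>z\<in>UNIV. u analytic_on {z} \<and> u z \<notin> {0, 1, -1}"
    using meromorphic_on_imp_analytic_cosparse[OF mero] avoids[of 0] avoids[of 1] avoids[of "-1"]
    by eventually_elim auto
  then show ?thesis using eventually_cosparse_imp_eventually_at by blast
qed

lemma ratio_eq_recip:
  assumes "u analytic_on {z}" "u z \<notin> {0, 1, -1}"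
  shows "ratio z = deriv recip z ^ 4 / poly recip_poly (recip z)"
proof -
  have uz: "u z \<noteq> 0" "u z - 1 \<noteq> 0" "u z + 1 \<noteq> 0" using assms(2) by (auto simp: eq_neg_iff_add_eq_0)
  obtain S where S: "open S" "z \<in> S" "u holomorphic_on S" using assms(1) by (auto simp: analytic_at)
  have "(\<lambda>z. inverse (u z - 1)) analytic_on {z}"
    using assms by (intro analytic_intros) auto
  then have 1: "recip z = inverse (u z - 1)" "deriv recip z = deriv (\<lambda>z. inverse (u z - 1)) z"
    unfolding recip_def by simp_all
  have "((\<lambda>z. inverse (u z - 1)) has_field_derivative - deriv u z / (u z - 1)\<^sup>2) (at z)"
    using holomorphic_derivI[OF S(3,1,2)] uz
    by (auto intro!: derivative_eq_intros simp: power2_eq_square divide_inverse)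
  then have 2: "deriv recip z = - deriv u z / (u z - 1)\<^sup>2" unfolding 1 by (rule DERIV_imp_deriv)
  have "d ^ 4 / (y\<^sup>2 * (y\<^sup>2 - 1) ^ 3) = (- d / (y - 1)\<^sup>2) ^ 4 / ((inverse (y - 1) + 1)\<^sup>2 * (2 * inverse (y - 1) + 1) ^ 3)"
    if y: "y \<noteq> 0" "y - 1 \<noteq> 0" "y + 1 \<noteq> 0" for d y :: complex
  proof -
    have a: "inverse (y - 1) + 1 = y / (y - 1)" "2 * inverse (y - 1) + 1 = (y + 1) / (y - 1)"
      using y by (simp_all add: field_simps)
    have b: "y\<^sup>2 - 1 = (y + 1) * (y - 1)" by (simp add: algebra_simps power2_eq_square)
    have e: "(- d / (y - 1)\<^sup>2) ^ 4 = d ^ 4 / (y - 1) ^ 8"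
      by (simp add: power_divide flip: power_mult)
    have "d ^ 4 / (y\<^sup>2 * (B * A) ^ 3) = d ^ 4 / A ^ 8 / ((y / A)\<^sup>2 * (B / A) ^ 3)"
      if "A \<noteq> 0" "B \<noteq> 0" for A B :: complex
      using that y(1) by (simp add: field_simps power_divide power_mult_distrib eval_nat_numeral)
    from this[OF y(2,3)] show ?thesis unfolding a b e .
  qed
  from this[OF uz] show ?thesis unfolding ratio_def 2 poly_recip_poly 1 by simp
qed

lemma ratio_ext_eq_recip:
  assumes "\<not> ramified_point u a"
  shows "ratio_ext a = deriv recip a ^ 4 / poly recip_poly (recip a)" "\<exists>l. (ratio \<longlongrightarrow> l) (at a)"
proof -
  have recip: "recip analytic_on {a}" "recip a \<noteq> -1" "recip a \<noteq> -1/2" using recip_omits[OF assms] by auto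
  have "2 * recip a + 1 \<noteq> 0"
  proof
    assume "2 * recip a + 1 = 0"
    moreover have "recip a = (2 * recip a + 1) / 2 - 1 / 2" by (simp add: field_simps)
    ultimately show False using recip by simp
  qed
  then have nz: "poly recip_poly (recip a) \<noteq> 0" using recip by (auto simp: poly_recip_poly eq_neg_iff_add_eq_0)
  have "(recip \<longlongrightarrow> recip a) (at a)" "(deriv recip \<longlongrightarrow> deriv recip a) (at a)"
    using recip(1) analytic_deriv[OF recip(1)] by (auto simp: analytic_at_imp_isCont isContD)
  then have lim: "((\<lambda>z. deriv recip z ^ 4 / poly recip_poly (recip z)) \<longlongrightarrow> deriv recip a ^ 4 / poly recip_poly (recip a)) (at a)"
    using nz by (intro tendsto_intros)
  moreover have "\<forall>\<^sub>F z in at a. deriv recip z ^ 4 / poly recip_poly (recip z) = ratio z"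
    using generic_near[of a] by eventually_elim (simp add: ratio_eq_recip)
  ultimately have "(ratio \<longlongrightarrow> deriv recip a ^ 4 / poly recip_poly (recip a)) (at a)"
    by (rule Lim_transform_eventually)
  then show "ratio_ext a = deriv recip a ^ 4 / poly recip_poly (recip a)" "\<exists>l. (ratio \<longlongrightarrow> l) (at a)"
    unfolding ratio_ext_def by blast+
qed

lemma ratio_tendsto_at_ramified_point:
  assumes "ramified_point u a"
  shows "\<exists>l. (ratio \<longlongrightarrow> l) (at a)"
proof -
  let ?t = "u a" and ?m = "ramification_index (u a)"
  define j :: nat where "j = (if ?t = 0 then 2 else 3)"
  define q :: "complex \<Rightarrow> complex" where
    "q w = (if ?t = 0 then (w\<^sup>2 - 1) ^ 3 else if ?t = 1 then w\<^sup>2 * (w + 1) ^ 3 else w\<^sup>2 * (w - 1) ^ 3)" for w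
  have t: "?t \<in> {0, 1, -1}" using assms by (auto simp: ramified_point_def)
  have q: "w\<^sup>2 * (w\<^sup>2 - 1) ^ 3 = (w - ?t) ^ j * q w" for w
  proof -
    have "w\<^sup>2 - 1 = (w + 1) * (w - 1)" by (simp add: algebra_simps power2_eq_square)
    then show ?thesis using t by (auto simp: q_def j_def power_mult_distrib)
  qed
  have q0: "q ?t \<noteq> 0" using t by (auto simp: q_def)
  have jm: "(?m - 1) * 4 = ?m * j" "?m > 0" using t by (auto simp: ramification_index_def j_def)
  obtain P where P: "ramified_expansion u a P" using ramified_expansion_exists[OF assms] by blast
  then have P': "P analytic_on {0}" "P 0 \<noteq> 0" "\<forall>\<^sub>F z in nhds 0. u (a + z) = ?t + z ^ ?m * P z"
    by (simp_all add: ramified_expansion_def)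
  from power_factor_nhd[OF P'(1,2) jm(2) P'(3), of "\<lambda>_. True"] obtain r where
    r: "r > 0" "P holomorphic_on ball 0 r" "\<And>z. z \<in> ball 0 r \<Longrightarrow> deriv_factor ?m P z \<noteq> 0"
    "\<And>z. z \<in> ball 0 r \<Longrightarrow> u (a + z) = ?t + z ^ ?m * P z" by auto
  let ?p = "deriv_factor ?m P"
  have hp: "?p holomorphic_on ball 0 r" using r by (intro holomorphic_intros) auto
  have r0: "(0::complex) \<in> ball 0 r" using r by simp
  have ev: "\<forall>\<^sub>F z in at (0::complex). z \<in> ball 0 r - {0}"
    using r(1) by (intro eventually_at_in_open) auto
  have limP: "(P \<longlongrightarrow> P 0) (at 0)" and limp: "(?p \<longlongrightarrow> ?p 0) (at 0)"
    using holomorphic_tendsto_at[OF r(2) _ r0] holomorphic_tendsto_at[OF hp _ r0] by auto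
  have nz: "\<forall>\<^sub>F z in at 0. P z \<noteq> 0"
    using limP P'(2) by (rule tendsto_imp_eventually_ne)
  have "((\<lambda>z. ?t + z ^ ?m * P z) \<longlongrightarrow> ?t + 0 ^ ?m * P 0) (at 0)" by (intro tendsto_intros limP)
  then have limu: "((\<lambda>z. ?t + z ^ ?m * P z) \<longlongrightarrow> ?t) (at 0)" using jm by (simp add: zero_power)
  have "isCont q x" for x
    unfolding q_def[abs_def] by (cases "?t = 0"; cases "?t = 1") (auto intro!: continuous_intros)
  then have "((\<lambda>z. q (?t + z ^ ?m * P z)) \<longlongrightarrow> q ?t) (at 0)"
    using limu by (rule isCont_tendsto_compose)
  then have "((\<lambda>z. ?p z ^ 4 / (P z ^ j * q (?t + z ^ ?m * P z))) \<longlongrightarrow> ?p 0 ^ 4 / (P 0 ^ j * q ?t)) (at 0)"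
    by (intro tendsto_intros limp limP) (use P'(2) q0 in auto)
  moreover have "\<forall>\<^sub>F z in at 0. ?p z ^ 4 / (P z ^ j * q (?t + z ^ ?m * P z)) = ratio (a + z)"
    using ev nz
  proof eventually_elim
    case (elim z)
    have d: "deriv u (a + z) = z ^ (?m - 1) * ?p z"
      using deriv_power_factor[OF open_ball r(2) jm(2) r(4), of z] elim by (simp add: deriv_translate)
    have *: "(z ^ (?m - 1)) ^ 4 = (z ^ ?m) ^ j" unfolding power_mult[symmetric] jm ..
    have "ratio (a + z) = (z ^ (?m - 1) * ?p z) ^ 4 / ((z ^ ?m * P z) ^ j * q (?t + z ^ ?m * P z))"
      unfolding ratio_def d q using r(4)[of z] elim by simp
    also have "\<dots> = ?p z ^ 4 / (P z ^ j * q (?t + z ^ ?m * P z))"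
      unfolding power_mult_distrib * using elim by simp
    finally show ?case by simp
  qed
  ultimately have "((\<lambda>z. ratio (a + z)) \<longlongrightarrow> ?p 0 ^ 4 / (P 0 ^ j * q ?t)) (at 0)"
    by (rule Lim_transform_eventually)
  then have "(ratio \<longlongrightarrow> ?p 0 ^ 4 / (P 0 ^ j * q ?t)) (at a)"
    by (subst at_to_0[of a]) (simp add: filterlim_filtermap add.commute)
  then show ?thesis by blast
qed

lemma ratio_ext_holomorphic: "ratio_ext holomorphic_on UNIV"
proof -
  have "ratio_ext analytic_on {a}" for a
  proof -
    have "\<exists>l. (ratio \<longlongrightarrow> l) (at a)" using ratio_ext_eq_recip(2) ratio_tendsto_at_ramified_point by blast
    moreover have "isolated_singularity_at ratio a"
      using ratio_meromorphic by (metis UNIV_I meromorphic_on_altdef)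
    ultimately show ?thesis unfolding ratio_ext_def using remove_sings_analytic_at by blast
  qed
  then show ?thesis by (meson analytic_imp_holomorphic analytic_on_analytic_at)
qed

lemma ratio_ext_period: assumes "w \<in> periods u" shows "ratio_ext (z + w) = ratio_ext z"
proof -
  have "u (z + w) = u z" for z using assms by (simp add: periods_def)
  then have "ratio (z + w) = ratio z" for z
    by (simp add: ratio_def deriv_translate_period)
  then show ?thesis unfolding ratio_ext_def by (rule remove_sings_translate_period)
qed

lemma recip_period: assumes "w \<in> periods u" shows "recip (z + w) = recip z"
  unfolding recip_def by (rule remove_sings_translate_period) (use assms in \<open>simp add: periods_def\<close>)

lemma ratio_ext_eq_ratio: "\<forall>\<^sub>\<approx>z\<in>UNIV. ratio_ext z = ratio z"
  unfolding ratio_ext_def by (rule eventually_remove_sings_eq[OF ratio_meromorphic])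

text \<open>
  Otherwise \<open>u'\<close> would vanish identically.
\<close>
lemma ratio_ext_not_zero: "\<not> (\<forall>z. ratio_ext z = 0)"
proof
  assume F0: "\<forall>z. ratio_ext z = 0"
  have "\<forall>\<^sub>\<approx>z\<in>UNIV. deriv u z = 0 \<and> u analytic_on {z}"
    using ratio_ext_eq_ratio meromorphic_on_imp_analytic_cosparse[OF mero] avoids[of 0] avoids[of 1] avoids[of "-1"]
  proof eventually_elim
    case (elim z)
    have "(u z)\<^sup>2 - 1 = (u z + 1) * (u z - 1)" by (simp add: algebra_simps power2_eq_square)
    then have "(u z)\<^sup>2 * ((u z)\<^sup>2 - 1) ^ 3 \<noteq> 0" using elim by (auto simp: eq_neg_iff_add_eq_0)
    then show ?case using elim F0 by (simp add: ratio_def)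
  qed
  then have ev: "\<forall>\<^sub>F z in at x. deriv u z = 0 \<and> u analytic_on {z}" for x
    using eventually_cosparse_imp_eventually_at by blast
  then obtain r where r: "r > 0" "\<And>z. z \<noteq> 0 \<Longrightarrow> dist z 0 < r \<Longrightarrow> deriv u z = 0 \<and> u analytic_on {z}"
    unfolding eventually_at by blast
  define b where "b = complex_of_real (r / 2)"
  have S: "ball b (r / 2) \<subseteq> ball 0 r - {0}"
  proof
    fix x assume "x \<in> ball b (r / 2)"
    then have x: "dist b x < r / 2" by simp
    have "dist 0 x \<le> dist 0 b + dist b x" by (rule dist_triangle)
    moreover have "dist 0 b = r / 2" using r by (simp add: b_def)
    moreover have "x \<noteq> 0" using x r by (auto simp: b_def)
    ultimately show "x \<in> ball 0 r - {0}" using x by simp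
  qed
  have d0: "(u has_field_derivative 0) (at z)" if "z \<in> ball b (r / 2)" for z
  proof -
    have "z \<in> ball 0 r - {0}" using S that by blast
    then have z: "deriv u z = 0" "u analytic_on {z}" using r(2)[of z] by (auto simp: dist_commute)
    then have "u field_differentiable at z" by (auto simp: analytic_at intro: holomorphic_on_imp_differentiable_at)
    then show ?thesis using z(1) by (metis DERIV_deriv_iff_field_differentiable)
  qed
  have "\<exists>c. \<forall>z\<in>ball b (r / 2). u z = c"
    by (rule has_field_derivative_zero_constant[OF convex_ball])
       (use d0 in \<open>auto intro: has_field_derivative_at_within\<close>)
  then obtain k where k: "\<And>z. z \<in> ball b (r / 2) \<Longrightarrow> u z = k" by auto
  have "\<forall>\<^sub>F z in at b. z \<in> ball b (r / 2)" using r by (intro eventually_at_in_open') auto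
  then have "\<forall>\<^sub>F z in at b. u z = k" by eventually_elim (rule k)
  then show False using not_locally_constant by blast
qed

text \<open>
  In the coordinate \<open>1/z\<close> the function \<open>recip\<close> has a puncture at \<open>0\<close>, so \<open>ratio_ext\<close> tends to \<open>0\<close> at infinity and
  vanishes by Liouville.
\<close>
lemma ramified_points_unbounded:
  assumes M: "M > 0" "\<And>z. ramified_point u z \<Longrightarrow> norm z \<le> M"
  shows False
proof -
  define h where "h x = recip (inverse x)" for x
  let ?B = "ball 0 (inverse M) - {0::complex}"
  have S: "open ?B" by (simp add: open_delete)
  have big: "\<not> ramified_point u (inverse x)" if "x \<in> ?B" for x
  proof
    assume "ramified_point u (inverse x)"
    then have "norm (inverse x) \<le> M" using M by blast
    moreover have "inverse (inverse M) < inverse (norm x)"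
      using that by (intro less_imp_inverse_less) auto
    ultimately show False by (simp add: norm_inverse)
  qed
  have hd: "(h has_field_derivative deriv recip (inverse x) * (- (inverse x ^ 2))) (at x)" if "x \<in> ?B" for x
  proof -
    have "recip field_differentiable at (inverse x)"
      using recip_omits(1)[OF big[OF that]] by (auto simp: analytic_at intro: holomorphic_on_imp_differentiable_at)
    then have "(recip has_field_derivative deriv recip (inverse x)) (at (inverse x))"
      by (simp add: DERIV_deriv_iff_field_differentiable)
    moreover have "(inverse has_field_derivative - (inverse x ^ 2)) (at x)"
      using DERIV_inverse[of x] that by (simp add: numeral_2_eq_2)
    ultimately show ?thesis unfolding h_def[abs_def] by (rule DERIV_chain2)
  qed
  then have "h holomorphic_on ?B" by (meson S holomorphic_on_open)
  moreover have "h x \<noteq> -1 \<and> h x \<noteq> -1/2" if "x \<in> ?B" for x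
    using recip_omits[OF big[OF that]] by (simp add: h_def)
  ultimately have "((\<lambda>z. (z * deriv h z) ^ 4 / poly recip_poly (h z)) \<longlongrightarrow> 0) (at 0)"
    using decay_at_puncture[of "inverse M" h] M(1) by auto
  then have "((\<lambda>z. z ^ 4 * ((z * deriv h z) ^ 4 / poly recip_poly (h z))) \<longlongrightarrow> 0 ^ 4 * 0) (at 0)"
    by (intro tendsto_intros)
  then have "((\<lambda>z. z ^ 4 * ((z * deriv h z) ^ 4 / poly recip_poly (h z))) \<longlongrightarrow> 0) (at 0)" by simp
  moreover have "\<forall>\<^sub>F z in at 0. z ^ 4 * ((z * deriv h z) ^ 4 / poly recip_poly (h z)) = (ratio_ext \<circ> inverse) z"
  proof -
    have "\<forall>\<^sub>F z in at 0. z \<in> ?B" using M(1) by (intro eventually_at_in_open) auto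
    then show ?thesis
    proof eventually_elim
      case (elim z)
      have d: "deriv h z = deriv recip (inverse z) * (- (inverse z ^ 2))" using hd[OF elim] by (rule DERIV_imp_deriv)
      have "z ^ 4 * (z * deriv h z) ^ 4 = deriv recip (inverse z) ^ 4"
      proof -
        have "z ^ 4 * (z * deriv h z) ^ 4 = (z * (z * deriv h z)) ^ 4" by (simp add: power_mult_distrib)
        also have "z * (z * deriv h z) = - deriv recip (inverse z)"
          unfolding d using elim by (simp add: power2_eq_square field_simps)
        finally show ?thesis by simp
      qed
      then show ?case using ratio_ext_eq_recip(1)[OF big[OF elim]] by (simp add: h_def)
    qed
  qed
  ultimately have "((ratio_ext \<circ> inverse) \<longlongrightarrow> 0) (at 0)" by (rule Lim_transform_eventually)
  then have "(ratio_ext \<longlongrightarrow> 0) at_infinity" by (simp add: lim_at_infinity_0)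
  then show False using Liouville_weak_0[OF ratio_ext_holomorphic] ratio_ext_not_zero by blast
qed

text \<open>
  By periodicity \<open>recip\<close> is a function \<open>h\<close> of \<open>exp (2\<pi>iz/w)\<close>, and the half-plane becomes a
  punctured disc around \<open>0\<close>.
\<close>
lemma ratio_ext_decay_half_plane:
  assumes w: "w \<in> periods u" "w \<noteq> 0" and M: "\<And>z. ramified_point u z \<Longrightarrow> Im (z / w) \<le> M" and e: "e > 0"
  obtains N where "\<And>z. Im (z / w) > N \<Longrightarrow> norm (ratio_ext z) < e"
proof -
  define k where "k = w / (2 * of_real pi * \<i>)"
  have k: "k \<noteq> 0" using w by (simp add: k_def)
  have kw: "z / k = 2 * of_real pi * \<i> * (z / w)" for z using w by (simp add: k_def)
  have nexp: "norm (exp (z / k)) = exp (- 2 * pi * Im (z / w))" for z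
  proof -
    have "Re (2 * of_real pi * \<i> * t) = - 2 * pi * Im t" for t by simp
    then show ?thesis unfolding kw norm_exp_eq_Re by (simp only:)
  qed
  define h where "h x = recip (k * Ln x)" for x
  define r where "r = exp (- 2 * pi * M)"
  let ?B = "ball 0 r - {0::complex}"
  have S: "open ?B" by (simp add: open_delete)
  have nt: "\<not> ramified_point u z" if "exp (z / k) \<in> ?B" for z
  proof
    assume "ramified_point u z"
    then have "Im (z / w) \<le> M" by (rule M)
    then have "exp (- 2 * pi * M) \<le> exp (- 2 * pi * Im (z / w))" by simp
    then show False using that nexp[of z] by (simp add: r_def)
  qed
  have hv: "h (exp (z / k)) = recip z" for z
  proof -
    have "exp (Ln (exp (z / k))) = exp (z / k)" by simp
    then obtain n :: int where n: "Ln (exp (z / k)) = z / k + (of_int (2 * n) * of_real pi) * \<i>"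
      unfolding exp_eq by auto
    have "k * Ln (exp (z / k)) = z + of_int n * w" unfolding n using k by (simp add: k_def field_simps)
    then show ?thesis unfolding h_def using recip_period[OF periods_of_int[OF w(1)]] by simp
  qed
  have hol: "h field_differentiable at x" if x: "x \<in> ?B" for x
  proof -
    \<comment> \<open>A branch of \<open>k Ln y\<close> that is holomorphic near \<open>x\<close> even on the cut of \<open>Ln\<close>; by periodicity it gives the same \<open>h\<close>.\<close>
    define l where "l y = k * (Ln (y / x) + Ln x)" for y
    have x0: "x \<noteq> 0" using x by auto
    define S where "S = (\<lambda>y. y / x) -` (- \<real>\<^sub>\<le>\<^sub>0)"
    have "open S" unfolding S_def by (intro open_vimage continuous_intros) (use x0 in \<open>auto simp: closed_nonpos_Reals_complex\<close>)
    have "x \<in> S" using x0 by (simp add: S_def)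
    have exl: "exp (l y / k) = y" if "y \<in> S" for y
    proof -
      have "y \<noteq> 0" using that by (auto simp: S_def)
      then show ?thesis using k x0 by (simp add: l_def exp_add)
    qed
    have lx: "exp (l x / k) \<in> ?B" using exl[OF \<open>x \<in> S\<close>] x by simp
    have "l field_differentiable at x"
      unfolding l_def[abs_def] field_differentiable_def using x0
      by (auto intro!: derivative_eq_intros exI)
    moreover have "recip field_differentiable at (l x)"
      using recip_omits(1)[OF nt[OF lx]] by (auto simp: analytic_at intro: holomorphic_on_imp_differentiable_at)
    ultimately have "(\<lambda>y. recip (l y)) field_differentiable at x"
      using field_differentiable_compose[of l x recip] by (simp add: o_def)
    then obtain D where "((\<lambda>y. recip (l y)) has_field_derivative D) (at x)" by (auto simp: field_differentiable_def)
    moreover have "recip (l y) = h y" if "y \<in> S" for y using hv[of "l y"] exl[OF that] by simp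
    ultimately have "(h has_field_derivative D) (at x)"
      using \<open>open S\<close> \<open>x \<in> S\<close> has_field_derivative_transform_within_open[of "\<lambda>y. recip (l y)" D x S h] by simp
    then show ?thesis by (auto simp: field_differentiable_def)
  qed
  then have "h holomorphic_on ?B" by (simp add: holomorphic_on_def field_differentiable_at_within)
  moreover have "h x \<noteq> -1 \<and> h x \<noteq> -1/2" if "x \<in> ?B" for x
  proof -
    have "exp (k * Ln x / k) = x" using that k by simp
    then have "\<not> ramified_point u (k * Ln x)" using nt[of "k * Ln x"] that by simp
    then show ?thesis using recip_omits by (simp add: h_def)
  qed
  ultimately have "((\<lambda>z. (z * deriv h z) ^ 4 / poly recip_poly (h z)) \<longlongrightarrow> 0) (at 0)"
    using decay_at_puncture[of r h] by (auto simp: r_def)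
  moreover have "e * norm k ^ 4 > 0" using e k by simp
  ultimately have "\<forall>\<^sub>F z in at 0. dist ((z * deriv h z) ^ 4 / poly recip_poly (h z)) 0 < e * norm k ^ 4"
    by (rule tendstoD)
  then obtain d where d: "d > 0" "\<And>z. z \<noteq> 0 \<Longrightarrow> dist z 0 < d \<Longrightarrow> norm ((z * deriv h z) ^ 4 / poly recip_poly (h z)) < e * norm k ^ 4"
    unfolding eventually_at by auto
  define d' where "d' = min d r"
  have d': "d' > 0" using d by (simp add: d'_def r_def)
  show ?thesis
  proof (rule that[of "- ln d' / (2 * pi)"])
    fix z assume "Im (z / w) > - ln d' / (2 * pi)"
    then have "- 2 * pi * Im (z / w) < ln d'" by (simp add: field_simps)
    then have "exp (- 2 * pi * Im (z / w)) < d'" using d' by (metis exp_less_cancel_iff exp_ln)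
    then have n: "norm (exp (z / k)) < d'" unfolding nexp .
    then have B: "exp (z / k) \<in> ?B" by (simp add: d'_def)
    let ?x = "exp (z / k)"
    have "norm ((?x * deriv h ?x) ^ 4 / poly recip_poly (h ?x)) < e * norm k ^ 4"
      using n by (intro d) (auto simp: d'_def)
    moreover have "?x * deriv h ?x = k * deriv recip z"
    proof -
      have "(h has_field_derivative deriv h ?x) (at ?x)"
        using hol[OF B] by (simp add: DERIV_deriv_iff_field_differentiable)
      moreover have "((\<lambda>z. exp (z / k)) has_field_derivative ?x / k) (at z)"
        using k by (auto intro!: derivative_eq_intros)
      ultimately have "((\<lambda>z. h (exp (z / k))) has_field_derivative deriv h ?x * (?x / k)) (at z)"
        by (rule DERIV_chain2)
      then have "deriv recip z = deriv h ?x * (?x / k)" unfolding hv by (rule DERIV_imp_deriv)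
      then show ?thesis using k by simp
    qed
    ultimately have "norm (k ^ 4 * ratio_ext z) < e * norm k ^ 4"
      using ratio_ext_eq_recip(1)[OF nt[OF B]] by (simp add: hv power_mult_distrib)
    then show "norm (ratio_ext z) < e" using k by (simp add: norm_mult norm_power mult.commute)
  qed
qed

lemma ratio_ext_bounded_strip:
  assumes w: "w \<in> periods u" "w \<noteq> 0"
  obtains K where "\<And>z. \<bar>Im (z / w)\<bar> \<le> N \<Longrightarrow> norm (ratio_ext z) \<le> K"
proof -
  define C where "C = (\<lambda>z. ratio_ext (w * z)) ` cbox (Complex 0 (-N)) (Complex 1 N)"
  have "continuous_on UNIV ratio_ext" using ratio_ext_holomorphic by (rule holomorphic_on_imp_continuous_on)
  then have "continuous_on (cbox (Complex 0 (-N)) (Complex 1 N)) (\<lambda>z. ratio_ext (w * z))"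
    by (rule continuous_on_compose2) (auto intro!: continuous_intros)
  then have "compact C" unfolding C_def by (rule compact_continuous_image) (rule compact_cbox)
  then have "bounded C" by (rule compact_imp_bounded)
  then obtain K where K: "\<And>x. x \<in> C \<Longrightarrow> norm x \<le> K" by (auto simp: bounded_iff)
  show ?thesis
  proof (rule that[of K])
    fix z assume z: "\<bar>Im (z / w)\<bar> \<le> N"
    define x where "x = z / w - of_int \<lfloor>Re (z / w)\<rfloor>"
    have "x \<in> cbox (Complex 0 (-N)) (Complex 1 N)"
      using z by (auto simp: in_cbox_complex_iff x_def) linarith+
    then have "norm (ratio_ext (w * x)) \<le> K" by (intro K) (auto simp: C_def)
    moreover have "w * x + of_int \<lfloor>Re (z / w)\<rfloor> * w = z" using w by (simp add: x_def algebra_simps)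
    ultimately show "norm (ratio_ext z) \<le> K"
      using ratio_ext_period[OF periods_of_int[OF w(1)]] by metis
  qed
qed

text \<open>
  The decay applies in both half-planes, with the periods \<open>w\<close> and \<open>-w\<close>; in the strip between them periodicity
  bounds \<open>ratio_ext\<close>. So it is a bounded entire function with limit \<open>0\<close>.
\<close>
lemma ramified_points_not_in_strip:
  assumes w: "w \<in> periods u" "w \<noteq> 0" and M: "\<And>z. ramified_point u z \<Longrightarrow> \<bar>Im (z / w)\<bar> \<le> M"
  shows False
proof -
  have M1: "Im (z / w) \<le> M" if "ramified_point u z" for z using M[OF that] by linarith
  have M2: "Im (z / - w) \<le> M" if "ramified_point u z" for z using M[OF that] by simp
  have w2: "- w \<in> periods u" "- w \<noteq> 0" using w periods_minus by auto
  have decay: "\<exists>N. \<forall>z. \<bar>Im (z / w)\<bar> > N \<longrightarrow> norm (ratio_ext z) < e" if e: "e > 0" for e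
  proof -
    obtain N1 where N1: "\<And>z. Im (z / w) > N1 \<Longrightarrow> norm (ratio_ext z) < e" using ratio_ext_decay_half_plane[OF w M1 e] by blast
    obtain N2 where N2: "\<And>z. Im (z / - w) > N2 \<Longrightarrow> norm (ratio_ext z) < e" using ratio_ext_decay_half_plane[OF w2 M2 e] by blast
    have "norm (ratio_ext z) < e" if "\<bar>Im (z / w)\<bar> > max N1 N2" for z
    proof (cases "Im (z / w) > 0")
      case True then show ?thesis using that by (intro N1) auto
    next
      case False then show ?thesis using that by (intro N2) auto
    qed
    then show ?thesis by blast
  qed
  obtain N where N: "\<And>z. \<bar>Im (z / w)\<bar> > N \<Longrightarrow> norm (ratio_ext z) < 1" using decay[of 1] by auto
  obtain K where K: "\<And>z. \<bar>Im (z / w)\<bar> \<le> N \<Longrightarrow> norm (ratio_ext z) \<le> K" using ratio_ext_bounded_strip[OF w] by blast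
  have "norm (ratio_ext z) \<le> max 1 K" for z
    using N[of z] K[of z] by (cases "\<bar>Im (z / w)\<bar> > N") auto
  then have "bounded (range ratio_ext)" by (auto simp: bounded_iff)
  then have "ratio_ext constant_on UNIV" by (rule Liouville_theorem[OF ratio_ext_holomorphic])
  then obtain c0 where c0: "\<And>z. ratio_ext z = c0" by (auto simp: constant_on_def)
  have "norm c0 < e" if e: "e > 0" for e
  proof -
    obtain N where N: "\<And>z. \<bar>Im (z / w)\<bar> > N \<Longrightarrow> norm (ratio_ext z) < e" using decay[OF e] by auto
    have "\<bar>Im ((w * \<i> * of_real (\<bar>N\<bar> + 1)) / w)\<bar> > N" using w(2) by simp
    from N[OF this] show ?thesis by (simp add: c0)
  qed
  from this[of "norm c0"] have "c0 = 0" by (cases "c0 = 0") auto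
  then show False using c0 ratio_ext_not_zero by simp
qed

text \<open>
  If all periods were real multiples of one of them, the finitely many classes of ramified points would lie in a strip; if
  there were no period but \<open>0\<close>, there would be only finitely many ramified points.
\<close>
theorem two_independent_periods:
  obtains w1 w2 where "w1 \<in> periods u" "w2 \<in> periods u" "w1 \<noteq> 0" "w2 \<noteq> 0" "w2 / w1 \<notin> \<real>"
proof (rule ccontr)
  assume no: "\<not> thesis"
  note found = that
  have real: "w2 / w1 \<in> \<real>" if "w1 \<in> periods u" "w2 \<in> periods u" "w1 \<noteq> 0" for w1 w2
  proof (rule ccontr)
    assume nr: "w2 / w1 \<notin> \<real>"
    then have "w2 \<noteq> 0" by auto
    then have thesis using found[OF that(1,2,3) _ nr] by blast
    then show False using no by simp
  qed
  obtain Z where Z: "finite Z" "\<And>z. ramified_point u z \<Longrightarrow> \<exists>w\<in>Z. z - w \<in> periods u"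
    using finitely_many_ramified_classes by blast
  show False
  proof (cases "\<exists>w\<in>periods u. w \<noteq> 0")
    case True
    then obtain w where w: "w \<in> periods u" "w \<noteq> 0" by blast
    obtain M where M: "\<And>z. z \<in> Z \<Longrightarrow> \<bar>Im (z / w)\<bar> \<le> M"
      using finite_imp_bounded[OF finite_imageI[OF Z(1), of "\<lambda>z. Im (z / w)"]] by (auto simp: bounded_iff)
    show False
    proof (rule ramified_points_not_in_strip[OF w])
      fix z assume "ramified_point u z"
      then obtain x where x: "x \<in> Z" "z - x \<in> periods u" using Z(2) by blast
      have "(z - x) / w \<in> \<real>" by (rule real[OF w(1) x(2) w(2)])
      then have "Im (z / w) = Im (x / w)" by (simp add: complex_is_Real_iff diff_divide_distrib)
      then show "\<bar>Im (z / w)\<bar> \<le> M" using M[OF x(1)] by simp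
    qed
  next
    case False
    obtain M where M: "M > 0" "\<And>z. z \<in> Z \<Longrightarrow> norm z \<le> M"
      using finite_imp_bounded[OF Z(1)] by (auto simp: bounded_pos)
    show False
    proof (rule ramified_points_unbounded[OF M(1)])
      fix z assume "ramified_point u z"
      then obtain x where "x \<in> Z" "z - x \<in> periods u" using Z(2) by blast
      then have "z = x" using False by auto
      then show "norm z \<le> M" using M(2) \<open>x \<in> Z\<close> by simp
    qed
  qed
qed

end

section \<open>Consequences of double periodicity\<close>

lemma lattice_coordinates:
  fixes w1 w2 z :: complex
  assumes "w1 \<noteq> 0" "w2 / w1 \<notin> \<real>"
  obtains a b :: real where "z = of_real a * w1 + of_real b * w2"
proof -
  define t where "t = w2 / w1"
  have t: "Im t \<noteq> 0" using assms(2) by (simp add: t_def complex_is_Real_iff)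
  define b where "b = Im (z / w1) / Im t"
  define a where "a = Re (z / w1) - b * Re t"
  have "z / w1 = of_real a + of_real b * t"
    using t by (simp add: complex_eq_iff a_def b_def)
  then have "z / w1 * w1 = of_real a * w1 + of_real b * (t * w1)" by (simp add: distrib_right)
  then have "z = of_real a * w1 + of_real b * w2" using assms(1) by (simp add: t_def)
  then show ?thesis by (rule that)
qed

lemma doubly_periodic_holomorphic_constant:
  assumes f: "f holomorphic_on UNIV" and w: "w1 \<in> periods f" "w2 \<in> periods f" "w1 \<noteq> 0" "w2 / w1 \<notin> \<real>"
  shows "f constant_on UNIV"
proof -
  define C where "C = (\<lambda>p. f (of_real (Re p) * w1 + of_real (Im p) * w2)) ` cbox 0 (Complex 1 1)"
  have "continuous_on UNIV f" using f by (rule holomorphic_on_imp_continuous_on)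
  then have "continuous_on (cbox 0 (Complex 1 1)) (\<lambda>p. f (of_real (Re p) * w1 + of_real (Im p) * w2))"
    by (rule continuous_on_compose2) (auto intro!: continuous_intros)
  then have "compact C" unfolding C_def by (rule compact_continuous_image) (rule compact_cbox)
  then have "bounded C" by (rule compact_imp_bounded)
  moreover have "range f \<subseteq> C"
  proof
    fix y assume "y \<in> range f"
    then obtain z where z: "y = f z" by blast
    obtain a b where ab: "z = of_real a * w1 + of_real b * w2" using lattice_coordinates[OF w(3,4)] by blast
    define p where "p = Complex (frac a) (frac b)"
    have p: "p \<in> cbox 0 (Complex 1 1)"
      by (simp add: in_cbox_complex_iff p_def less_imp_le[OF frac_lt_1])
    have "of_real (Re p) * w1 + of_real (Im p) * w2 + (of_int \<lfloor>a\<rfloor> * w1 + of_int \<lfloor>b\<rfloor> * w2) = z"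
      by (simp add: p_def ab frac_def algebra_simps)
    moreover have "of_int \<lfloor>a\<rfloor> * w1 + of_int \<lfloor>b\<rfloor> * w2 \<in> periods f"
      by (intro periods_add periods_of_int w)
    then have "f (x + (of_int \<lfloor>a\<rfloor> * w1 + of_int \<lfloor>b\<rfloor> * w2)) = f x" for x by (simp add: periods_def)
    ultimately have "f z = f (of_real (Re p) * w1 + of_real (Im p) * w2)" by metis
    then show "y \<in> C" unfolding C_def z using p by blast
  qed
  ultimately have "bounded (range f)" by (rule bounded_subset)
  then show ?thesis by (rule Liouville_theorem[OF f])
qed

text \<open>
  Logarithmic differentiation gives \<open>u''/u' = u' q(u)\<close> with \<open>q(w) = 1/(2w) + 3w/(2(w\<^sup>2 - 1))\<close>. Hence
  \<open>S(u) = u'\<^sup>2 (q\<^sup>2/2 + q')(u)\<close>, and \<open>q\<^sup>2/2 + q' = -(3/2) (w\<^sup>2 + 1/4) / (w\<^sup>2 (w\<^sup>2 - 1)\<^sup>2)\<close>.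
\<close>
lemma schwarzian_of_quartic:
  assumes S: "open S" and u: "u holomorphic_on S" and K: "K \<noteq> 0"
    and quartic: "\<And>z. z \<in> S \<Longrightarrow> deriv u z ^ 4 = K * ((u z)\<^sup>2 * ((u z)\<^sup>2 - 1) ^ 3)"
    and nz: "\<And>z. z \<in> S \<Longrightarrow> u z \<noteq> 0 \<and> (u z)\<^sup>2 \<noteq> 1" and z: "z \<in> S"
  shows "(schwarzian u z)\<^sup>2 * ((u z)\<^sup>2 * ((u z)\<^sup>2 - 1)) = 9 / 4 * K * ((u z)\<^sup>2 + 1 / 4)\<^sup>2"
proof -
  define q where "q w = 1 / (2 * w) + 3 * w / (2 * (w\<^sup>2 - 1))" for w :: complex
  have du: "(u has_field_derivative deriv u x) (at x)" if "x \<in> S" for x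
    using holomorphic_derivI[OF u S that] .
  have du1: "(deriv u has_field_derivative deriv (deriv u) x) (at x)" if "x \<in> S" for x
    by (rule holomorphic_derivI[OF _ S that]) (intro holomorphic_intros u S)
  have d0: "deriv u x \<noteq> 0" if "x \<in> S" for x
    using quartic[OF that] nz[OF that] K by auto
  have n: "deriv (deriv u) x = (deriv u x)\<^sup>2 * q (u x)" if x: "x \<in> S" for x
  proof -
    let ?u = "u x" and ?d = "deriv u x" and ?e = "deriv (deriv u) x"
    have 1: "((\<lambda>y. deriv u y ^ 4) has_field_derivative 4 * ?d ^ 3 * ?e) (at x)"
      using du1[OF x] by (auto intro!: derivative_eq_intros)
    have "((\<lambda>y. K * ((u y)\<^sup>2 * ((u y)\<^sup>2 - 1) ^ 3)) has_field_derivative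
       K * (2 * ?u * ?d * (?u\<^sup>2 - 1) ^ 3 + ?u\<^sup>2 * (3 * (?u\<^sup>2 - 1)\<^sup>2 * (2 * ?u * ?d)))) (at x)"
      using du[OF x] by (auto intro!: derivative_eq_intros)
    then have "((\<lambda>y. deriv u y ^ 4) has_field_derivative
       K * (2 * ?u * ?d * (?u\<^sup>2 - 1) ^ 3 + ?u\<^sup>2 * (3 * (?u\<^sup>2 - 1)\<^sup>2 * (2 * ?u * ?d)))) (at x)"
      by (rule has_field_derivative_transform_within_open[OF _ S x]) (simp add: quartic)
    from DERIV_unique[OF 1 this] have
      "4 * ?d ^ 3 * ?e = K * (2 * ?u * ?d * (?u\<^sup>2 - 1) ^ 3 + ?u\<^sup>2 * (3 * (?u\<^sup>2 - 1)\<^sup>2 * (2 * ?u * ?d)))" .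
    also have "\<dots> = 4 * ?d * (K * (?u\<^sup>2 * (?u\<^sup>2 - 1) ^ 3)) * q ?u"
    proof -
      have *: "K * (2 * y * d * A ^ 3 + y\<^sup>2 * (3 * A\<^sup>2 * (2 * y * d))) = 4 * d * (K * (y\<^sup>2 * A ^ 3)) * (1 / (2 * y) + 3 * y / (2 * A))"
        if "y \<noteq> 0" "A \<noteq> 0" for y d A :: complex
        using that by (simp add: field_simps eval_nat_numeral)
      show ?thesis unfolding q_def using nz[OF x] by (intro *) auto
    qed
    also have "\<dots> = 4 * ?d ^ 3 * (?d\<^sup>2 * q ?u)" unfolding quartic[OF x, symmetric] by (simp add: eval_nat_numeral)
    finally show ?thesis using d0[OF x] by simp
  qed
  have nn: "deriv (deriv u) x / deriv u x = deriv u x * q (u x)" if "x \<in> S" for x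
    unfolding n[OF that] using d0[OF that] by (simp add: power2_eq_square)
  let ?u = "u z" and ?d = "deriv u z"
  define q' where "q' = - 1 / (2 * ?u\<^sup>2) - 3 / 2 * (?u\<^sup>2 + 1) / (?u\<^sup>2 - 1)\<^sup>2"
  have A: "?u \<noteq> 0" "?u\<^sup>2 - 1 \<noteq> 0" using nz[OF z] by auto
  have "(q has_field_derivative q') (at ?u)"
  proof -
    have "((\<lambda>w. 1 / (2 * w)) has_field_derivative - 1 / (2 * ?u\<^sup>2)) (at ?u)"
      using A by (auto intro!: derivative_eq_intros simp: power2_eq_square)
    moreover have "((\<lambda>w. 3 * w / (2 * (w\<^sup>2 - 1))) has_field_derivative
        (3 * (2 * (?u\<^sup>2 - 1)) - 3 * ?u * (2 * (2 * ?u))) / (2 * (?u\<^sup>2 - 1))\<^sup>2) (at ?u)"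
      using A by (auto intro!: derivative_eq_intros simp: power2_eq_square)
    ultimately have "(q has_field_derivative - 1 / (2 * ?u\<^sup>2) + (3 * (2 * (?u\<^sup>2 - 1)) - 3 * ?u * (2 * (2 * ?u))) / (2 * (?u\<^sup>2 - 1))\<^sup>2) (at ?u)"
      unfolding q_def[abs_def] by (rule DERIV_add)
    moreover have "(3 * (2 * (?u\<^sup>2 - 1)) - 3 * ?u * (2 * (2 * ?u))) / (2 * (?u\<^sup>2 - 1))\<^sup>2 = - (3 / 2 * (?u\<^sup>2 + 1) / (?u\<^sup>2 - 1)\<^sup>2)"
    proof -
      have "3 * (2 * (?u\<^sup>2 - 1)) - 3 * ?u * (2 * (2 * ?u)) = - 6 * (?u\<^sup>2 + 1)"
        by (simp add: algebra_simps power2_eq_square)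
      moreover have "- 6 * B / (2 * C)\<^sup>2 = - (3 / 2 * B / C\<^sup>2)" if "C \<noteq> 0" for B C :: complex
        using that by (simp add: field_simps power2_eq_square)
      ultimately show ?thesis using A(2) by metis
    qed
    ultimately show ?thesis unfolding q'_def by (simp only: diff_conv_add_uminus)
  qed
  from DERIV_chain2[OF this du[OF z]]
  have "((\<lambda>x. deriv u x * q (u x)) has_field_derivative deriv (deriv u) z * q ?u + ?d * (q' * ?d)) (at z)"
    using du1[OF z] by (auto intro!: derivative_eq_intros)
  then have "((\<lambda>x. deriv (deriv u) x / deriv u x) has_field_derivative deriv (deriv u) z * q ?u + ?d * (q' * ?d)) (at z)"
    by (rule has_field_derivative_transform_within_open[OF _ S z]) (simp add: nn)
  then have "deriv (\<lambda>x. deriv (deriv u) x / deriv u x) z = deriv (deriv u) z * q ?u + ?d * (q' * ?d)"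
    by (rule DERIV_imp_deriv)
  then have "schwarzian u z = ?d\<^sup>2 * ((q ?u)\<^sup>2 / 2 + q')"
    unfolding schwarzian_def nn[OF z] unfolding n[OF z] by (simp add: field_simps power2_eq_square)
  also have "(q ?u)\<^sup>2 / 2 + q' = - 3 / 2 * (?u\<^sup>2 + 1 / 4) / (?u\<^sup>2 * (?u\<^sup>2 - 1)\<^sup>2)"
  proof -
    have "(1 / (2 * y) + 3 * y / (2 * A))\<^sup>2 / 2 + (- 1 / (2 * y\<^sup>2) - 3 / 2 * (y\<^sup>2 + 1) / A\<^sup>2) = - 3 / 2 * (y\<^sup>2 + 1 / 4) / (y\<^sup>2 * A\<^sup>2)"
      if y: "y \<noteq> 0" "A \<noteq> 0" "A = y\<^sup>2 - 1" for y A :: complex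
    proof -
      have "(1 / (2 * y) + 3 * y / (2 * A))\<^sup>2 / 2 + (- 1 / (2 * y\<^sup>2) - 3 / 2 * (y\<^sup>2 + 1) / A\<^sup>2) =
         (A\<^sup>2 + 6 * y\<^sup>2 * A + 9 * y\<^sup>2 * y\<^sup>2 - 4 * A\<^sup>2 - 12 * y\<^sup>2 * (y\<^sup>2 + 1)) / (8 * y\<^sup>2 * A\<^sup>2)"
      proof -
        have "1 / (2 * y) + 3 * y / (2 * A) = (A + 3 * y * y) / (2 * y * A)" using y(1,2) by (simp add: field_simps)
        then have t1: "(1 / (2 * y) + 3 * y / (2 * A))\<^sup>2 / 2 = (A + 3 * y * y)\<^sup>2 / (8 * y\<^sup>2 * A\<^sup>2)"
          by (simp add: power_divide power_mult_distrib)
        have t2: "- 1 / (2 * y\<^sup>2) = - (4 * A\<^sup>2) / (8 * y\<^sup>2 * A\<^sup>2)" using y(1,2) by simp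
        have t3: "3 / 2 * (y\<^sup>2 + 1) / A\<^sup>2 = 12 * y\<^sup>2 * (y\<^sup>2 + 1) / (8 * y\<^sup>2 * A\<^sup>2)" using y(1,2) by (simp add: field_simps)
        show ?thesis unfolding t1 t2 t3 add_divide_distrib[symmetric] diff_divide_distrib[symmetric]
          by (simp add: algebra_simps power2_eq_square)
      qed
      also have "A\<^sup>2 + 6 * y\<^sup>2 * A + 9 * y\<^sup>2 * y\<^sup>2 - 4 * A\<^sup>2 - 12 * y\<^sup>2 * (y\<^sup>2 + 1) = - 12 * y\<^sup>2 - 3"
        unfolding y(3) by (simp add: algebra_simps power2_eq_square)
      also have "(- 12 * y\<^sup>2 - 3) / (8 * y\<^sup>2 * A\<^sup>2) = - 3 / 2 * (y\<^sup>2 + 1 / 4) / (y\<^sup>2 * A\<^sup>2)"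
        using y(1,2) by (simp add: field_simps)
      finally show ?thesis .
    qed
    from this[OF A refl] show ?thesis unfolding q_def q'_def .
  qed
  finally have S_eq: "schwarzian u z = ?d\<^sup>2 * (- 3 / 2 * (?u\<^sup>2 + 1 / 4) / (?u\<^sup>2 * (?u\<^sup>2 - 1)\<^sup>2))" .
  have "(d\<^sup>2 * x)\<^sup>2 = d ^ 4 * x\<^sup>2" for d x :: complex by (simp add: power_mult_distrib flip: power_mult)
  then have "(schwarzian u z)\<^sup>2 = ?d ^ 4 * (- 3 / 2 * (?u\<^sup>2 + 1 / 4) / (?u\<^sup>2 * (?u\<^sup>2 - 1)\<^sup>2))\<^sup>2"
    unfolding S_eq .
  also have "\<dots> = K * (?u\<^sup>2 * (?u\<^sup>2 - 1) ^ 3) * (- 3 / 2 * (?u\<^sup>2 + 1 / 4) / (?u\<^sup>2 * (?u\<^sup>2 - 1)\<^sup>2))\<^sup>2"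
    unfolding quartic[OF z] ..
  finally have fin: "(schwarzian u z)\<^sup>2 = K * (?u\<^sup>2 * (?u\<^sup>2 - 1) ^ 3) * (- 3 / 2 * (?u\<^sup>2 + 1 / 4) / (?u\<^sup>2 * (?u\<^sup>2 - 1)\<^sup>2))\<^sup>2" .
  have "K * (y * A ^ 3) * (- 3 / 2 * B / (y * A\<^sup>2))\<^sup>2 * (y * A) = 9 / 4 * K * B\<^sup>2" if "y \<noteq> 0" "A \<noteq> 0" for y A B :: complex
    using that by (simp add: field_simps eval_nat_numeral)
  from this[of "?u\<^sup>2" "?u\<^sup>2 - 1" "?u\<^sup>2 + 1 / 4"] show ?thesis unfolding fin using A by simp
qed

context schwarzian_solution
begin

lemma ratio_ext_constant: obtains K where "K \<noteq> 0" "\<And>z. ratio_ext z = K"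
proof -
  obtain w1 w2 where w: "w1 \<in> periods u" "w2 \<in> periods u" "w1 \<noteq> 0" "w2 \<noteq> 0" "w2 / w1 \<notin> \<real>"
    using two_independent_periods by blast
  have "ratio_ext constant_on UNIV"
    by (rule doubly_periodic_holomorphic_constant[OF ratio_ext_holomorphic _ _ w(3,5)])
      (simp_all add: periods_def[of ratio_ext] ratio_ext_period[OF w(1)] ratio_ext_period[OF w(2)])
  then obtain K where K: "\<And>z. ratio_ext z = K" by (auto simp: constant_on_def)
  then have "K \<noteq> 0" using ratio_ext_not_zero by auto
  then show ?thesis using K that by blast
qed

text \<open>
  A nonconstant meromorphic function is not confined to a finite set of values.
\<close>
lemma no_polynomial_relation:
  assumes "\<forall>\<^sub>\<approx>z\<in>UNIV. poly R (u z) = 0"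
  shows "R = 0"
proof (rule ccontr)
  assume "R \<noteq> 0"
  then have "finite {x. poly R x = 0}" by (rule poly_roots_finite)
  then have "\<forall>\<^sub>\<approx>z\<in>UNIV. \<forall>x\<in>{x. poly R x = 0}. u z \<noteq> x"
    by (rule eventually_ball_finite) (auto intro: avoids)
  with assms have "\<forall>\<^sub>\<approx>z\<in>(UNIV :: complex set). False" by eventually_elim auto
  then show False by simp
qed

text \<open>
  The quartic equation and the given equation are two expressions for \<open>S(u)\<^sup>2\<close> as a rational function of \<open>u\<close>,
  so their numerators agree as polynomials; the roots of the first one are \<open>i/2\<close> and \<open>-i/2\<close>.
\<close>
lemma sigma_values: "{s1, s2} = {\<i> / 2, - \<i> / 2}"
proof -
  obtain K where K: "K \<noteq> 0" "\<And>z. ratio_ext z = K" using ratio_ext_constant by blast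
  \<comment> \<open>The difference of the two numerators of \<open>S(u)\<^sup>2\<close> over \<open>u\<^sup>2 (u\<^sup>2 - 1)\<close>.\<close>
  define R where "R = smult (9 / 4 * K) ([:1/4, 0, 1:]\<^sup>2) - ode_numerator c s1 s2"
  have "\<forall>\<^sub>\<approx>z\<in>UNIV. poly R (u z) = 0"
    using ode unfolding eventually_cosparse_open_eq[OF open_UNIV]
  proof (intro ballI)
    fix a :: complex
    let ?ode = "\<lambda>z. (schwarzian u z)\<^sup>2 * ((u z)\<^sup>2 * (u z - 1) * (u z + 1)) = c * ((u z - s1)\<^sup>2 * (u z - s2)\<^sup>2)"
    let ?gen = "\<lambda>z. u analytic_on {z} \<and> u z \<notin> {0, 1, -1}"
    assume "\<forall>x\<in>UNIV. \<forall>\<^sub>F z in at x. ?ode z"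
    then have o: "\<forall>\<^sub>F z in at a. ?ode z" by simp
    have "\<forall>\<^sub>F z in at a. ratio_ext z = ratio z" using eventually_cosparse_imp_eventually_at[OF ratio_ext_eq_ratio] by simp
    with generic_near[of a] have "\<forall>\<^sub>F z in at a. ?gen z \<and> ratio z = K" by eventually_elim (simp add: K(2))
    then obtain S0 where S0: "open S0" "a \<in> S0" "\<And>z. z \<in> S0 \<Longrightarrow> z \<noteq> a \<Longrightarrow> ?gen z \<and> ratio z = K"
      unfolding eventually_at_topological by blast
    define S where "S = S0 - {a}"
    have S: "open S" using S0 by (simp add: S_def open_delete)
    have gS: "?gen z" "ratio z = K" if "z \<in> S" for z using S0(3)[of z] that by (auto simp: S_def)
    have hu: "u holomorphic_on S" using gS(1) by (meson analytic_imp_holomorphic analytic_on_analytic_at)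
    have nz: "u z \<noteq> 0 \<and> (u z)\<^sup>2 \<noteq> 1" if "z \<in> S" for z using gS(1)[OF that] by (auto simp: power2_eq_1_iff)
    have qu: "deriv u z ^ 4 = K * ((u z)\<^sup>2 * ((u z)\<^sup>2 - 1) ^ 3)" if "z \<in> S" for z
      using gS(2)[OF that] nz[OF that] by (simp add: ratio_def field_simps)
    have "\<forall>\<^sub>F z in at a. z \<in> S" unfolding S_def using S0 by (intro eventually_at_in_open) auto
    then show "\<forall>\<^sub>F z in at a. poly R (u z) = 0" using o
    proof eventually_elim
      case (elim z)
      have "(u z)\<^sup>2 * (u z - 1) * (u z + 1) = (u z)\<^sup>2 * ((u z)\<^sup>2 - 1)" by (simp add: algebra_simps power2_eq_square)
      then have "9 / 4 * K * ((u z)\<^sup>2 + 1 / 4)\<^sup>2 = c * ((u z - s1)\<^sup>2 * (u z - s2)\<^sup>2)"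
        using elim(2) schwarzian_of_quartic[OF S hu K(1) qu nz elim(1)] by metis
      then show ?case by (simp add: R_def poly_ode_numerator power2_eq_square algebra_simps)
    qed
  qed
  then have "R = 0" by (rule no_polynomial_relation)
  then have "poly R (\<i> / 2) = 0" "poly R (- \<i> / 2) = 0" by simp_all
  then have "c * ((\<i> / 2 - s1)\<^sup>2 * (\<i> / 2 - s2)\<^sup>2) = 0" "c * ((- \<i> / 2 - s1)\<^sup>2 * (- \<i> / 2 - s2)\<^sup>2) = 0"
    by (simp_all add: R_def poly_ode_numerator)
  then have "\<i> / 2 = s1 \<or> \<i> / 2 = s2" "- \<i> / 2 = s1 \<or> - \<i> / 2 = s2" using c by auto
  then show ?thesis by auto
qed

text \<open>
  Otherwise \<open>1/(u - 1)\<close> would be a doubly periodic entire function.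
\<close>
lemma takes_value_one: obtains a where "ramified_point u a" "u a = 1"
proof (rule ccontr)
  assume no: "\<not> thesis"
  have "is_pole u z \<or> u z \<noteq> 1" for z
    using no that[of z] by (auto simp: ramified_point_def)
  then have "recip analytic_on {z}" for z by (intro recip_eq(2))
  then have hv: "recip holomorphic_on UNIV" by (meson analytic_imp_holomorphic analytic_on_analytic_at)
  obtain w1 w2 where w: "w1 \<in> periods u" "w2 \<in> periods u" "w1 \<noteq> 0" "w2 \<noteq> 0" "w2 / w1 \<notin> \<real>"
    using two_independent_periods by blast
  have "recip constant_on UNIV"
    by (rule doubly_periodic_holomorphic_constant[OF hv _ _ w(3,5)]) (simp_all add: periods_def[of recip] recip_period[OF w(1)] recip_period[OF w(2)])
  then obtain k where k: "\<And>z. recip z = k" by (auto simp: constant_on_def)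
  have "\<forall>\<^sub>F z in at 0. u analytic_on {z} \<and> u z \<notin> {0, 1, -1}" by (rule generic_near)
  then have "\<forall>\<^sub>F z in at 0. u z = 1 + inverse k"
  proof eventually_elim
    case (elim z)
    then have "\<not> is_pole u z" using analytic_at_imp_no_pole by blast
    then have "k = inverse (u z - 1)" using recip_eq(1)[of z] elim k by simp
    then show ?case by simp
  qed
  then show False using not_locally_constant by blast
qed

text \<open>
  Both solutions take the value \<open>1\<close>, and for this value the leading coefficient is unique because
  \<open>u - 1\<close> enters the denominator of the equation linearly.
\<close>
lemma translate_of_solution:
  assumes "schwarzian_solution c s1 s2 w"
  obtains z0 where "\<And>z. u z = w (z - z0)"
proof -
  interpret w: schwarzian_solution c s1 s2 w by fact
  obtain a where a: "ramified_point u a" "u a = 1" by (rule takes_value_one)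
  obtain b where b: "ramified_point w b" "w b = 1" by (rule w.takes_value_one)
  obtain P where P: "ramified_expansion u a P"
    "((1 - (of_nat (ramification_index (u a)))\<^sup>2) / 2)\<^sup>2 * P 0 ^ denominator_order (u a) * poly (denominator_cofactor (u a)) (u a) =
       poly (ode_numerator c s1 s2) (u a)" by (rule ramified_expansion_exists[OF a(1)])
  obtain Q where Q: "ramified_expansion w b Q"
    "((1 - (of_nat (ramification_index (w b)))\<^sup>2) / 2)\<^sup>2 * Q 0 ^ denominator_order (w b) * poly (denominator_cofactor (w b)) (w b) =
       poly (ode_numerator c s1 s2) (w b)" by (rule w.ramified_expansion_exists[OF b(1)])
  have "P 0 = Q 0" using trans[OF P(2)[unfolded a(2)] Q(2)[unfolded b(2), symmetric]]
    by (simp add: ramification_index_def denominator_order_def denominator_cofactor_def)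
  then have "u (a + z) = w (b + z)" for z
    using solutions_agree[OF assms a(1) _ P(1) Q(1)] a(2) b(2) by simp
  from this[of "_ - a"] have "u z = w (z - (a - b))" for z by (simp add: algebra_simps)
  then show ?thesis by (rule that)
qed

text \<open>
  The value \<open>1\<close> is taken at the infinitely many translates of one point by a period.
\<close>
lemma not_rational: "\<not> rational_function u"
proof
  assume "rational_function u"
  then obtain p q where q: "q \<noteq> 0" and pq: "\<forall>\<^sub>\<approx>z\<in>UNIV. u z = poly p z / poly q z"
    unfolding rational_function_def by blast
  obtain a where a: "ramified_point u a" "u a = 1" by (rule takes_value_one)
  obtain w where w: "w \<in> periods u" "w \<noteq> 0" using two_independent_periods by metis
  have "poly (p - q) (a + of_nat n * w) = 0" for n
  proof -
    let ?x = "a + of_nat n * w"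
    have per: "of_nat n * w \<in> periods u" by (rule periods_of_nat[OF w(1)])
    then have "(\<lambda>z. u (of_nat n * w + z)) = u" by (auto simp: periods_def add.commute)
    moreover have "is_pole (u \<circ> (\<lambda>z. of_nat n * w + z)) a \<longleftrightarrow> is_pole u (of_nat n * w + a)"
      by (rule is_pole_compose_iff) (rule filtermap_plus_at)
    ultimately have "\<not> is_pole u ?x" using a(1) by (simp add: o_def ramified_point_def add.commute)
    then have "(u \<longlongrightarrow> u ?x) (at ?x)" using analytic by (simp add: analytic_at_imp_isCont isContD)
    moreover have "u ?x = 1" using per a(2) by (simp add: periods_def)
    ultimately have lim: "(u \<longlongrightarrow> 1) (at ?x)" by simp
    have "\<forall>\<^sub>F z in at ?x. poly q z \<noteq> 0"
      using islimpt_finite[OF poly_roots_finite[OF q], of ?x] by (simp add: islimpt_iff_eventually)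
    moreover have "\<forall>\<^sub>F z in at ?x. u z = poly p z / poly q z"
      using eventually_cosparse_imp_eventually_at[OF pq] by simp
    ultimately have "\<forall>\<^sub>F z in at ?x. u z * poly q z = poly p z" by eventually_elim simp
    moreover have "((\<lambda>z. u z * poly q z) \<longlongrightarrow> 1 * poly q ?x) (at ?x)" by (intro tendsto_intros lim)
    ultimately have "(poly p \<longlongrightarrow> 1 * poly q ?x) (at ?x)" by (rule Lim_transform_eventually[rotated])
    moreover have "(poly p \<longlongrightarrow> poly p ?x) (at ?x)" by (intro tendsto_intros)
    ultimately show ?thesis using LIM_unique by fastforce
  qed
  then have "range (\<lambda>n. a + of_nat n * w) \<subseteq> {x. poly (p - q) x = 0}" by auto
  moreover have "inj (\<lambda>n. a + of_nat n * w)" using w(2) by (auto simp: inj_def)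
  then have "infinite (range (\<lambda>n. a + of_nat n * w))" by (rule range_inj_infinite)
  ultimately have "p - q = 0" using poly_roots_finite[of "p - q"] finite_subset by blast
  then have "p = q" by simp
  have "\<forall>\<^sub>F z in at 0. poly q z \<noteq> 0"
    using islimpt_finite[OF poly_roots_finite[OF q], of 0] by (simp add: islimpt_iff_eventually)
  moreover have "\<forall>\<^sub>F z in at 0. u z = poly p z / poly q z"
    using eventually_cosparse_imp_eventually_at[OF pq] by simp
  ultimately have "\<forall>\<^sub>F z in at 0. u z = 1" by eventually_elim (simp add: \<open>p = q\<close>)
  then show False using not_locally_constant by blast
qed

end

text \<open>
  Sparse sets in the plane are closed, so an identity off a sparse set can be differentiated there.
\<close>
lemma cosparse_eventually_nhds:
  assumes "\<forall>\<^sub>\<approx>z\<in>(UNIV :: complex set). R z"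
  shows "\<forall>\<^sub>\<approx>z\<in>UNIV. \<forall>\<^sub>F w in nhds z. R w"
proof -
  have "closed {z. \<not> R z}" using assms by (intro sparse_in_UNIV_imp_closed) (simp add: eventually_cosparse)
  then have "open {z. R z}" by (simp add: closed_def Compl_eq)
  show ?thesis using assms
  proof eventually_elim
    case (elim z)
    then show ?case using eventually_nhds_in_open[OF \<open>open {z. R z}\<close>, of z] by simp
  qed
qed

lemma schwarzian_solution_of_transcendental:
  assumes c: "c \<noteq> 0" and s: "s1 \<notin> {0, 1, -1}" "s2 \<notin> {0, 1, -1}"
    and u: "transcendental_meromorphic u" "schwarzian_ode_solution c s1 s2 0 1 (-1) u"
  shows "schwarzian_solution c s1 s2 (remove_sings u)" "\<forall>\<^sub>\<approx>z\<in>UNIV. u z = remove_sings u z"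
proof -
  have mero: "u meromorphic_on UNIV" using u(1) by (simp add: transcendental_meromorphic_def)
  let ?v = "remove_sings u"
  have eq: "\<forall>\<^sub>\<approx>z\<in>UNIV. ?v z = u z" by (rule eventually_remove_sings_eq[OF mero])
  then show "\<forall>\<^sub>\<approx>z\<in>UNIV. u z = ?v z" by eventually_elim simp
  have nice: "?v nicely_meromorphic_on UNIV" by (rule remove_sings_nicely_meromorphic[OF mero])
  have nc: "\<not> ?v constant_on UNIV"
  proof
    assume "?v constant_on UNIV"
    then obtain k where "\<And>z. ?v z = k" by (auto simp: constant_on_def)
    then have "\<forall>\<^sub>\<approx>z\<in>UNIV. u z = poly [:k:] z / poly 1 z"
      using eq by (auto elim: eventually_mono)
    then have "rational_function u" unfolding rational_function_def by (intro exI[of _ "[:k:]"] exI[of _ 1]) auto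
    then show False using u(1) by (simp add: transcendental_meromorphic_def)
  qed
  have av: "\<forall>\<^sub>\<approx>z\<in>UNIV. ?v z \<noteq> a" for a
    using nicely_meromorphic_imp_constant_or_avoid[OF nice open_UNIV connected_UNIV, of a] nc
    by (auto simp: constant_on_def)
  have ode: "\<forall>\<^sub>\<approx>z\<in>UNIV. (schwarzian u z)\<^sup>2 = c * (((u z - s1)\<^sup>2 * (u z - s2)\<^sup>2) / ((u z - 0)\<^sup>2 * (u z - 1) * (u z - -1)))"
    using u(2) by (simp add: schwarzian_ode_solution_def)
  have "\<forall>\<^sub>\<approx>z\<in>UNIV. (schwarzian ?v z)\<^sup>2 * ((?v z)\<^sup>2 * (?v z - 1) * (?v z + 1)) = c * ((?v z - s1)\<^sup>2 * (?v z - s2)\<^sup>2)"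
    using ode cosparse_eventually_nhds[OF eq] av[of 0] av[of 1] av[of "-1"]
  proof eventually_elim
    case (elim z)
    have 1: "schwarzian ?v z = schwarzian u z" by (rule schwarzian_cong) (rule elim(2))
    have 2: "?v z = u z" using elim(2) by (rule eventually_nhds_x_imp_x)
    have "u z \<noteq> 0" "u z - 1 \<noteq> 0" "u z + 1 \<noteq> 0" using elim(3-5) unfolding 2 by (auto simp: eq_neg_iff_add_eq_0)
    then show ?case unfolding 1 2 elim(1) by simp
  qed
  then show "schwarzian_solution c s1 s2 ?v" using c s nice nc by unfold_locales
qed

lemma transcendental_of_schwarzian_solution:
  assumes w: "schwarzian_solution c s1 s2 w" and eq: "\<forall>\<^sub>\<approx>z\<in>UNIV. u z = w z"
  shows "transcendental_meromorphic u \<and> schwarzian_ode_solution c s1 s2 0 1 (-1) u"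
proof
  interpret w: schwarzian_solution c s1 s2 w by fact
  have "u meromorphic_on UNIV" using w.mero meromorphic_on_cong'[OF eq refl] by simp
  moreover have "\<not> rational_function u"
  proof
    assume "rational_function u"
    then obtain p q where q: "q \<noteq> 0" and pq: "\<forall>\<^sub>\<approx>z\<in>UNIV. u z = poly p z / poly q z"
      unfolding rational_function_def by blast
    from pq eq have "\<forall>\<^sub>\<approx>z\<in>UNIV. w z = poly p z / poly q z" by eventually_elim simp
    then show False using w.not_rational q unfolding rational_function_def by blast
  qed
  ultimately show "transcendental_meromorphic u" by (simp add: transcendental_meromorphic_def)
  show "schwarzian_ode_solution c s1 s2 0 1 (-1) u"
    unfolding schwarzian_ode_solution_def
    using w.ode cosparse_eventually_nhds[OF eq] w.avoids[of 0] w.avoids[of 1] w.avoids[of "-1"]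
  proof eventually_elim
    case (elim z)
    have 1: "schwarzian u z = schwarzian w z" by (rule schwarzian_cong) (rule elim(2))
    have 2: "u z = w z" using elim(2) by (rule eventually_nhds_x_imp_x)
    have "(w z)\<^sup>2 * (w z - 1) * (w z + 1) \<noteq> 0" using elim(3-5) by (auto simp: eq_neg_iff_add_eq_0)
    then show ?case unfolding 1 2 using elim(1) by (simp add: field_simps)
  qed
qed

lemma elliptic_of_schwarzian_solution:
  assumes w: "schwarzian_solution c s1 s2 w" and eq: "\<forall>\<^sub>\<approx>z\<in>UNIV. u z = w z"
  shows "elliptic_function u"
proof -
  interpret w: schwarzian_solution c s1 s2 w by fact
  obtain w1 w2 where p: "w1 \<in> periods w" "w2 \<in> periods w" "w1 \<noteq> 0" "w2 \<noteq> 0" "w2 / w1 \<notin> \<real>"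
    using w.two_independent_periods by blast
  have per: "\<forall>\<^sub>\<approx>z\<in>UNIV. u (z + t) = u z" if "t \<in> periods w" for t
    unfolding eventually_cosparse_open_eq[OF open_UNIV]
  proof
    fix a
    have "\<forall>\<^sub>F z in at (t + a). u z = w z" using eventually_cosparse_imp_eventually_at[OF eq] by simp
    then have "\<forall>\<^sub>F z in at a. u (t + z) = w (t + z)"
      unfolding filtermap_plus_at[symmetric] eventually_filtermap .
    moreover have "\<forall>\<^sub>F z in at a. u z = w z" using eventually_cosparse_imp_eventually_at[OF eq] by simp
    ultimately show "\<forall>\<^sub>F z in at a. u (z + t) = u z"
      by eventually_elim (use that in \<open>simp add: periods_def add.commute\<close>)
  qed
  have "u meromorphic_on UNIV" using w.mero meromorphic_on_cong'[OF eq refl] by simp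
  then show ?thesis unfolding elliptic_function_def using p per by blast
qed

section \<open>The Weierstrass function of a lattice\<close>

definition lattice_point :: "complex \<Rightarrow> complex \<Rightarrow> int \<times> int \<Rightarrow> complex" where
  "lattice_point w1 w2 = (\<lambda>(m, n). of_int m * w1 + of_int n * w2)"

lemma summable_on_int_powr: "(\<lambda>m::int. (1 + \<bar>real_of_int m\<bar>) powr (- 3 / 2)) summable_on UNIV"
proof -
  let ?a = "\<lambda>m::int. (1 + \<bar>real_of_int m\<bar>) powr (- 3 / 2)"
  have "summable (\<lambda>n. of_nat n powr (- 3 / 2) :: real)" by (simp add: summable_real_powr_iff)
  then have s1: "summable (\<lambda>n. of_nat (Suc n) powr (- 3 / 2) :: real)" by (subst summable_Suc_iff)
  then have s2: "summable (\<lambda>n. of_nat (Suc (Suc n)) powr (- 3 / 2) :: real)"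
    by (subst summable_Suc_iff[of "\<lambda>n. of_nat (Suc n) powr (- 3 / 2)"])
  have "(\<lambda>n. of_nat (Suc n) powr (- 3 / 2) :: real) summable_on UNIV"
    by (rule norm_summable_imp_summable_on) (use s1 in simp)
  then have "?a \<circ> int summable_on UNIV" by (simp add: o_def add.commute)
  then have 1: "?a summable_on range int" by (subst summable_on_reindex) auto
  have "(\<lambda>n. of_nat (Suc (Suc n)) powr (- 3 / 2) :: real) summable_on UNIV"
    by (rule norm_summable_imp_summable_on) (use s2 in simp)
  moreover have "?a \<circ> (\<lambda>n. - 1 - int n) = (\<lambda>n. of_nat (Suc (Suc n)) powr (- 3 / 2))"
    by (auto simp: o_def algebra_simps)
  ultimately have "?a \<circ> (\<lambda>n. - 1 - int n) summable_on UNIV" by simp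
  then have 2: "?a summable_on range (\<lambda>n. - 1 - int n)" by (subst summable_on_reindex) (auto simp: inj_def)
  have "range int \<inter> range (\<lambda>n. - 1 - int n) = {}" by auto
  then have "?a summable_on (range int \<union> range (\<lambda>n. - 1 - int n))"
    using 1 2 by (intro summable_on_Un_disjoint)
  moreover have "range int \<union> range (\<lambda>n. - 1 - int n) = UNIV"
  proof -
    have "x \<in> range int \<union> range (\<lambda>n. - 1 - int n)" for x
    proof (cases "x \<ge> 0")
      case True then show ?thesis by (metis UnI1 nat_0_le rangeI)
    next
      case False
      then have "x = - 1 - int (nat (- x - 1))" by simp
      then show ?thesis by blast
    qed
    then show ?thesis by blast
  qed
  ultimately show ?thesis by simp
qed

text \<open>
  A majorant for the lattice sums: \<open>(1 + \<bar>m\<bar> + \<bar>n\<bar>)\<^sup>2 \<ge> (1 + \<bar>m\<bar>) (1 + \<bar>n\<bar>)\<close>, so the inverse cubes are bounded by a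
  product of two convergent series.
\<close>
lemma summable_on_int_prod:
  "(\<lambda>(m, n). (1 + \<bar>real_of_int m\<bar>) powr (- 3 / 2) * (1 + \<bar>real_of_int n\<bar>) powr (- 3 / 2)) summable_on UNIV"
proof -
  let ?a = "\<lambda>m::int. (1 + \<bar>real_of_int m\<bar>) powr (- 3 / 2)"
  have "(\<lambda>(m, n). ?a m * ?a n) summable_on (UNIV \<times> UNIV)"
  proof (rule summable_on_SigmaI)
    show "((\<lambda>y. case (x, y) of (m, n) \<Rightarrow> ?a m * ?a n) has_sum ?a x * infsum ?a UNIV) UNIV" for x
      using has_sum_cmult_right[OF has_sum_infsum[OF summable_on_int_powr], of "?a x"] by simp
    show "(\<lambda>x. ?a x * infsum ?a UNIV) summable_on UNIV"
      by (intro summable_on_cmult_left summable_on_int_powr)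
  qed auto
  then show ?thesis by simp
qed

lemma holomorphic_on_infsum:
  fixes f :: "'a \<Rightarrow> complex \<Rightarrow> complex"
  assumes S: "open S" and f: "\<And>x. x \<in> X \<Longrightarrow> f x holomorphic_on S"
    and M: "\<And>x z. x \<in> X \<Longrightarrow> z \<in> S \<Longrightarrow> norm (f x z) \<le> M x" "M summable_on X"
  shows "(\<lambda>z. \<Sum>\<^sub>\<infinity>x\<in>X. f x z) holomorphic_on S"
proof -
  let ?g = "\<lambda>z. \<Sum>\<^sub>\<infinity>x\<in>X. f x z"
  have ul: "uniform_limit S (\<lambda>Y z. \<Sum>x\<in>Y. f x z) ?g (finite_subsets_at_top X)"
    by (rule Weierstrass_m_test_general[OF M])
  have "?g field_differentiable at z" if zS: "z \<in> S" for z
  proof -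
    obtain r where r: "r > 0" "cball z r \<subseteq> S" using S zS by (meson open_contains_cball)
    have "\<forall>\<^sub>F Y in finite_subsets_at_top X. finite Y \<and> Y \<subseteq> X"
      by (simp add: eventually_finite_subsets_at_top_weakI)
    then have "\<forall>\<^sub>F Y in finite_subsets_at_top X. continuous_on (cball z r) (\<lambda>z. \<Sum>x\<in>Y. f x z) \<and> (\<lambda>z. \<Sum>x\<in>Y. f x z) holomorphic_on ball z r"
    proof eventually_elim
      case (elim Y)
      have "(\<lambda>z. \<Sum>x\<in>Y. f x z) holomorphic_on S" using elim f by (intro holomorphic_intros) auto
      then show ?case
        using r(2) by (meson ball_subset_cball holomorphic_on_imp_continuous_on holomorphic_on_subset order_trans)
    qed
    then have "?g holomorphic_on ball z r"
      by (rule holomorphic_uniform_limit[OF _ uniform_limit_on_subset[OF ul r(2)]]) auto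
    then show ?thesis using r(1) by (metis centre_in_ball holomorphic_on_imp_differentiable_at open_ball)
  qed
  then show ?thesis by (simp add: holomorphic_on_def field_differentiable_at_within)
qed

locale lattice =
  fixes w1 w2 :: complex and L :: "complex set"
  assumes w1: "w1 \<noteq> 0" and w2: "w2 / w1 \<notin> \<real>"
    and L: "L = range (lattice_point w1 w2)"
begin

abbreviation wp :: "complex \<Rightarrow> complex" where "wp \<equiv> lattice_wp L"

lemma lattice_point_bound: obtains d where "d > 0" "\<And>m n. norm (lattice_point w1 w2 (m, n)) \<ge> d * (\<bar>real_of_int m\<bar> + \<bar>real_of_int n\<bar>)"
proof -
  define t where "t = w2 / w1"
  have t: "Im t \<noteq> 0" using w2 by (simp add: t_def complex_is_Real_iff)
  define C where "C = 1 + (1 + \<bar>Re t\<bar>) / \<bar>Im t\<bar>"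
  have C: "C > 0" by (simp add: C_def add_pos_nonneg)
  have "\<bar>real_of_int m\<bar> + \<bar>real_of_int n\<bar> \<le> C * (norm (lattice_point w1 w2 (m, n)) / norm w1)" for m n
  proof -
    define x where "x = of_int m + of_int n * t"
    have "lattice_point w1 w2 (m, n) = x * w1" using w1 by (simp add: lattice_point_def x_def t_def field_simps)
    then have x: "norm (lattice_point w1 w2 (m, n)) / norm w1 = norm x" using w1 by (simp add: norm_mult)
    have "\<bar>real_of_int n\<bar> * \<bar>Im t\<bar> = \<bar>Im x\<bar>" by (simp add: x_def abs_mult)
    also have "\<dots> \<le> norm x" by (rule abs_Im_le_cmod)
    finally have n: "\<bar>real_of_int n\<bar> \<le> norm x / \<bar>Im t\<bar>" using t by (simp add: field_simps)
    have "real_of_int m = Re x - of_int n * Re t" by (simp add: x_def)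
    then have "\<bar>real_of_int m\<bar> \<le> \<bar>Re x\<bar> + \<bar>real_of_int n\<bar> * \<bar>Re t\<bar>" by (simp add: abs_mult[symmetric])
    also have "\<dots> \<le> norm x + norm x / \<bar>Im t\<bar> * \<bar>Re t\<bar>"
      using n abs_Re_le_cmod[of x] by (intro add_mono mult_right_mono) auto
    finally have "\<bar>real_of_int m\<bar> + \<bar>real_of_int n\<bar> \<le> norm x + norm x / \<bar>Im t\<bar> * \<bar>Re t\<bar> + norm x / \<bar>Im t\<bar>"
      using n by linarith
    also have "\<dots> = C * norm x" using t by (simp add: C_def field_simps)
    finally show ?thesis unfolding x .
  qed
  then have "norm (lattice_point w1 w2 (m, n)) \<ge> norm w1 / C * (\<bar>real_of_int m\<bar> + \<bar>real_of_int n\<bar>)" for m n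
    using C w1 by (simp add: field_simps)
  then show ?thesis using that[of "norm w1 / C"] C w1 by simp
qed

lemma inj_lattice_point: "inj (lattice_point w1 w2)"
proof -
  obtain d where d: "d > 0" "\<And>m n. norm (lattice_point w1 w2 (m, n)) \<ge> d * (\<bar>real_of_int m\<bar> + \<bar>real_of_int n\<bar>)"
    using lattice_point_bound by blast
  have "p = q" if "lattice_point w1 w2 p = lattice_point w1 w2 q" for p q
  proof -
    obtain m n m' n' where pq: "p = (m, n)" "q = (m', n')" by (cases p, cases q)
    have "lattice_point w1 w2 (m - m', n - n') = 0"
      using that by (simp add: pq lattice_point_def algebra_simps)
    then have "d * (\<bar>real_of_int (m - m')\<bar> + \<bar>real_of_int (n - n')\<bar>) \<le> 0" using d(2)[of "m - m'" "n - n'"] by simp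
    then have "\<bar>real_of_int (m - m')\<bar> + \<bar>real_of_int (n - n')\<bar> \<le> 0" using d(1) by (simp add: mult_le_0_iff)
    then have "real_of_int (m - m') = 0 \<and> real_of_int (n - n') = 0" by linarith
    then show ?thesis by (simp add: pq)
  qed
  then show ?thesis by (rule injI)
qed

lemma zero_in_L [simp]: "0 \<in> L"
  unfolding L by (rule image_eqI[of _ _ "(0, 0)"]) (auto simp: lattice_point_def)

lemma w1_in_L: "w1 \<in> L" and w2_in_L: "w2 \<in> L"
  unfolding L by (rule image_eqI[of _ _ "(1, 0)"], auto simp: lattice_point_def)
    (rule image_eqI[of _ _ "(0, 1)"], auto simp: lattice_point_def)

lemma L_add: "x \<in> L \<Longrightarrow> y \<in> L \<Longrightarrow> x + y \<in> L"
proof -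
  assume "x \<in> L" "y \<in> L"
  then obtain m n m' n' where "x = lattice_point w1 w2 (m, n)" "y = lattice_point w1 w2 (m', n')" unfolding L by auto
  then have "x + y = lattice_point w1 w2 (m + m', n + n')" by (simp add: lattice_point_def algebra_simps)
  then show ?thesis unfolding L by blast
qed

lemma L_minus: "x \<in> L \<Longrightarrow> - x \<in> L"
proof -
  assume "x \<in> L"
  then obtain m n where "x = lattice_point w1 w2 (m, n)" unfolding L by auto
  then have "- x = lattice_point w1 w2 (- m, - n)" by (simp add: lattice_point_def algebra_simps)
  then show ?thesis unfolding L by blast
qed

lemma summable_cube: "(\<lambda>w. 1 / norm w ^ 3) summable_on (L - {0})"
proof -
  obtain d where d: "d > 0" "\<And>m n. norm (lattice_point w1 w2 (m, n)) \<ge> d * (\<bar>real_of_int m\<bar> + \<bar>real_of_int n\<bar>)"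
    using lattice_point_bound by blast
  let ?a = "\<lambda>m::int. (1 + \<bar>real_of_int m\<bar>) powr (- 3 / 2)"
  have Lz: "L - {0} = lattice_point w1 w2 ` (UNIV - {(0, 0)})"
  proof -
    have "lattice_point w1 w2 (0, 0) = 0" by (simp add: lattice_point_def)
    then show ?thesis unfolding L using inj_lattice_point by (auto simp: inj_eq image_set_diff)
  qed
  have "(\<lambda>p. 1 / norm (lattice_point w1 w2 p) ^ 3) summable_on (UNIV - {(0, 0)})"
  proof (rule summable_on_comparison_test)
    have "(\<lambda>(m, n). ?a m * ?a n) summable_on (UNIV - {(0, 0)})"
      by (rule summable_on_subset_banach[OF summable_on_int_prod]) auto
    then show "(\<lambda>p. 8 / d ^ 3 * (case p of (m, n) \<Rightarrow> ?a m * ?a n)) summable_on (UNIV - {(0, 0)})"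
      by (rule summable_on_cmult_right)
    fix p :: "int \<times> int" assume p: "p \<in> UNIV - {(0, 0)}"
    obtain m n where mn: "p = (m, n)" by (cases p)
    define A where "A = 1 + \<bar>real_of_int m\<bar>"
    define B where "B = 1 + \<bar>real_of_int n\<bar>"
    define s where "s = \<bar>real_of_int m\<bar> + \<bar>real_of_int n\<bar>"
    have AB: "A > 0" "B > 0" by (auto simp: A_def B_def)
    have "m \<noteq> 0 \<or> n \<noteq> 0" using p mn by auto
    then have "\<bar>m\<bar> + \<bar>n\<bar> \<ge> 1" by linarith
    then have "real_of_int (\<bar>m\<bar> + \<bar>n\<bar>) \<ge> 1" by (simp only: of_int_1_le_iff)
    then have s1: "s \<ge> 1" by (simp add: s_def)
    have "A * B \<le> (1 + s)\<^sup>2"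
      unfolding A_def B_def s_def by (simp add: power2_eq_square algebra_simps)
    also have "\<dots> \<le> (2 * s)\<^sup>2" using s1 by (intro power_mono) auto
    finally have AB2: "A * B \<le> (2 * s)\<^sup>2" .
    have "(A * B) powr (3 / 2) \<le> ((2 * s)\<^sup>2) powr (3 / 2)"
      using AB2 AB by (intro powr_mono2) auto
    also have "\<dots> = (2 * s) ^ 3"
    proof -
      have x: "0 \<le> 2 * s" using s1 by simp
      have "((2 * s) powr 2) powr (3 / 2) = (2 * s) powr 3" unfolding powr_powr by simp
      then show ?thesis unfolding powr_numeral[OF x] .
    qed
    finally have le: "(A * B) powr (3 / 2) \<le> 8 * s ^ 3" by (simp add: power_mult_distrib)
    have ds: "d * s > 0" using d(1) s1 by simp
    have "(d * s) ^ 3 \<le> norm (lattice_point w1 w2 p) ^ 3"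
      using d(2)[of m n] ds unfolding mn s_def by (intro power_mono) auto
    then have "1 / norm (lattice_point w1 w2 p) ^ 3 \<le> 1 / (d * s) ^ 3"
      using zero_less_power[OF ds, of 3] by (intro frac_le) auto
    also have "\<dots> = 8 / d ^ 3 * (1 / (8 * s ^ 3))" using d(1) s1 by (simp add: power_mult_distrib)
    also have "\<dots> \<le> 8 / d ^ 3 * (1 / (A * B) powr (3 / 2))"
      using le AB d(1) by (intro mult_left_mono frac_le) auto
    also have "1 / (A * B) powr (3 / 2) = A powr (- 3 / 2) * B powr (- 3 / 2)"
    proof -
      have "(A * B) powr (- 3 / 2) = A powr (- 3 / 2) * B powr (- 3 / 2)" using AB by (subst powr_mult) auto
      moreover have "1 / (A * B) powr (3 / 2) = (A * B) powr (- 3 / 2)" using powr_minus_divide[of "A * B" "3 / 2"] by simp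
      ultimately show ?thesis by (rule trans[rotated])
    qed
    finally show "1 / norm (lattice_point w1 w2 p) ^ 3 \<le> 8 / d ^ 3 * (case p of (m, n) \<Rightarrow> ?a m * ?a n)"
      by (simp add: mn A_def B_def)
  qed auto
  then show ?thesis unfolding Lz
    by (subst summable_on_reindex) (auto simp: o_def intro: inj_on_subset[OF inj_lattice_point])
qed

lemma finite_L_ball: "finite {w \<in> L. norm w < R}"
proof -
  obtain d where d: "d > 0" "\<And>m n. norm (lattice_point w1 w2 (m, n)) \<ge> d * (\<bar>real_of_int m\<bar> + \<bar>real_of_int n\<bar>)"
    using lattice_point_bound by blast
  define N where "N = \<lceil>R / d\<rceil>"
  have "{w \<in> L. norm w < R} \<subseteq> lattice_point w1 w2 ` ({-N..N} \<times> {-N..N})"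
  proof
    fix w assume w: "w \<in> {w \<in> L. norm w < R}"
    then obtain m n where mn: "w = lattice_point w1 w2 (m, n)" unfolding L by auto
    have "d * (\<bar>real_of_int m\<bar> + \<bar>real_of_int n\<bar>) < R" using d(2)[of m n] w mn by simp
    then have "\<bar>real_of_int m\<bar> + \<bar>real_of_int n\<bar> < R / d" using d(1) by (simp add: field_simps)
    then have "real_of_int (\<bar>m\<bar> + \<bar>n\<bar>) \<le> of_int N" unfolding N_def by linarith
    then have "\<bar>m\<bar> + \<bar>n\<bar> \<le> N" by (simp only: of_int_le_iff)
    then have "m \<in> {-N..N}" "n \<in> {-N..N}" unfolding atLeastAtMost_iff by linarith+
    then show "w \<in> lattice_point w1 w2 ` ({-N..N} \<times> {-N..N})" unfolding mn by blast
  qed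
  then show ?thesis by (rule finite_subset) auto
qed

lemma min_norm: obtains R where "R > 0" "\<And>w. w \<in> L - {0} \<Longrightarrow> 2 * R \<le> norm w"
proof -
  define r where "r = Min (insert 1 ((norm ` {w \<in> L. norm w < 1}) - {0}))"
  have fin: "finite (insert 1 ((norm ` {w \<in> L. norm w < 1}) - {0}))" using finite_L_ball[of 1] by simp
  have "r \<in> insert 1 ((norm ` {w \<in> L. norm w < 1}) - {0})" unfolding r_def using fin by (intro Min_in) auto
  then have "r > 0" by auto
  moreover have "r \<le> norm w" if "w \<in> L - {0}" for w
  proof (cases "norm w < 1")
    case True
    then show ?thesis unfolding r_def using that fin by (intro Min_le) auto
  next
    case False
    moreover have "r \<le> 1" unfolding r_def using fin by (intro Min_le) auto
    ultimately show ?thesis by simp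
  qed
  ultimately show ?thesis using that[of "r / 2"] by simp
qed

lemma term_bound:
  fixes z w :: complex
  assumes "norm z < R" "2 * R \<le> norm w" "R > 0"
  shows "norm (1 / (z - w)\<^sup>2 - 1 / w\<^sup>2) \<le> 10 * R * (1 / norm w ^ 3)" "z \<noteq> w"
proof -
  have w: "norm w > 0" using assms by linarith
  have zw: "norm w / 2 \<le> norm (z - w)" using assms norm_triangle_ineq2[of w z] by (simp add: norm_minus_commute)
  show ne: "z \<noteq> w" using assms by auto
  have "1 / (z - w)\<^sup>2 - 1 / w\<^sup>2 = (w\<^sup>2 - (z - w)\<^sup>2) / ((z - w)\<^sup>2 * w\<^sup>2)"
    using ne w by (subst diff_frac_eq) auto
  moreover have "w\<^sup>2 - (z - w)\<^sup>2 = z * (2 * w - z)" by (simp add: algebra_simps power2_eq_square)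
  ultimately have "1 / (z - w)\<^sup>2 - 1 / w\<^sup>2 = z * (2 * w - z) / ((z - w)\<^sup>2 * w\<^sup>2)" by simp
  then have "norm (1 / (z - w)\<^sup>2 - 1 / w\<^sup>2) = norm z * norm (2 * w - z) / (norm (z - w) ^ 2 * norm w ^ 2)"
    by (simp add: norm_mult norm_divide norm_power)
  also have "\<dots> \<le> R * (5 / 2 * norm w) / ((norm w / 2) ^ 2 * norm w ^ 2)"
  proof (intro frac_le mult_mono power_mono zw)
    have "norm (2 * w - z) \<le> norm (2 * w) + norm z" by (rule norm_triangle_ineq4)
    then show "norm (2 * w - z) \<le> 5 / 2 * norm w" using assms by (simp add: norm_mult)
  qed (use assms w in \<open>auto simp: zero_le_mult_iff\<close>)
  also have "\<dots> = 10 * R * (1 / norm w ^ 3)" using w by (simp add: field_simps eval_nat_numeral)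
  finally show "norm (1 / (z - w)\<^sup>2 - 1 / w\<^sup>2) \<le> 10 * R * (1 / norm w ^ 3)" .
qed

lemma summable_far: "(\<lambda>w. K * (1 / norm w ^ 3)) summable_on {w \<in> L. 2 * R \<le> norm w}" if "R > 0"
proof -
  have "(\<lambda>w. 1 / norm w ^ 3) summable_on {w \<in> L. 2 * R \<le> norm w}"
    by (rule summable_on_subset_banach[OF summable_cube]) (use that in auto)
  then show ?thesis by (rule summable_on_cmult_right)
qed

lemma summable_wp: "(\<lambda>w. 1 / (z - w)\<^sup>2 - 1 / w\<^sup>2) summable_on L"
proof -
  define R where "R = norm z + 1"
  have R: "R > 0" "norm z < R" by (auto simp: R_def add_nonneg_pos)
  have "(\<lambda>w. 1 / (z - w)\<^sup>2 - 1 / w\<^sup>2) summable_on {w \<in> L. 2 * R \<le> norm w}"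
    by (rule abs_summable_summable, rule summable_on_comparison_test[OF summable_far[OF R(1), of "10 * R"]])
      (use term_bound(1)[OF R(2) _ R(1)] in auto)
  moreover have "(\<lambda>w. 1 / (z - w)\<^sup>2 - 1 / w\<^sup>2) summable_on {w \<in> L. norm w < 2 * R}"
    using finite_L_ball by (rule summable_on_finite)
  ultimately have "(\<lambda>w. 1 / (z - w)\<^sup>2 - 1 / w\<^sup>2) summable_on ({w \<in> L. 2 * R \<le> norm w} \<union> {w \<in> L. norm w < 2 * R})"
    by (rule summable_on_Un_disjoint) auto
  moreover have "{w \<in> L. 2 * R \<le> norm w} \<union> {w \<in> L. norm w < 2 * R} = L" by auto
  ultimately show ?thesis by simp
qed

text \<open>
  With \<open>1/0 = 0\<close> the term for \<open>0\<close> is \<open>1/z\<^sup>2\<close>, so the whole lattice can serve as the index set.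
\<close>
lemma wp_eq: "wp z = (\<Sum>\<^sub>\<infinity>w\<in>L. 1 / (z - w)\<^sup>2 - 1 / w\<^sup>2)"
proof -
  have s: "(\<lambda>w. 1 / (z - w)\<^sup>2 - 1 / w\<^sup>2) summable_on (L - {0})"
    by (rule summable_on_subset_banach[OF summable_wp]) auto
  have "(\<Sum>\<^sub>\<infinity>w\<in>insert 0 (L - {0}). 1 / (z - w)\<^sup>2 - 1 / w\<^sup>2) = wp z"
    unfolding lattice_wp_def by (subst infsum_insert[OF s]) auto
  then show ?thesis by (simp add: insert_absorb)
qed

lemma wp_even: "wp (- z) = wp z"
proof -
  have "bij_betw uminus L L" using L_minus by (intro bij_betwI[of _ _ _ uminus]) auto
  then have "(\<Sum>\<^sub>\<infinity>w\<in>L. 1 / (- z - - w)\<^sup>2 - 1 / (- w)\<^sup>2) = (\<Sum>\<^sub>\<infinity>w\<in>L. 1 / (- z - w)\<^sup>2 - 1 / w\<^sup>2)"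
    by (rule infsum_reindex_bij_betw)
  moreover have "1 / (- z - - w)\<^sup>2 - 1 / (- w)\<^sup>2 = 1 / (z - w)\<^sup>2 - 1 / w\<^sup>2" for w
    using power2_minus[of "z - w"] by (simp add: power2_commute)
  ultimately show ?thesis unfolding wp_eq by simp
qed

text \<open>
  Shifting the index of summation leaves a difference that does not depend on \<open>z\<close>.
\<close>
lemma wp_translate:
  assumes t: "t \<in> L"
  shows "wp (z + t) = wp z + (\<Sum>\<^sub>\<infinity>w\<in>L. 1 / w\<^sup>2 - 1 / (w + t)\<^sup>2)"
proof -
  have bij: "bij_betw (\<lambda>w. w + t) L L"
    using t L_add L_minus by (intro bij_betwI[of _ _ _ "\<lambda>w. w - t"]) (auto simp: diff_conv_add_uminus simp del: add_uminus_conv_diff)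
  have "(\<Sum>\<^sub>\<infinity>w\<in>L. 1 / (z + t - (w + t))\<^sup>2 - 1 / (w + t)\<^sup>2) = wp (z + t)"
    unfolding wp_eq by (rule infsum_reindex_bij_betw[OF bij])
  then have 1: "wp (z + t) = (\<Sum>\<^sub>\<infinity>w\<in>L. 1 / (z - w)\<^sup>2 - 1 / (w + t)\<^sup>2)" by simp
  have "(\<lambda>w. 1 / (z + t - (w + t))\<^sup>2 - 1 / (w + t)\<^sup>2) summable_on L"
    using summable_on_reindex_bij_betw[OF bij, of "\<lambda>w. 1 / (z + t - w)\<^sup>2 - 1 / w\<^sup>2"] summable_wp[of "z + t"] by simp
  then have s: "(\<lambda>w. 1 / (z - w)\<^sup>2 - 1 / (w + t)\<^sup>2) summable_on L" by simp
  have "(\<lambda>w. - (1 / (z - w)\<^sup>2 - 1 / w\<^sup>2)) summable_on L" using summable_wp by (simp only: summable_on_uminus)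
  from summable_on_add[OF s this] have s': "(\<lambda>w. 1 / w\<^sup>2 - 1 / (w + t)\<^sup>2) summable_on L" by simp
  have "(\<Sum>\<^sub>\<infinity>w\<in>L. (1 / (z - w)\<^sup>2 - 1 / w\<^sup>2) + (1 / w\<^sup>2 - 1 / (w + t)\<^sup>2)) =
      wp z + (\<Sum>\<^sub>\<infinity>w\<in>L. 1 / w\<^sup>2 - 1 / (w + t)\<^sup>2)"
    unfolding wp_eq by (rule infsum_add[OF summable_wp s'])
  then show ?thesis unfolding 1 by simp
qed

text \<open>
  At the point \<open>-t/2\<close> the additive constant of \<open>wp_translate\<close> is seen to vanish, because the function is even.
\<close>
lemma wp_period:
  assumes "t \<in> {w1, w2}"
  shows "t \<in> periods wp"
proof -
  have t: "t \<in> L" using assms w1_in_L w2_in_L by auto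
  have "wp (- (t / 2) + t) = wp (- (t / 2)) + (\<Sum>\<^sub>\<infinity>w\<in>L. 1 / w\<^sup>2 - 1 / (w + t)\<^sup>2)"
    by (rule wp_translate[OF t])
  also have "- (t / 2) + t = t / 2" by simp
  finally have "(\<Sum>\<^sub>\<infinity>w\<in>L. 1 / w\<^sup>2 - 1 / (w + t)\<^sup>2) = 0" by (simp add: wp_even)
  then show ?thesis using wp_translate[OF t] by (simp add: periods_def)
qed

lemma L_periods: "t \<in> L \<Longrightarrow> t \<in> periods wp"
proof -
  assume "t \<in> L"
  then obtain m n where "t = of_int m * w1 + of_int n * w2" unfolding L by (auto simp: lattice_point_def)
  then show ?thesis using wp_period by (auto intro!: periods_add periods_of_int)
qed

text \<open>
  The terms from \<open>far R\<close> converge uniformly on the disc of radius \<open>R\<close>; only finitely many lattice points remain.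
\<close>
definition far :: "real \<Rightarrow> complex set" where "far R = {w \<in> L. 2 * R \<le> norm w}"
definition near :: "real \<Rightarrow> complex set" where "near R = {w \<in> L. norm w < 2 * R}"

lemma wp_split:
  "wp z = (\<Sum>w\<in>near R. 1 / (z - w)\<^sup>2 - 1 / w\<^sup>2) + (\<Sum>\<^sub>\<infinity>w\<in>far R. 1 / (z - w)\<^sup>2 - 1 / w\<^sup>2)"
proof -
  have "(\<Sum>\<^sub>\<infinity>w\<in>near R \<union> far R. 1 / (z - w)\<^sup>2 - 1 / w\<^sup>2) =
      (\<Sum>\<^sub>\<infinity>w\<in>near R. 1 / (z - w)\<^sup>2 - 1 / w\<^sup>2) + (\<Sum>\<^sub>\<infinity>w\<in>far R. 1 / (z - w)\<^sup>2 - 1 / w\<^sup>2)"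
    by (rule infsum_Un_disjoint)
       (auto intro!: summable_on_subset_banach[OF summable_wp] simp: near_def far_def)
  moreover have "near R \<union> far R = L" by (auto simp: near_def far_def)
  moreover have "(\<Sum>\<^sub>\<infinity>w\<in>near R. 1 / (z - w)\<^sup>2 - 1 / w\<^sup>2) = (\<Sum>w\<in>near R. 1 / (z - w)\<^sup>2 - 1 / w\<^sup>2)"
    using finite_L_ball by (intro infsum_finite) (simp add: near_def)
  ultimately show ?thesis unfolding wp_eq by simp
qed

lemma far_holomorphic:
  assumes "R > 0"
  shows "(\<lambda>z. \<Sum>\<^sub>\<infinity>w\<in>far R. 1 / (z - w)\<^sup>2 - 1 / w\<^sup>2) holomorphic_on ball 0 R"
proof (rule holomorphic_on_infsum)
  fix w assume w: "w \<in> far R"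
  have "w \<noteq> 0" "\<And>z. z \<in> ball 0 R \<Longrightarrow> z \<noteq> w" using term_bound(2)[of _ R w] assms w by (auto simp: far_def)
  then show "(\<lambda>z. 1 / (z - w)\<^sup>2 - 1 / w\<^sup>2) holomorphic_on ball 0 R"
    by (intro holomorphic_intros) auto
  show "norm (1 / (z - w)\<^sup>2 - 1 / w\<^sup>2) \<le> 10 * R * (1 / norm w ^ 3)" if "z \<in> ball 0 R" for z
    using term_bound(1)[of z R w] w that assms by (simp add: far_def)
next
  show "(\<lambda>w. 10 * R * (1 / norm w ^ 3)) summable_on far R"
    unfolding far_def by (rule summable_far[OF assms])
qed simp

lemma wp_analytic: assumes "z \<notin> L" shows "wp analytic_on {z}"
proof -
  define R where "R = norm z + 1"
  have R: "R > 0" "norm z < R" by (auto simp: R_def add_nonneg_pos)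
  have fin: "finite (near R)" using finite_L_ball by (simp add: near_def)
  have "(\<lambda>z. (\<Sum>w\<in>near R. 1 / (z - w)\<^sup>2 - 1 / w\<^sup>2) + (\<Sum>\<^sub>\<infinity>w\<in>far R. 1 / (z - w)\<^sup>2 - 1 / w\<^sup>2))
      holomorphic_on (ball 0 R - near R)"
  proof (rule holomorphic_on_add)
    show "(\<lambda>z. \<Sum>\<^sub>\<infinity>w\<in>far R. 1 / (z - w)\<^sup>2 - 1 / w\<^sup>2) holomorphic_on (ball 0 R - near R)"
      by (rule holomorphic_on_subset[OF far_holomorphic[OF R(1)]]) auto
    show "(\<lambda>z. \<Sum>w\<in>near R. 1 / (z - w)\<^sup>2 - 1 / w\<^sup>2) holomorphic_on (ball 0 R - near R)"
    proof (rule holomorphic_on_sum)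
      fix w assume w: "w \<in> near R"
      have "(\<lambda>z. 1 / (z - w)\<^sup>2 - inverse (w\<^sup>2)) holomorphic_on (ball 0 R - near R)"
        using w by (intro holomorphic_intros) auto
      then show "(\<lambda>z. 1 / (z - w)\<^sup>2 - 1 / w\<^sup>2) holomorphic_on (ball 0 R - near R)"
        by (simp add: divide_inverse)
    qed
  qed
  then have "wp holomorphic_on (ball 0 R - near R)"
    unfolding wp_split[of _ R, symmetric] by simp
  moreover have "open (ball 0 R - near R)" using fin by (intro open_Diff finite_imp_closed) auto
  moreover have "z \<in> ball 0 R - near R" using assms R by (auto simp: near_def)
  ultimately show ?thesis using analytic_at by blast
qed

lemma summable_power:
  assumes "k \<ge> 3"
  shows "(\<lambda>w. 1 / w ^ k) summable_on (L - {0})"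
proof -
  obtain R where R: "R > 0" "\<And>w. w \<in> L - {0} \<Longrightarrow> 2 * R \<le> norm w" using min_norm by blast
  obtain j where j: "k = j + 3" using assms by (metis le_add_diff_inverse2)
  show ?thesis
  proof (rule abs_summable_summable, rule summable_on_comparison_test)
    show "(\<lambda>w. 1 / (2 * R) ^ j * (1 / norm w ^ 3)) summable_on (L - {0})"
      by (intro summable_on_cmult_right summable_cube)
    fix w assume w: "w \<in> L - {0}"
    have "norm (1 / w ^ k) = 1 / norm w ^ j * (1 / norm w ^ 3)" by (simp add: j norm_divide norm_mult norm_power power_add)
    also have "\<dots> \<le> 1 / (2 * R) ^ j * (1 / norm w ^ 3)"
      using R(1) R(2)[OF w] by (intro mult_right_mono frac_le power_mono) auto
    finally show "norm (1 / w ^ k) \<le> 1 / (2 * R) ^ j * (1 / norm w ^ 3)" .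
  qed auto
qed

lemma odd_sum_zero:
  assumes "odd k"
  shows "(\<Sum>\<^sub>\<infinity>w\<in>L - {0}. 1 / w ^ k) = 0"
proof -
  have "bij_betw uminus (L - {0}) (L - {0})" using L_minus by (intro bij_betwI[of _ _ _ uminus]) auto
  then have "(\<Sum>\<^sub>\<infinity>w\<in>L - {0}. 1 / (- w) ^ k) = (\<Sum>\<^sub>\<infinity>w\<in>L - {0}. 1 / w ^ k)"
    by (rule infsum_reindex_bij_betw)
  moreover have "(\<Sum>\<^sub>\<infinity>w\<in>L - {0}. 1 / (- w) ^ k) = - (\<Sum>\<^sub>\<infinity>w\<in>L - {0}. 1 / w ^ k)"
    using assms by (simp add: infsum_uminus)
  ultimately show ?thesis by simp
qed

text \<open>
  The Taylor polynomial of degree \<open>4\<close> with explicit remainder, which is \<open>O(1/\<bar>w\<bar>\<^sup>7)\<close> and so can be summed over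
  the lattice.
\<close>
lemma term_expansion:
  fixes z w :: complex
  assumes "w \<noteq> 0" "w \<noteq> z"
  shows "1 / (z - w)\<^sup>2 - 1 / w\<^sup>2 = 2 * z * (1 / w ^ 3) + 3 * z\<^sup>2 * (1 / w ^ 4) + 4 * z ^ 3 * (1 / w ^ 5) + 5 * z ^ 4 * (1 / w ^ 6)
     + z ^ 5 * ((6 * w - 5 * z) / (w ^ 6 * (w - z)\<^sup>2))"
proof -
  have d: "(w - z)\<^sup>2 \<noteq> 0" using assms by simp
  have "w ^ 6 - w ^ 4 * (w - z)\<^sup>2 = (2 * z * w ^ 3 + 3 * z\<^sup>2 * w\<^sup>2 + 4 * z ^ 3 * w + 5 * z ^ 4) * (w - z)\<^sup>2 + z ^ 5 * (6 * w - 5 * z)"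
    by (simp add: algebra_simps eval_nat_numeral)
  then have "(w ^ 6 - w ^ 4 * (w - z)\<^sup>2) / (w ^ 6 * (w - z)\<^sup>2) =
     (2 * z * w ^ 3 + 3 * z\<^sup>2 * w\<^sup>2 + 4 * z ^ 3 * w + 5 * z ^ 4) / w ^ 6 + z ^ 5 * (6 * w - 5 * z) / (w ^ 6 * (w - z)\<^sup>2)"
    using d assms(1) by (simp add: add_divide_distrib)
  moreover have "(w ^ 6 - w ^ 4 * (w - z)\<^sup>2) / (w ^ 6 * (w - z)\<^sup>2) = 1 / (z - w)\<^sup>2 - 1 / w\<^sup>2"
  proof -
    have "w ^ 6 / (w ^ 6 * (w - z)\<^sup>2) = 1 / (z - w)\<^sup>2" using assms(1) by (simp add: power2_commute)
    moreover have "w ^ 4 * (w - z)\<^sup>2 / (w ^ 6 * (w - z)\<^sup>2) = 1 / w\<^sup>2" using assms(1) d by (simp add: eval_nat_numeral)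
    ultimately show ?thesis by (simp add: diff_divide_distrib)
  qed
  moreover have "(2 * z * w ^ 3 + 3 * z\<^sup>2 * w\<^sup>2 + 4 * z ^ 3 * w + 5 * z ^ 4) / w ^ 6 =
     2 * z * (1 / w ^ 3) + 3 * z\<^sup>2 * (1 / w ^ 4) + 4 * z ^ 3 * (1 / w ^ 5) + 5 * z ^ 4 * (1 / w ^ 6)"
  proof -
    have "2 * z * w ^ 3 / w ^ 6 = 2 * z * (1 / w ^ 3)" "3 * z\<^sup>2 * w\<^sup>2 / w ^ 6 = 3 * z\<^sup>2 * (1 / w ^ 4)"
      "4 * z ^ 3 * w / w ^ 6 = 4 * z ^ 3 * (1 / w ^ 5)" using assms(1) by (simp_all add: eval_nat_numeral)
    then show ?thesis by (simp add: add_divide_distrib)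
  qed
  ultimately show ?thesis by simp
qed

text \<open>
  Summing \<open>term_expansion\<close>; the sums of odd powers cancel in pairs \<open>w\<close>, \<open>-w\<close>.
\<close>
lemma laurent_at_0:
  obtains R k where "R > 0" "k holomorphic_on ball 0 R"
    "\<And>z. z \<in> ball 0 R - {0} \<Longrightarrow>
       wp z = 1 / z\<^sup>2 + lattice_g2 L / 20 * z\<^sup>2 + lattice_g3 L / 28 * z ^ 4 + z ^ 5 * k z"
proof -
  obtain R where R: "R > 0" "\<And>w. w \<in> L - {0} \<Longrightarrow> 2 * R \<le> norm w" using min_norm by blast
  define r where "r w z = (6 * w - 5 * z) / (w ^ 6 * (w - z)\<^sup>2)" for w z :: complex
  define k where "k z = (\<Sum>\<^sub>\<infinity>w\<in>L - {0}. r w z)" for z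
  define M where "M w = 34 / (2 * R) ^ 4 * (1 / norm w ^ 3)" for w :: complex
  have sM: "M summable_on (L - {0})" unfolding M_def[abs_def] by (intro summable_on_cmult_right summable_cube)
  have rb: "norm (r w z) \<le> M w" "w \<noteq> z" if w: "w \<in> L - {0}" and z: "z \<in> ball 0 R" for w z
  proof -
    have wR: "2 * R \<le> norm w" using R(2)[OF w] .
    have zR: "norm z < R" using z by simp
    have wp: "norm w > 0" using w by simp
    show "w \<noteq> z" using wR zR R(1) by auto
    have zw: "norm w / 2 \<le> norm (w - z)" using wR zR norm_triangle_ineq2[of w z] by linarith
    have "norm (6 * w - 5 * z) \<le> norm (6 * w) + norm (5 * z)" by (rule norm_triangle_ineq4)
    then have num: "norm (6 * w - 5 * z) \<le> 17 / 2 * norm w" using wR zR by (simp add: norm_mult)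
    have "norm (r w z) = norm (6 * w - 5 * z) / (norm w ^ 6 * norm (w - z) ^ 2)"
      by (simp add: r_def norm_divide norm_mult norm_power)
    also have "\<dots> \<le> 17 / 2 * norm w / (norm w ^ 6 * (norm w / 2) ^ 2)"
      using wp by (intro frac_le mult_left_mono power_mono zw num) auto
    also have "\<dots> = 34 / norm w ^ 4 * (1 / norm w ^ 3)" using wp by (simp add: field_simps eval_nat_numeral)
    also have "\<dots> \<le> M w"
      unfolding M_def using R(1) wR by (intro mult_right_mono frac_le power_mono) auto
    finally show "norm (r w z) \<le> M w" .
  qed
  have hk: "k holomorphic_on ball 0 R"
    unfolding k_def[abs_def]
  proof (rule holomorphic_on_infsum[OF _ _ rb(1) sM])
    fix w assume w: "w \<in> L - {0}"
    have "\<And>z. z \<in> ball 0 R \<Longrightarrow> w \<noteq> z" using rb(2)[OF w] by blast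
    then show "r w holomorphic_on ball 0 R"
      unfolding r_def[abs_def] using w by (intro holomorphic_intros) auto
  qed auto
  have exp: "wp z = 1 / z\<^sup>2 + lattice_g2 L / 20 * z\<^sup>2 + lattice_g3 L / 28 * z ^ 4 + z ^ 5 * k z"
    if z: "z \<in> ball 0 R - {0}" for z
  proof -
    define s where "s j = (\<Sum>\<^sub>\<infinity>w\<in>L - {0}. 1 / w ^ j)" for j :: nat
    have s: "((\<lambda>w. 1 / w ^ j) has_sum s j) (L - {0})" if "j \<ge> 3" for j
      unfolding s_def using summable_power[OF that] by (rule has_sum_infsum)
    have "(\<lambda>w. r w z) summable_on (L - {0})"
      by (rule abs_summable_summable, rule summable_on_comparison_test[OF sM]) (use rb(1)[of _ z] z in auto)
    then have k: "((\<lambda>w. r w z) has_sum k z) (L - {0})" unfolding k_def by (rule has_sum_infsum)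
    have "((\<lambda>w. 2 * z * (1 / w ^ 3) + 3 * z\<^sup>2 * (1 / w ^ 4) + 4 * z ^ 3 * (1 / w ^ 5) + 5 * z ^ 4 * (1 / w ^ 6) + z ^ 5 * r w z)
      has_sum (2 * z * s 3 + 3 * z\<^sup>2 * s 4 + 4 * z ^ 3 * s 5 + 5 * z ^ 4 * s 6 + z ^ 5 * k z)) (L - {0})"
      by (intro has_sum_add has_sum_cmult_right s k) auto
    then have "((\<lambda>w. 1 / (z - w)\<^sup>2 - 1 / w\<^sup>2)
      has_sum (2 * z * s 3 + 3 * z\<^sup>2 * s 4 + 4 * z ^ 3 * s 5 + 5 * z ^ 4 * s 6 + z ^ 5 * k z)) (L - {0})"
    proof (rule has_sum_cong[THEN iffD1, rotated])
      fix w assume w: "w \<in> L - {0}"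
      have "w \<noteq> 0" "w \<noteq> z" using rb(2)[OF w] w z by auto
      from term_expansion[OF this]
      show "2 * z * (1 / w ^ 3) + 3 * z\<^sup>2 * (1 / w ^ 4) + 4 * z ^ 3 * (1 / w ^ 5) + 5 * z ^ 4 * (1 / w ^ 6) + z ^ 5 * r w z = 1 / (z - w)\<^sup>2 - 1 / w\<^sup>2"
        unfolding r_def by simp
    qed
    then have "wp z = 1 / z\<^sup>2 + (2 * z * s 3 + 3 * z\<^sup>2 * s 4 + 4 * z ^ 3 * s 5 + 5 * z ^ 4 * s 6 + z ^ 5 * k z)"
      unfolding lattice_wp_def by (simp add: infsumI)
    moreover have "s 3 = 0" "s 5 = 0" unfolding s_def by (rule odd_sum_zero, simp)+
    moreover have "lattice_g2 L = 60 * s 4" "lattice_g3 L = 140 * s 6" by (simp_all add: lattice_g2_def lattice_g3_def s_def)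
    ultimately show ?thesis by simp
  qed
  show ?thesis by (rule that[OF R(1) hk exp])
qed

lemma wp_pole_0: "is_pole (wp) 0"
proof -
  obtain R k where R: "R > 0" "k holomorphic_on ball 0 R"
    "\<And>z. z \<in> ball 0 R - {0} \<Longrightarrow>
       wp z = 1 / z\<^sup>2 + lattice_g2 L / 20 * z\<^sup>2 + lattice_g3 L / 28 * z ^ 4 + z ^ 5 * k z"
    using laurent_at_0 by blast
  define h where "h z = 1 + lattice_g2 L / 20 * z ^ 4 + lattice_g3 L / 28 * z ^ 6 + z ^ 7 * k z" for z
  have "h holomorphic_on ball 0 R" unfolding h_def[abs_def] by (intro holomorphic_intros R(2))
  then have lim: "(h \<longlongrightarrow> h 0) (at 0)" using R(1) by (intro holomorphic_tendsto_at) auto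
  moreover have "h 0 \<noteq> 0" by (simp add: h_def)
  ultimately have "is_pole (\<lambda>z. h z / z\<^sup>2) 0"
    unfolding is_pole_def by (intro filterlim_divide_at_infinity[OF lim _]) (auto intro!: tendsto_eq_intros filterlim_atI eventually_at_filter[THEN iffD2])
  moreover have "\<forall>\<^sub>F z in at 0. h z / z\<^sup>2 = wp z"
  proof -
    have "\<forall>\<^sub>F z in at (0::complex). z \<in> ball 0 R - {0}" using R(1) by (intro eventually_at_in_open) auto
    then show ?thesis
    proof eventually_elim
      case (elim z)
      then show ?case unfolding R(3)[OF elim] h_def by (simp add: field_simps eval_nat_numeral)
    qed
  qed
  ultimately show ?thesis using is_pole_cong[of "\<lambda>z. h z / z\<^sup>2" "wp" 0 0] by simp
qed

lemma wp_meromorphic: "wp meromorphic_on UNIV"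
proof -
  have 0: "wp meromorphic_on {0}"
  proof -
    obtain R k where R: "R > 0" "k holomorphic_on ball 0 R"
      "\<And>z. z \<in> ball 0 R - {0} \<Longrightarrow>
         wp z = 1 / z\<^sup>2 + lattice_g2 L / 20 * z\<^sup>2 + lattice_g3 L / 28 * z ^ 4 + z ^ 5 * k z"
      using laurent_at_0 by blast
    have "k analytic_on {0}" using R(1,2) by (auto simp: analytic_on_def)
    then have k: "k meromorphic_on {0}" by (rule analytic_on_imp_meromorphic_on)
    have "(\<lambda>z. 1 / z\<^sup>2 + lattice_g2 L / 20 * z\<^sup>2 + lattice_g3 L / 28 * z ^ 4 + z ^ 5 * k z) meromorphic_on {0}"
      by (intro meromorphic_intros k)
    moreover have "\<forall>\<^sub>F z in at (0::complex). z \<in> ball 0 R - {0}" using R(1) by (intro eventually_at_in_open) auto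
    then have "\<forall>\<^sub>F z in at 0. wp z = 1 / z\<^sup>2 + lattice_g2 L / 20 * z\<^sup>2 + lattice_g3 L / 28 * z ^ 4 + z ^ 5 * k z"
      by eventually_elim (rule R(3))
    ultimately show ?thesis by (subst meromorphic_on_cong) auto
  qed
  have "wp meromorphic_on {t}" for t
  proof (cases "t \<in> L")
    case True
    then have "- t \<in> periods wp" by (intro periods_minus L_periods)
    then have "wp = (\<lambda>z. wp (z - t))" by (auto simp: periods_def)
    moreover have "(\<lambda>z. wp (z - t)) meromorphic_on {t}"
      by (rule meromorphic_on_compose[OF 0]) (auto intro!: analytic_intros)
    ultimately show ?thesis by simp
  next
    case False
    then show ?thesis using wp_analytic analytic_on_imp_meromorphic_on by blast
  qed
  then show ?thesis by (subst meromorphic_on_meromorphic_at) auto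
qed

lemma wp_avoids: "\<forall>\<^sub>\<approx>z\<in>UNIV. wp z \<noteq> a"
proof -
  have "\<not> (\<forall>\<^sub>\<approx>z\<in>UNIV. wp z = a)"
  proof
    assume "\<forall>\<^sub>\<approx>z\<in>UNIV. wp z = a"
    then have "\<forall>\<^sub>F z in at 0. wp z = a" using eventually_cosparse_imp_eventually_at by blast
    then have "is_pole (\<lambda>_. a) (0::complex)"
      using wp_pole_0 is_pole_cong[of "wp" "\<lambda>_. a" 0 0] by simp
    then show False by simp
  qed
  then show ?thesis using meromorphic_imp_constant_or_avoid[OF wp_meromorphic open_UNIV connected_UNIV, of a] by blast
qed

lemma cosparse_not_L: "\<forall>\<^sub>\<approx>z\<in>UNIV. z \<notin> L"
  unfolding eventually_cosparse_open_eq[OF open_UNIV]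
proof
  fix a
  have "\<not> a islimpt L"
  proof
    assume "a islimpt L"
    then have "infinite (L \<inter> ball a 1)" using islimpt_eq_infinite_ball[of a L] by auto
    moreover have "L \<inter> ball a 1 \<subseteq> {w \<in> L. norm w < norm a + 1}"
    proof
      fix w assume w: "w \<in> L \<inter> ball a 1"
      have "norm w \<le> norm a + norm (w - a)" by (rule norm_triangle_sub)
      then show "w \<in> {w \<in> L. norm w < norm a + 1}" using w by (auto simp: dist_norm norm_minus_commute)
    qed
    ultimately show False using finite_L_ball finite_subset by blast
  qed
  then show "\<forall>\<^sub>F z in at a. z \<notin> L" by (simp add: islimpt_iff_eventually)
qed

text \<open>
  The polar terms of \<open>f'\<^sup>2 - 4 f\<^sup>3 + 20 a f + 28 b\<close> cancel: with \<open>z\<^sup>2 f = 1 + z\<^sup>4 x\<close> and \<open>z\<^sup>3 f' = -2 + z\<^sup>4 y\<close>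
  this is an identity of polynomials.
\<close>
lemma laurent_ode:
  assumes S: "open S" and k: "k holomorphic_on S" and z: "z \<in> S" "z \<noteq> 0"
    and wp: "\<And>z. z \<in> S - {0} \<Longrightarrow> f z = 1 / z\<^sup>2 + a * z\<^sup>2 + b * z ^ 4 + z ^ 5 * k z"
    and x: "x = a + b * z\<^sup>2 + z ^ 3 * k z" and y: "y = 2 * a + 4 * b * z\<^sup>2 + 5 * z ^ 3 * k z + z ^ 4 * deriv k z"
  shows "(deriv f z)\<^sup>2 - 4 * f z ^ 3 + 20 * a * f z + 28 * b =
     - 32 * z * k z - 4 * z\<^sup>2 * deriv k z + z\<^sup>2 * y\<^sup>2 - 12 * z\<^sup>2 * x\<^sup>2 - 4 * z ^ 6 * x ^ 3 + 20 * a * z\<^sup>2 * x"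
proof -
  have "((\<lambda>z. 1 / z\<^sup>2 + a * z\<^sup>2 + b * z ^ 4 + z ^ 5 * k z) has_field_derivative
     - 2 / z ^ 3 + 2 * a * z + 4 * b * z ^ 3 + (5 * z ^ 4 * k z + z ^ 5 * deriv k z)) (at z)"
    using holomorphic_derivI[OF k S z(1)] z(2)
    by (auto intro!: derivative_eq_intros simp: field_simps eval_nat_numeral)
  then have "(f has_field_derivative
     - 2 / z ^ 3 + 2 * a * z + 4 * b * z ^ 3 + (5 * z ^ 4 * k z + z ^ 5 * deriv k z)) (at z)"
    by (rule has_field_derivative_transform_within_open[of _ _ _ "S - {0}"])
      (use S z wp in \<open>auto simp: open_delete\<close>)
  then have d: "deriv f z = - 2 / z ^ 3 + 2 * a * z + 4 * b * z ^ 3 + (5 * z ^ 4 * k z + z ^ 5 * deriv k z)"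
    by (rule DERIV_imp_deriv)
  have P: "z\<^sup>2 * f z = 1 + z ^ 4 * x"
    using wp[of z] z by (simp add: x field_simps eval_nat_numeral)
  have D: "z ^ 3 * deriv f z = - 2 + z ^ 4 * y"
    unfolding d using z by (simp add: y field_simps eval_nat_numeral)
  have lin: "- 4 * y - 12 * x + 20 * a + 28 * b * z\<^sup>2 = - 32 * z ^ 3 * k z - 4 * z ^ 4 * deriv k z"
    by (simp add: x y algebra_simps)
  have "z ^ 6 * ((deriv f z)\<^sup>2 - 4 * f z ^ 3 + 20 * a * f z + 28 * b) =
     (z ^ 3 * deriv f z)\<^sup>2 - 4 * (z\<^sup>2 * f z) ^ 3 + 20 * a * z ^ 4 * (z\<^sup>2 * f z) + 28 * b * z ^ 6"
    by (simp add: algebra_simps eval_nat_numeral)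
  also have "\<dots> = z ^ 4 * (- 4 * y - 12 * x + 20 * a + 28 * b * z\<^sup>2) + z ^ 8 * y\<^sup>2 - 12 * z ^ 8 * x\<^sup>2 - 4 * z ^ 12 * x ^ 3 + 20 * a * z ^ 8 * x"
    unfolding P D by (simp add: algebra_simps eval_nat_numeral)
  also have "\<dots> = z ^ 6 * (- 32 * z * k z - 4 * z\<^sup>2 * deriv k z + z\<^sup>2 * y\<^sup>2 - 12 * z\<^sup>2 * x\<^sup>2 - 4 * z ^ 6 * x ^ 3 + 20 * a * z\<^sup>2 * x)"
    unfolding lin by (simp add: algebra_simps eval_nat_numeral)
  finally show ?thesis using z(2) by simp
qed

text \<open>
  The difference of the two sides extends to a doubly periodic entire function, and it vanishes at \<open>0\<close>.
\<close>
theorem wp_ode: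
  assumes "z \<notin> L"
  shows "(deriv wp z)\<^sup>2 = 4 * wp z ^ 3 - lattice_g2 L * wp z - lattice_g3 L"
proof -
  let ?p = "wp"
  define f where "f z = (deriv ?p z)\<^sup>2 - 4 * ?p z ^ 3 + lattice_g2 L * ?p z + lattice_g3 L" for z
  have mero: "f meromorphic_on UNIV" unfolding f_def[abs_def] by (intro meromorphic_intros wp_meromorphic)
  have per: "f (z + t) = f z" if "t \<in> L" for t z
  proof -
    have "?p (z + t) = ?p z" for z using L_periods[OF that] by (simp add: periods_def)
    then show ?thesis by (simp add: f_def deriv_translate_period)
  qed
  have lim0: "(f \<longlongrightarrow> 0) (at 0)"
  proof -
    obtain R k where R: "R > 0" "k holomorphic_on ball 0 R"
      "\<And>z. z \<in> ball 0 R - {0} \<Longrightarrow>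
         ?p z = 1 / z\<^sup>2 + lattice_g2 L / 20 * z\<^sup>2 + lattice_g3 L / 28 * z ^ 4 + z ^ 5 * k z"
      using laurent_at_0 by blast
    define x where "x z = lattice_g2 L / 20 + lattice_g3 L / 28 * z\<^sup>2 + z ^ 3 * k z" for z
    define y where "y z = 2 * (lattice_g2 L / 20) + 4 * (lattice_g3 L / 28) * z\<^sup>2 + 5 * z ^ 3 * k z + z ^ 4 * deriv k z" for z
    define g where "g z = - 32 * z * k z - 4 * z\<^sup>2 * deriv k z + z\<^sup>2 * (y z)\<^sup>2 - 12 * z\<^sup>2 * (x z)\<^sup>2 - 4 * z ^ 6 * x z ^ 3
       + 20 * (lattice_g2 L / 20) * z\<^sup>2 * x z" for z
    have "g holomorphic_on ball 0 R"
      unfolding g_def[abs_def] x_def y_def by (intro holomorphic_intros R(2)) auto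
    then have "(g \<longlongrightarrow> g 0) (at 0)" using R(1) by (intro holomorphic_tendsto_at) auto
    then have "(g \<longlongrightarrow> 0) (at 0)" by (simp add: g_def)
    moreover have "\<forall>\<^sub>F z in at (0::complex). z \<in> ball 0 R - {0}" using R(1) by (intro eventually_at_in_open) auto
    then have "\<forall>\<^sub>F z in at 0. g z = f z"
    proof eventually_elim
      case (elim z)
      have "z \<in> ball 0 R" "z \<noteq> 0" using elim by auto
      from laurent_ode[OF open_ball R(2) this R(3) x_def y_def] show ?case by (simp add: g_def f_def)
    qed
    ultimately show ?thesis by (rule Lim_transform_eventually)
  qed
  define h where "h = remove_sings f"
  have "h analytic_on {t}" for t
  proof (cases "t \<in> L")
    case True
    have "f (z + t) = f z" for z by (rule per[OF True])
    then have "(f \<longlongrightarrow> 0) (at t)"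
      using lim0 by (subst at_to_0[of t]) (simp add: filterlim_filtermap)
    moreover have "isolated_singularity_at f t" using mero by (metis UNIV_I meromorphic_on_altdef)
    ultimately show ?thesis unfolding h_def by (intro remove_sings_analytic_at)
  next
    case False
    have "f analytic_on {t}" unfolding f_def[abs_def]
      by (intro analytic_intros wp_analytic[OF False] analytic_deriv)
    then show ?thesis unfolding h_def by (rule remove_sings_analytic_on)
  qed
  then have "h holomorphic_on UNIV" by (meson analytic_imp_holomorphic analytic_on_analytic_at)
  moreover have "t \<in> periods h" if "t \<in> L" for t
    unfolding periods_def h_def using remove_sings_translate_period[of f t] per[OF that] by simp
  ultimately have "h constant_on UNIV"
    using doubly_periodic_holomorphic_constant[of h w1 w2] w1 w2 w1_in_L w2_in_L by blast
  moreover have "h 0 = 0" unfolding h_def by (rule remove_sings_eqI[OF lim0])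
  ultimately have "h z = 0" unfolding constant_on_def by (metis UNIV_I)
  moreover have "f analytic_on {z}" unfolding f_def[abs_def]
    by (intro analytic_intros wp_analytic[OF assms] analytic_deriv)
  then have "h z = f z" by (simp add: h_def)
  ultimately show ?thesis by (simp add: f_def algebra_simps)
qed

lemma wp_second_derivative:
  assumes "z \<notin> L" "deriv wp z \<noteq> 0"
  shows "deriv (deriv wp) z = 6 * (wp z)\<^sup>2 - lattice_g2 L / 2"
proof -
  let ?p = "wp"
  have p: "(?p has_field_derivative deriv ?p z) (at z)" "(deriv ?p has_field_derivative deriv (deriv ?p) z) (at z)"
    using wp_analytic[OF assms(1)] analytic_deriv[OF wp_analytic[OF assms(1)]]
    by (simp_all add: DERIV_deriv_iff_field_differentiable analytic_on_imp_differentiable_at)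
  have 1: "((\<lambda>z. (deriv ?p z)\<^sup>2) has_field_derivative 2 * deriv ?p z * deriv (deriv ?p) z) (at z)"
    using p by (auto intro!: derivative_eq_intros)
  have 2: "((\<lambda>z. 4 * ?p z ^ 3 - lattice_g2 L * ?p z - lattice_g3 L) has_field_derivative
     (12 * (?p z)\<^sup>2 * deriv ?p z - lattice_g2 L * deriv ?p z)) (at z)"
    using p by (auto intro!: derivative_eq_intros)
  have "closed L" using cosparse_not_L by (simp add: eventually_cosparse sparse_in_UNIV_imp_closed)
  then have "\<forall>\<^sub>F z in nhds z. z \<in> - L" using assms(1) by (intro eventually_nhds_in_open) auto
  then have ev: "\<forall>\<^sub>F z in nhds z. 4 * ?p z ^ 3 - lattice_g2 L * ?p z - lattice_g3 L = (deriv ?p z)\<^sup>2"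
    by eventually_elim (simp add: wp_ode)
  note DERIV_cong_ev[OF refl ev refl, THEN iffD1, OF 2]
  from DERIV_unique[OF 1 this] have "deriv ?p z * (2 * deriv (deriv ?p) z) = deriv ?p z * (12 * (?p z)\<^sup>2 - lattice_g2 L)"
    by (simp add: algebra_simps)
  then have "2 * deriv (deriv ?p) z = 12 * (?p z)\<^sup>2 - lattice_g2 L" using assms(2) by simp
  then show ?thesis by (simp add: field_simps)
qed

end

section \<open>The solution built from the Weierstrass function\<close>

context lattice
begin

lemma wp_analytic_derivs:
  assumes "z \<notin> L"
  shows "(wp has_field_derivative deriv wp z) (at z)"
    "(deriv wp has_field_derivative deriv (deriv wp) z) (at z)"
  using wp_analytic[OF assms] analytic_deriv[OF wp_analytic[OF assms]]
  by (simp_all add: DERIV_deriv_iff_field_differentiable analytic_on_imp_differentiable_at)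

text \<open>
  If both invariants vanished, then \<open>\<wp>'\<^sup>2 = 4 \<wp>\<^sup>3\<close> and \<open>\<wp>'' = 6 \<wp>\<^sup>2\<close>, so \<open>\<wp>/\<wp>'\<close> would have the constant derivative
  \<open>-1/2\<close>, contrary to its periodicity.
\<close>
lemma invariants_not_both_zero: "\<not> (lattice_g2 L = 0 \<and> lattice_g3 L = 0)"
proof
  assume g: "lattice_g2 L = 0 \<and> lattice_g3 L = 0"
  let ?p = "wp"
  have ode: "(deriv ?p z)\<^sup>2 = 4 * ?p z ^ 3" if "z \<notin> L" for z using wp_ode[OF that] g by simp
  define X where "X = {z. \<not> (z \<notin> L \<and> ?p z \<noteq> 0)}"
  have gen: "\<forall>\<^sub>\<approx>z\<in>UNIV. z \<notin> L \<and> ?p z \<noteq> 0" using cosparse_not_L wp_avoids[of 0] by eventually_elim simp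
  then have X: "X sparse_in UNIV" by (simp add: X_def eventually_cosparse)
  have con: "connected (- X)" using sparse_imp_connected[OF _ connected_UNIV open_UNIV X] by (simp add: Compl_eq_Diff_UNIV)
  have op: "open (- X)" using sparse_in_UNIV_imp_closed[OF X] by (simp add: open_Compl)
  \<comment> \<open>Its derivative is \<open>1 - \<wp> \<wp>''/\<wp>'\<^sup>2 + 1/2 = 0\<close>.\<close>
  define y where "y z = ?p z / deriv ?p z + z / 2" for z
  have dy: "(y has_field_derivative 0) (at z)" if z: "z \<in> - X" for z
  proof -
    have zL: "z \<notin> L" "?p z \<noteq> 0" using z by (auto simp: X_def)
    have d0: "deriv ?p z \<noteq> 0" using ode[OF zL(1)] zL(2) by auto
    have d2: "deriv (deriv ?p) z = 6 * (?p z)\<^sup>2" using wp_second_derivative[OF zL(1) d0] g by simp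
    have "(y has_field_derivative ((deriv ?p z * deriv ?p z - ?p z * deriv (deriv ?p) z) / (deriv ?p z * deriv ?p z) + 1 / 2)) (at z)"
      unfolding y_def[abs_def] using wp_analytic_derivs[OF zL(1)] d0 by (auto intro!: derivative_eq_intros)
    also have "(deriv ?p z * deriv ?p z - ?p z * deriv (deriv ?p) z) / (deriv ?p z * deriv ?p z) + 1 / 2 = 0"
    proof -
      have e: "deriv ?p z * deriv ?p z = 4 * ?p z ^ 3" using ode[OF zL(1)] by (simp add: power2_eq_square)
      show ?thesis unfolding e d2 using zL(2) by (simp add: field_simps eval_nat_numeral)
    qed
    finally show ?thesis .
  qed
  have "\<forall>\<^sub>F z in at (- w1 + 0). z \<in> - X" "\<forall>\<^sub>F z in at 0. z \<in> - X"
    using gen eventually_cosparse_imp_eventually_at[of "\<lambda>z. z \<in> - X" UNIV] by (auto simp: X_def)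
  then have "\<forall>\<^sub>F z in at 0. - w1 + z \<in> - X" "\<forall>\<^sub>F z in at 0. z \<in> - X"
    unfolding filtermap_plus_at[symmetric] eventually_filtermap by auto
  then have "\<forall>\<^sub>F z in at (0::complex). - w1 + z \<in> - X \<and> z \<in> - X" by eventually_elim simp
  from eventually_happens'[OF at_neq_bot this] obtain z where z: "- w1 + z \<in> - X" "z \<in> - X" by blast
  have "y constant_on - X" by (rule has_field_derivative_0_imp_constant_on[OF dy con op])
  then have "y z = y (- w1 + z)" using z unfolding constant_on_def by metis
  moreover have "?p (- w1 + z) = ?p z" "deriv ?p (- w1 + z) = deriv ?p z"
  proof -
    have "- w1 \<in> periods ?p" by (intro periods_minus wp_period) simp
    then have "\<And>z. ?p (z + - w1) = ?p z" by (simp add: periods_def)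
    then show "?p (- w1 + z) = ?p z" "deriv ?p (- w1 + z) = deriv ?p z"
      using deriv_translate_period[of ?p "- w1" z] by (metis add.commute)+
  qed
  ultimately show False using w1 by (simp add: y_def)
qed

end

lemma lattice_of_is_lattice:
  assumes "is_lattice L"
  obtains w1 w2 where "lattice w1 w2 L"
proof -
  obtain w1 w2 where w: "w1 \<noteq> 0" "w2 \<noteq> 0" "w2 / w1 \<notin> \<real>" "L = {of_int m * w1 + of_int n * w2 | m n. True}"
    using assms unfolding is_lattice_def by blast
  have "lattice w1 w2 L"
    by standard (use w in \<open>auto simp: lattice_point_def\<close>)
  then show ?thesis by (rule that)
qed

text \<open>
  Multiplication by \<open>i\<close> permutes the square lattice and changes the sign of \<open>1/w\<^sup>6\<close>; multiplication by \<open>r\<close> scales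
  \<open>g\<^sub>2\<close> by \<open>r\<^sup>-\<^sup>4\<close>.
\<close>
lemma gauss_lattice:
  assumes "r \<noteq> 0"
  defines "L \<equiv> range (lattice_point r (r * \<i>))"
  shows "lattice r (r * \<i>) L" "is_lattice L" "lattice_g3 L = 0" "lattice_g2 L = lattice_g2 (range (lattice_point 1 \<i>)) / r ^ 4"
proof -
  show lat: "lattice r (r * \<i>) L"
    by standard (use assms in \<open>auto simp: complex_is_Real_iff\<close>)
  interpret lattice r "r * \<i>" L by (rule lat)
  show "is_lattice L"
    unfolding is_lattice_def using w1 w2
    by (intro exI[of _ r] exI[of _ "r * \<i>"]) (auto simp: L_def lattice_point_def)
  have iL: "\<i> * w \<in> L" if w: "w \<in> L" for w
  proof -
    obtain m n where "w = lattice_point r (r * \<i>) (m, n)" using w unfolding L_def by auto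
    then have "\<i> * w = lattice_point r (r * \<i>) (- n, m)" by (simp add: lattice_point_def algebra_simps)
    then show ?thesis unfolding L_def by blast
  qed
  have "- \<i> * w \<in> L" if "w \<in> L" for w using L_minus[OF iL[OF that]] by simp
  then have "bij_betw (\<lambda>w. \<i> * w) (L - {0}) (L - {0})"
    using iL by (intro bij_betwI[of _ _ _ "\<lambda>w. - \<i> * w"]) (auto simp flip: mult.assoc)
  then have "(\<Sum>\<^sub>\<infinity>w\<in>L - {0}. 1 / (\<i> * w) ^ 6) = (\<Sum>\<^sub>\<infinity>w\<in>L - {0}. 1 / w ^ 6)"
    by (rule infsum_reindex_bij_betw)
  moreover have "1 / (\<i> * w) ^ 6 = - (1 / w ^ 6)" for w
    using power_mult[of "\<i>" 2 3] by (simp add: power_mult_distrib)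
  ultimately have "- (\<Sum>\<^sub>\<infinity>w\<in>L - {0}. 1 / w ^ 6) = (\<Sum>\<^sub>\<infinity>w\<in>L - {0}. 1 / w ^ 6)"
    by (simp only: infsum_uminus)
  then show "lattice_g3 L = 0" by (simp add: lattice_g3_def)
  let ?M = "range (lattice_point 1 \<i>)"
  have "bij_betw (\<lambda>w. r * w) (?M - {0}) (L - {0})"
  proof (rule bij_betwI[of _ _ _ "\<lambda>w. w / r"])
    show "(\<lambda>w. r * w) \<in> ?M - {0} \<rightarrow> L - {0}"
    proof
      fix w assume w: "w \<in> ?M - {0}"
      then obtain m n where "w = lattice_point 1 \<i> (m, n)" by auto
      then have "r * w = lattice_point r (r * \<i>) (m, n)" by (simp add: lattice_point_def algebra_simps)
      then show "r * w \<in> L - {0}" using w assms(1) unfolding L_def by auto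
    qed
    show "(\<lambda>w. w / r) \<in> L - {0} \<rightarrow> ?M - {0}"
    proof
      fix w assume w: "w \<in> L - {0}"
      then obtain m n where "w = lattice_point r (r * \<i>) (m, n)" unfolding L_def by auto
      then have "w / r = lattice_point 1 \<i> (m, n)" using assms(1) by (simp add: lattice_point_def field_simps)
      then show "w / r \<in> ?M - {0}" using w assms(1) by auto
    qed
  qed (use assms in auto)
  then have "(\<Sum>\<^sub>\<infinity>w\<in>?M - {0}. 1 / (r * w) ^ 4) = (\<Sum>\<^sub>\<infinity>w\<in>L - {0}. 1 / w ^ 4)"
    by (rule infsum_reindex_bij_betw)
  moreover have "1 / (r * w) ^ 4 = 1 / r ^ 4 * (1 / w ^ 4)" for w by (simp add: power_mult_distrib)
  ultimately have E: "1 / r ^ 4 * (\<Sum>\<^sub>\<infinity>w\<in>?M - {0}. 1 / w ^ 4) = (\<Sum>\<^sub>\<infinity>w\<in>L - {0}. 1 / w ^ 4)"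
    by (simp only: infsum_cmult_right')
  then show "lattice_g2 L = lattice_g2 ?M / r ^ 4" unfolding lattice_g2_def E[symmetric] by simp
qed

lemma exists_fourth_root: "\<exists>r::complex. r ^ 4 = a"
proof -
  have "(csqrt (csqrt a)) ^ 4 = ((csqrt (csqrt a))\<^sup>2)\<^sup>2" using power_mult[of "csqrt (csqrt a)" 2 2] by (simp only: mult_2 numeral_plus_numeral add_num_simps)
  also have "\<dots> = a" by (simp only: power2_csqrt)
  finally show ?thesis by blast
qed

lemma lattice_with_invariants:
  assumes "g \<noteq> 0"
  shows "\<exists>L. is_lattice L \<and> lattice_g2 L = g \<and> lattice_g3 L = 0"
proof -
  let ?M = "range (lattice_point 1 \<i>)"
  have M: "lattice 1 \<i> ?M" "lattice_g3 ?M = 0" using gauss_lattice[of 1] by simp_all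
  have g0: "lattice_g2 ?M \<noteq> 0" using lattice.invariants_not_both_zero[OF M(1)] M(2) by simp
  obtain r where r: "r ^ 4 = lattice_g2 ?M / g" using exists_fourth_root by blast
  then have "r \<noteq> 0" using g0 assms by auto
  from gauss_lattice(2-4)[OF this] show ?thesis using r g0 assms by auto
qed

text \<open>
  For these invariants the choice in the definition of \<open>weierstrass_wp\<close> is made from a nonempty set. Whichever
  lattice it yields, only its invariants enter the argument below.
\<close>
lemma weierstrass_wp_lattice:
  assumes "g \<noteq> 0"
  obtains w1 w2 \<Lambda> where "lattice w1 w2 \<Lambda>" "lattice_g2 \<Lambda> = g" "lattice_g3 \<Lambda> = 0" "weierstrass_wp g 0 = lattice_wp \<Lambda>"
proof -
  define \<Lambda> where "\<Lambda> = (SOME \<Lambda>. is_lattice \<Lambda> \<and> lattice_g2 \<Lambda> = g \<and> lattice_g3 \<Lambda> = 0)"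
  have "is_lattice \<Lambda> \<and> lattice_g2 \<Lambda> = g \<and> lattice_g3 \<Lambda> = 0"
    unfolding \<Lambda>_def by (rule someI_ex[OF lattice_with_invariants[OF assms]])
  moreover from this obtain w1 w2 where "lattice w1 w2 \<Lambda>" using lattice_of_is_lattice by blast
  ultimately show ?thesis using that by (simp add: weierstrass_wp_def \<Lambda>_def)
qed

definition wp_solution :: "complex \<Rightarrow> (complex \<Rightarrow> complex) \<Rightarrow> complex \<Rightarrow> complex" where
  "wp_solution k p z = - (1 / (2 * k)) * (((8 * p z + k\<^sup>2)\<^sup>2 * deriv p z) / (p z * (64 * (p z)\<^sup>2 + k ^ 4)))"

text \<open>
  Here \<open>x\<close> and \<open>p\<close> stand for \<open>\<wp>\<close> and \<open>\<wp>'\<close>. The key identity is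
  \<open>(X + l)\<^sup>4 - 8 l X (X\<^sup>2 + l\<^sup>2) = (X - l)\<^sup>4\<close> with \<open>X = 8 x\<close> and \<open>l = k\<^sup>2\<close>; it makes \<open>u\<^sup>2 - 1\<close> a fourth power up to the
  denominator. The number whose fourth power is taken in the last equation is the derivative of \<open>u\<close>.
\<close>
lemma wp_solution_algebra:
  fixes k x p :: complex
  assumes k: "k \<noteq> 0" and p: "p \<noteq> 0" and ode: "16 * p\<^sup>2 = x * (64 * x\<^sup>2 + k ^ 4)"
  defines "u \<equiv> - ((8 * x + k\<^sup>2)\<^sup>2 / (32 * k * p))"
  shows "- (1 / (2 * k)) * (((8 * x + k\<^sup>2)\<^sup>2 * p) / (x * (64 * x\<^sup>2 + k ^ 4))) = u"
    and "u\<^sup>2 - 1 = (8 * x - k\<^sup>2) ^ 4 / (1024 * k\<^sup>2 * p\<^sup>2)"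
    and "(- ((8 * x + k\<^sup>2) * (8 * x - k\<^sup>2) ^ 3 / (1024 * k * p\<^sup>2))) ^ 4 = k ^ 4 * (u\<^sup>2 * (u\<^sup>2 - 1) ^ 3)"
proof -
  show "- (1 / (2 * k)) * (((8 * x + k\<^sup>2)\<^sup>2 * p) / (x * (64 * x\<^sup>2 + k ^ 4))) = u"
    unfolding ode[symmetric] u_def using k p by (simp add: field_simps power2_eq_square)
  have u2: "u\<^sup>2 = (8 * x + k\<^sup>2) ^ 4 / (1024 * k\<^sup>2 * p\<^sup>2)"
    unfolding u_def by (simp add: power_divide power_mult_distrib flip: power_mult)
  have "(8 * x + k\<^sup>2) ^ 4 - 64 * k\<^sup>2 * (x * (64 * x\<^sup>2 + k ^ 4)) = (8 * x - k\<^sup>2) ^ 4"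
    by (simp add: algebra_simps eval_nat_numeral)
  then have e: "(8 * x + k\<^sup>2) ^ 4 - 1024 * k\<^sup>2 * p\<^sup>2 = (8 * x - k\<^sup>2) ^ 4"
    unfolding ode[symmetric] by (simp add: algebra_simps)
  show u21: "u\<^sup>2 - 1 = (8 * x - k\<^sup>2) ^ 4 / (1024 * k\<^sup>2 * p\<^sup>2)"
    unfolding u2 e[symmetric] using k p by (simp add: diff_divide_distrib)
  define A where "A = 8 * x + k\<^sup>2"
  define B where "B = 8 * x - k\<^sup>2"
  have "(- (A * B ^ 3 / (1024 * k * p\<^sup>2))) ^ 4 = k ^ 4 * (A ^ 4 / (1024 * k\<^sup>2 * p\<^sup>2) * (B ^ 4 / (1024 * k\<^sup>2 * p\<^sup>2)) ^ 3)"
    using k p by (simp add: power_divide power_mult_distrib flip: power_mult) (simp add: field_simps eval_nat_numeral)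
  then show "(- ((8 * x + k\<^sup>2) * (8 * x - k\<^sup>2) ^ 3 / (1024 * k * p\<^sup>2))) ^ 4 = k ^ 4 * (u\<^sup>2 * (u\<^sup>2 - 1) ^ 3)"
    unfolding u21 unfolding u2 A_def B_def .
qed

context lattice
begin

text \<open>
  The function satisfies the quartic equation of \<open>schwarzian_of_quartic\<close> with constant \<open>k\<^sup>4\<close> off the sparse set where
  \<open>\<wp>\<close> has a pole or one of \<open>\<wp>'\<close>, \<open>8 \<wp> + k\<^sup>2\<close>, \<open>8 \<wp> - k\<^sup>2\<close> vanishes.
\<close>
lemma wp_solution_is_solution:
  assumes k: "k \<noteq> 0" and g2: "lattice_g2 L = - (k ^ 4 / 16)" and g3: "lattice_g3 L = 0"
    and c: "c = 9 * k ^ 4 / 4" and s: "{s1, s2} = {\<i> / 2, - \<i> / 2}"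
  shows "schwarzian_solution c s1 s2 (remove_sings (wp_solution k (wp)))"
    "\<forall>\<^sub>\<approx>z\<in>UNIV. remove_sings (wp_solution k (wp)) z = wp_solution k (wp) z"
proof -
  let ?p = "wp" and ?U = "wp_solution k (wp)"
  let ?V = "remove_sings ?U"
  have mero: "?U meromorphic_on UNIV"
    unfolding wp_solution_def[abs_def] by (intro meromorphic_intros wp_meromorphic)
  then show eq: "\<forall>\<^sub>\<approx>z\<in>UNIV. ?V z = ?U z" by (rule eventually_remove_sings_eq)
  have nice: "?V nicely_meromorphic_on UNIV" using mero by (rule remove_sings_nicely_meromorphic)
  have ode: "16 * (deriv ?p z)\<^sup>2 = ?p z * (64 * (?p z)\<^sup>2 + k ^ 4)" if "z \<notin> L" for z
    unfolding wp_ode[OF that] g2 g3 by (simp add: algebra_simps eval_nat_numeral)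
  define T where "T = {z. z \<notin> L \<and> ?p z * (64 * (?p z)\<^sup>2 + k ^ 4) \<noteq> 0 \<and> 8 * ?p z + k\<^sup>2 \<noteq> 0 \<and> 8 * ?p z - k\<^sup>2 \<noteq> 0}"
  have T: "\<forall>\<^sub>\<approx>z\<in>UNIV. z \<in> T"
  proof -
    \<comment> \<open>All exceptional conditions are polynomial in \<open>\<wp>\<close>: the first two factors account for the zeros of \<open>\<wp>'\<close>.\<close>
    define Q where "Q = [:0, 1:] * [:k ^ 4, 0, 64:] * [:k\<^sup>2, 8:] * [:- (k\<^sup>2), 8:]"
    have "finite {x. poly Q x = 0}" by (rule poly_roots_finite) (simp add: Q_def)
    then have "\<forall>\<^sub>\<approx>z\<in>UNIV. \<forall>x\<in>{x. poly Q x = 0}. ?p z \<noteq> x"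
      by (rule eventually_ball_finite) (auto intro: wp_avoids)
    with cosparse_not_L show ?thesis
    proof eventually_elim
      case (elim z)
      have "poly Q x = x * (64 * x\<^sup>2 + k ^ 4) * ((8 * x + k\<^sup>2) * (8 * x - k\<^sup>2))" for x
        by (simp add: Q_def algebra_simps power2_eq_square)
      moreover have "poly Q (?p z) \<noteq> 0" using elim(2) by auto
      ultimately show ?case using elim(1) unfolding T_def by (metis (mono_tags, lifting) mem_Collect_eq mult_zero_left mult_zero_right)
    qed
  qed
  have openT: "open T"
  proof -
    have "closed {z. z \<notin> T}" using T by (intro sparse_in_UNIV_imp_closed) (simp add: eventually_cosparse)
    then show ?thesis by (simp add: closed_def Compl_eq)
  qed
  have pT: "z \<notin> L" "deriv ?p z \<noteq> 0" "8 * ?p z + k\<^sup>2 \<noteq> 0" "8 * ?p z - k\<^sup>2 \<noteq> 0" if "z \<in> T" for z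
    using that ode[of z] by (auto simp: T_def)
  define u where "u z = - ((8 * ?p z + k\<^sup>2)\<^sup>2 / (32 * k * deriv ?p z))" for z
  have Uu: "?U z = u z" if "z \<in> T" for z
    unfolding wp_solution_def u_def using wp_solution_algebra(1)[OF k pT(2)[OF that] ode[OF pT(1)[OF that]]] .
  have u2: "(u z)\<^sup>2 - 1 = (8 * ?p z - k\<^sup>2) ^ 4 / (1024 * k\<^sup>2 * (deriv ?p z)\<^sup>2)" if "z \<in> T" for z
    unfolding u_def using wp_solution_algebra(2)[OF k pT(2)[OF that] ode[OF pT(1)[OF that]]] .
  have nz: "u z \<noteq> 0 \<and> (u z)\<^sup>2 \<noteq> 1" if "z \<in> T" for z
  proof
    show "u z \<noteq> 0" using pT[OF that] k by (simp add: u_def)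
    have "(u z)\<^sup>2 - 1 \<noteq> 0" unfolding u2[OF that] using pT[OF that] k by simp
    then show "(u z)\<^sup>2 \<noteq> 1" by simp
  qed
  have du: "(u has_field_derivative - ((8 * ?p z + k\<^sup>2) * (8 * ?p z - k\<^sup>2) ^ 3 / (1024 * k * (deriv ?p z)\<^sup>2))) (at z)"
    if z: "z \<in> T" for z
  proof -
    let ?x = "?p z" and ?d = "deriv ?p z"
    have d2: "deriv (deriv ?p) z = 6 * ?x\<^sup>2 + k ^ 4 / 32"
      using wp_second_derivative[OF pT(1,2)[OF z]] by (simp add: g2)
    have "(u has_field_derivative
       - ((2 * (8 * ?x + k\<^sup>2) * (8 * ?d) * (32 * k * ?d) - (8 * ?x + k\<^sup>2)\<^sup>2 * (32 * k * deriv (deriv ?p) z)) / ((32 * k * ?d) * (32 * k * ?d)))) (at z)"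
      unfolding u_def[abs_def] using wp_analytic_derivs[OF pT(1)[OF z]] pT(2)[OF z] k
      by (auto intro!: derivative_eq_intros)
    also have "(2 * (8 * ?x + k\<^sup>2) * (8 * ?d) * (32 * k * ?d) - (8 * ?x + k\<^sup>2)\<^sup>2 * (32 * k * deriv (deriv ?p) z)) / ((32 * k * ?d) * (32 * k * ?d))
       = (8 * ?x + k\<^sup>2) * (8 * ?x - k\<^sup>2) ^ 3 / (1024 * k * ?d\<^sup>2)"
    proof -
      have "2 * (8 * ?x + k\<^sup>2) * (8 * ?d) * (32 * k * ?d) - (8 * ?x + k\<^sup>2)\<^sup>2 * (32 * k * deriv (deriv ?p) z) =
        k * (8 * ?x + k\<^sup>2) * (32 * (16 * ?d\<^sup>2) - (8 * ?x + k\<^sup>2) * (32 * deriv (deriv ?p) z))"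
        by (simp add: algebra_simps power2_eq_square)
      also have "32 * (16 * ?d\<^sup>2) - (8 * ?x + k\<^sup>2) * (32 * deriv (deriv ?p) z) = (8 * ?x - k\<^sup>2) ^ 3"
        unfolding ode[OF pT(1)[OF z]] d2 by (simp add: algebra_simps eval_nat_numeral)
      finally show ?thesis using k pT(2)[OF z] by (simp add: field_simps power2_eq_square)
    qed
    finally show ?thesis .
  qed
  have hu: "u holomorphic_on T" using du openT by (meson holomorphic_on_open)
  have quartic: "deriv u z ^ 4 = k ^ 4 * ((u z)\<^sup>2 * ((u z)\<^sup>2 - 1) ^ 3)" if "z \<in> T" for z
    unfolding DERIV_imp_deriv[OF du[OF that]] unfolding u_def
    by (rule wp_solution_algebra(3)[OF k pT(2)[OF that] ode[OF pT(1)[OF that]]])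
  have Vu: "\<forall>\<^sub>\<approx>z\<in>UNIV. ?V z = u z" using eq T by eventually_elim (simp add: Uu)
  have num: "(w - s1)\<^sup>2 * (w - s2)\<^sup>2 = (w\<^sup>2 + 1 / 4)\<^sup>2" for w
  proof -
    have "s1 = \<i> / 2 \<and> s2 = - \<i> / 2 \<or> s1 = - \<i> / 2 \<and> s2 = \<i> / 2" using s by (auto simp: doubleton_eq_iff)
    moreover have "(w - \<i> / 2) * (w - - \<i> / 2) = w\<^sup>2 + 1 / 4" by (simp add: algebra_simps power2_eq_square)
    then have "(w - \<i> / 2)\<^sup>2 * (w - - \<i> / 2)\<^sup>2 = (w\<^sup>2 + 1 / 4)\<^sup>2" by (simp only: power_mult_distrib[symmetric])
    ultimately show ?thesis by (metis mult.commute)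
  qed
  show "schwarzian_solution c s1 s2 ?V"
  proof
    show "c \<noteq> 0" unfolding c using k by simp
    show "s1 \<notin> {0, 1, - 1}" "s2 \<notin> {0, 1, - 1}" using s by (auto simp: doubleton_eq_iff complex_eq_iff)
    show "?V nicely_meromorphic_on UNIV" by (rule nice)
    show "\<not> ?V constant_on UNIV"
    proof
      assume "?V constant_on UNIV"
      then obtain b where "\<And>z. ?V z = b" by (auto simp: constant_on_def)
      then have "\<forall>\<^sub>\<approx>z\<in>UNIV. u z = b" using Vu by (auto elim: eventually_mono)
      from cosparse_eventually_nhds[OF this] T
      have "\<forall>\<^sub>\<approx>z\<in>(UNIV :: complex set). False"
      proof eventually_elim
        case (elim z)
        then have "deriv u z = deriv (\<lambda>_. b) z" by (intro deriv_cong_ev) auto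
        then show ?case using quartic[OF elim(2)] nz[OF elim(2)] k by auto
      qed
      then show False by simp
    qed
    show "\<forall>\<^sub>\<approx>z\<in>UNIV. (schwarzian ?V z)\<^sup>2 * ((?V z)\<^sup>2 * (?V z - 1) * (?V z + 1)) = c * ((?V z - s1)\<^sup>2 * (?V z - s2)\<^sup>2)"
      using cosparse_eventually_nhds[OF Vu] T
    proof eventually_elim
      case (elim z)
      have 1: "schwarzian ?V z = schwarzian u z" using elim(1) by (rule schwarzian_cong)
      have 2: "?V z = u z" using elim(1) by (rule eventually_nhds_x_imp_x)
      have "k ^ 4 \<noteq> 0" using k by simp
      from schwarzian_of_quartic[OF openT hu this quartic nz elim(2)]
      have "(schwarzian u z)\<^sup>2 * ((u z)\<^sup>2 * ((u z)\<^sup>2 - 1)) = 9 / 4 * k ^ 4 * ((u z)\<^sup>2 + 1 / 4)\<^sup>2" .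
      moreover have "(u z)\<^sup>2 * (u z - 1) * (u z + 1) = (u z)\<^sup>2 * ((u z)\<^sup>2 - 1)"
        by (simp add: algebra_simps power2_eq_square)
      ultimately show ?case unfolding 1 2 num c by (simp only: mult_ac) (simp add: mult_ac)
    qed
  qed
qed

end

theorem theorem6:
  fixes c \<tau>\<^sub>1 \<tau>\<^sub>2 \<tau>\<^sub>3 \<sigma>\<^sub>1 \<sigma>\<^sub>2 :: complex
  assumes "c \<noteq> 0"
    and "\<tau>\<^sub>1 = 0" and "\<tau>\<^sub>2 = 1" and "\<tau>\<^sub>3 = -1"
    and "\<sigma>\<^sub>1 \<notin> {\<tau>\<^sub>1, \<tau>\<^sub>2, \<tau>\<^sub>3}" and "\<sigma>\<^sub>2 \<notin> {\<tau>\<^sub>1, \<tau>\<^sub>2, \<tau>\<^sub>3}"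
  shows "(\<forall>u. transcendental_meromorphic u \<and> schwarzian_ode_solution c \<sigma>\<^sub>1 \<sigma>\<^sub>2 \<tau>\<^sub>1 \<tau>\<^sub>2 \<tau>\<^sub>3 u
      \<longrightarrow> elliptic_function u) \<and>
    ((\<exists>u. transcendental_meromorphic u \<and> schwarzian_ode_solution c \<sigma>\<^sub>1 \<sigma>\<^sub>2 \<tau>\<^sub>1 \<tau>\<^sub>2 \<tau>\<^sub>3 u) \<longleftrightarrow> {\<sigma>\<^sub>1, \<sigma>\<^sub>2} = {\<i> / 2, - \<i> / 2}) \<and>
    ({\<sigma>\<^sub>1, \<sigma>\<^sub>2} = {\<i> / 2, - \<i> / 2} \<longrightarrow>
      (\<forall>L g\<^sub>2 g\<^sub>3. c = 9 * L ^ 4 / 4 \<and> g\<^sub>2 = - c / 36 \<and> g\<^sub>3 = 0 \<longrightarrow>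
        (\<forall>u. transcendental_meromorphic u \<and> schwarzian_ode_solution c \<sigma>\<^sub>1 \<sigma>\<^sub>2 \<tau>\<^sub>1 \<tau>\<^sub>2 \<tau>\<^sub>3 u
          \<longleftrightarrow>
          (\<exists>z\<^sub>0. \<forall>\<^sub>\<approx>z\<in>UNIV. u z =
             - (1 / (2 * L)) *
             (((8 * weierstrass_wp g\<^sub>2 g\<^sub>3 (z - z\<^sub>0) + L\<^sup>2)\<^sup>2 * deriv (weierstrass_wp g\<^sub>2 g\<^sub>3) (z - z\<^sub>0)) /
              (weierstrass_wp g\<^sub>2 g\<^sub>3 (z - z\<^sub>0) *
               (64 * (weierstrass_wp g\<^sub>2 g\<^sub>3 (z - z\<^sub>0))\<^sup>2 + L ^ 4)))))))"
proof -
  note [simp] = assms(2-4)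
  have s: "\<sigma>\<^sub>1 \<notin> {0, 1, -1}" "\<sigma>\<^sub>2 \<notin> {0, 1, -1}" using assms(5,6) by simp_all
  let ?sol = "\<lambda>u. transcendental_meromorphic u \<and> schwarzian_ode_solution c \<sigma>\<^sub>1 \<sigma>\<^sub>2 \<tau>\<^sub>1 \<tau>\<^sub>2 \<tau>\<^sub>3 u"
  have sol: "schwarzian_solution c \<sigma>\<^sub>1 \<sigma>\<^sub>2 (remove_sings u)" "\<forall>\<^sub>\<approx>z\<in>UNIV. u z = remove_sings u z" if "?sol u" for u
    using schwarzian_solution_of_transcendental[OF assms(1) s, of u] that by simp_all
  have ell: "elliptic_function u" if "?sol u" for u
    using elliptic_of_schwarzian_solution[OF sol[OF that]] .
  have sig: "{\<sigma>\<^sub>1, \<sigma>\<^sub>2} = {\<i> / 2, - \<i> / 2}" if "?sol u" for u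
    using schwarzian_solution.sigma_values[OF sol(1)[OF that]] .
  have wp: "\<exists>w. schwarzian_solution c \<sigma>\<^sub>1 \<sigma>\<^sub>2 w \<and> (\<forall>\<^sub>\<approx>z\<in>UNIV. w z = wp_solution L (weierstrass_wp (- c / 36) 0) z)"
    if sg: "{\<sigma>\<^sub>1, \<sigma>\<^sub>2} = {\<i> / 2, - \<i> / 2}" and cL: "c = 9 * L ^ 4 / 4" for L
  proof -
    have L: "L \<noteq> 0" using cL assms(1) by auto
    have "- c / 36 \<noteq> 0" using assms(1) by simp
    then obtain w1 w2 \<Lambda> where \<Lambda>: "lattice w1 w2 \<Lambda>" "lattice_g2 \<Lambda> = - c / 36" "lattice_g3 \<Lambda> = 0"
      "weierstrass_wp (- c / 36) 0 = lattice_wp \<Lambda>"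
      by (rule weierstrass_wp_lattice)
    have "lattice_g2 \<Lambda> = - (L ^ 4 / 16)" unfolding \<Lambda>(2) cL by simp
    from lattice.wp_solution_is_solution[OF \<Lambda>(1) L this \<Lambda>(3) cL sg] show ?thesis unfolding \<Lambda>(4) by blast
  qed
  have ex: "\<exists>u. ?sol u" if sg: "{\<sigma>\<^sub>1, \<sigma>\<^sub>2} = {\<i> / 2, - \<i> / 2}"
  proof -
    obtain L where "L ^ 4 = 4 * c / 9" using exists_fourth_root by blast
    then have "c = 9 * L ^ 4 / 4" by (simp add: field_simps)
    from wp[OF sg this] obtain w where "schwarzian_solution c \<sigma>\<^sub>1 \<sigma>\<^sub>2 w" by blast
    from transcendental_of_schwarzian_solution[OF this, of w] show ?thesis by auto
  qed
  have all: "?sol u \<longleftrightarrow> (\<exists>z\<^sub>0. \<forall>\<^sub>\<approx>z\<in>UNIV. u z = wp_solution L (weierstrass_wp (- c / 36) 0) (z - z\<^sub>0))"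
    if sg: "{\<sigma>\<^sub>1, \<sigma>\<^sub>2} = {\<i> / 2, - \<i> / 2}" and cL: "c = 9 * L ^ 4 / 4" for L u
  proof -
    let ?W = "wp_solution L (weierstrass_wp (- c / 36) 0)"
    obtain w where w: "schwarzian_solution c \<sigma>\<^sub>1 \<sigma>\<^sub>2 w" "\<forall>\<^sub>\<approx>z\<in>UNIV. w z = ?W z" using wp[OF sg cL] by blast
    have w': "\<forall>\<^sub>\<approx>z\<in>UNIV. w (- z0 + z) = ?W (z - z0)" for z0
      unfolding eventually_cosparse_open_eq[OF open_UNIV]
    proof
      fix a
      have "\<forall>\<^sub>F z in at (- z0 + a). w z = ?W z" using eventually_cosparse_imp_eventually_at[OF w(2)] by simp
      then show "\<forall>\<^sub>F z in at a. w (- z0 + z) = ?W (z - z0)"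
        unfolding filtermap_plus_at[symmetric] eventually_filtermap by simp
    qed
    show ?thesis
    proof
      assume u: "?sol u"
      obtain z0 where z0: "\<And>z. remove_sings u z = w (z - z0)"
        using schwarzian_solution.translate_of_solution[OF sol(1)[OF u] w(1)] by blast
      have "\<forall>\<^sub>\<approx>z\<in>UNIV. u z = ?W (z - z0)"
        using sol(2)[OF u] w'[of z0] by eventually_elim (simp add: z0)
      then show "\<exists>z\<^sub>0. \<forall>\<^sub>\<approx>z\<in>UNIV. u z = ?W (z - z\<^sub>0)" by blast
    next
      assume "\<exists>z\<^sub>0. \<forall>\<^sub>\<approx>z\<in>UNIV. u z = ?W (z - z\<^sub>0)"
      then obtain z0 where "\<forall>\<^sub>\<approx>z\<in>UNIV. u z = ?W (z - z0)" by blast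
      with w'[of z0] have "\<forall>\<^sub>\<approx>z\<in>UNIV. u z = w (- z0 + z)" by eventually_elim simp
      from transcendental_of_schwarzian_solution[OF schwarzian_solution.translate_solution[OF w(1)] this]
      show "?sol u" by simp
    qed
  qed
  show ?thesis
    using ell sig ex all unfolding wp_solution_def by blast
qed

end
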